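(* Let $t\mapsto A(t)$ be a real analytic map from an open interval $I$ to $\mathbb{P}(2n)$. Then one can choose $n$ symplectic eigenvalue functions and a corresponding symplectic eigenbasis map that are real analytic on $I$; i.e. there exist real analytic functions $\tilde d_1,\dots,\tilde d_n:I\to\mathbb{R}$ and real analytic maps $\tilde u_1,\dots,\tilde u_n,\tilde v_1,\dots,\tilde v_n:I\to\mathbb{R}^{2n}$ such that for every $t\in I$, $\tilde d_1(t),\dots,\tilde d_n(t)$ are the $n$ symplectic eigenvalues of $A(t)$ counted with multiplicity and $\{\tilde u_1(t),\dots,\tilde u_n(t),\tilde v_1(t),\dots,\tilde v_n(t)\}$ is a symplectic eigenbasis of $A(t)$ corresponding to them.
   Context: Let $J=\begin{bmatrix}O & I_n\\ -I_n & O\end{bmatrix}$ ($2n\times 2n$). A real $2n\times 2n$ matrix $M$ is symplectic if $M^TJM=J$. $\mathbb{P}(2n)$ denotes the set of $2n\times 2n$ real symmetric positive definite matrices. By Williamson's theorem, for every $A\in\mathbb{P}(2n)$ there is a symplectic $M$ with $M^TAM=\begin{bmatrix}D&O\\O&D\end{bmatrix}$, $D=\mathrm{diag}(d_1(A),\dots,d_n(A))$, where $0<d_1(A)\le\dots\le d_n(A)$ are uniquely determined by $A$; they are the symplectic eigenvalues of $A$, counted with multiplicity. $\langle\cdot,\cdot\rangle$ is the Euclidean inner product. A symplectic basis of $\mathbb{R}^{2n}$ is a set $\{u_1,\dots,u_n,v_1,\dots,v_n\}$ with $\langle u_i,Jv_j\rangle=\delta_{ij}$ and $\langle u_i,Ju_j\rangle=\langle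 v_i,Jv_j\rangle=0$ for all $i,j$. A symplectic eigenbasis of $A$ corresponding to $\tilde d_1,\dots,\tilde d_n$ is a symplectic basis with $Au_i=\tilde d_iJv_i$ and $Av_i=-\tilde d_iJu_i$ for each $i$. *)

theory Defs
  imports "HOL-Analysis.Analysis" "HOL-Library.Multiset"
begin

text \<open>
  Vectors of length \<open>2n\<close> are indexed by \<open>'n + 'n\<close>, where \<open>'n\<close> is a finite linearly ordered type
  standing for \<open>{1, \<dots>, n}\<close>; \<open>Inl i\<close> is the \<open>i\<close>-th coordinate and \<open>Inr i\<close> the \<open>(n + i)\<close>-th.
\<close>

definition block_matrix ::
    "'a^'n^'n \<Rightarrow> 'a^'n^'n \<Rightarrow> 'a^'n^'n \<Rightarrow> 'a^'n^'n \<Rightarrow> 'a^('n + 'n)^('n + 'n)" where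
  "block_matrix P Q R S =
    (\<chi> i j. case i of
       Inl a \<Rightarrow> (case j of Inl b \<Rightarrow> P $ a $ b | Inr b \<Rightarrow> Q $ a $ b)
     | Inr a \<Rightarrow> (case j of Inl b \<Rightarrow> R $ a $ b | Inr b \<Rightarrow> S $ a $ b))"

definition diagonal_matrix :: "('n \<Rightarrow> real) \<Rightarrow> real^'n^'n" where
  "diagonal_matrix d = (\<chi> i j. if i = j then d i else 0)"

definition symplectic_J :: "real^('n::finite + 'n)^('n + 'n)" where
  "symplectic_J = block_matrix 0 (mat 1) (- mat 1) 0"

definition symplectic_matrix :: "real^('n::finite + 'n)^('n + 'n) \<Rightarrow> bool" where
  "symplectic_matrix M \<longleftrightarrow> transpose M ** symplectic_J ** M = symplectic_J"

definition positive_definite :: "real^'m^'m \<Rightarrow> bool" where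
  "positive_definite A \<longleftrightarrow> transpose A = A \<and> (\<forall>x. x \<noteq> 0 \<longrightarrow> 0 < x \<bullet> (A *v x))"

text \<open>
  \<open>symplectic_eigenvalue A i\<close> is \<open>d\<^sub>i(A)\<close>, in increasing order. For positive definite \<open>A\<close> the
  description is well defined by Williamson's theorem.
\<close>

definition symplectic_eigenvalue ::
    "real^('n::{finite,linorder} + 'n)^('n + 'n) \<Rightarrow> 'n \<Rightarrow> real" where
  "symplectic_eigenvalue A =
    (THE d. (\<forall>i. 0 < d i) \<and> mono d \<and>
       (\<exists>M. symplectic_matrix M \<and>
          transpose M ** A ** M = block_matrix (diagonal_matrix d) 0 0 (diagonal_matrix d)))"

text \<open>The relations below already imply that the \<open>u i\<close> and \<open>v i\<close> form a basis.\<close>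

definition symplectic_basis ::
    "('n::finite \<Rightarrow> real^('n + 'n)) \<Rightarrow> ('n \<Rightarrow> real^('n + 'n)) \<Rightarrow> bool" where
  "symplectic_basis u v \<longleftrightarrow>
    (\<forall>i j. u i \<bullet> (symplectic_J *v v j) = (if i = j then 1 else 0) \<and>
           u i \<bullet> (symplectic_J *v u j) = 0 \<and>
           v i \<bullet> (symplectic_J *v v j) = 0)"

definition symplectic_eigenbasis ::
    "real^('n::finite + 'n)^('n + 'n) \<Rightarrow> ('n \<Rightarrow> real) \<Rightarrow>
     ('n \<Rightarrow> real^('n + 'n)) \<Rightarrow> ('n \<Rightarrow> real^('n + 'n)) \<Rightarrow> bool" where
  "symplectic_eigenbasis A d u v \<longleftrightarrow>
    symplectic_basis u v \<and>
    (\<forall>i. A *v u i = d i *\<^sub>R (symplectic_J *v v i) \<and>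
         A *v v i = - (d i *\<^sub>R (symplectic_J *v u i)))"

text \<open>
  Local convergent power series expansions; meant for open \<open>S\<close>, where the values of \<open>f\<close>
  outside \<open>S\<close> are irrelevant.
\<close>

definition real_analytic_on :: "(real \<Rightarrow> 'a::real_normed_vector) \<Rightarrow> real set \<Rightarrow> bool" where
  "real_analytic_on f S \<longleftrightarrow>
    (\<forall>x\<in>S. \<exists>r>0. \<exists>c :: nat \<Rightarrow> 'a. \<forall>y. \<bar>y - x\<bar> < r \<longrightarrow>
       (\<lambda>k. (y - x) ^ k *\<^sub>R c k) sums f y)"

end

theory Submission
  imports Defs "HOL-Complex_Analysis.Cauchy_Integral_Formula"
begin

text \<open>
  Put \<open>K = J A\<close> and \<open>T = - K\<^sup>2\<close>. Both \<open>T\<close> and its spectral projections are self-adjoint for the inner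
  product \<open>x \<bullet> A y\<close> and commute with \<open>K\<close>; the eigenvalues of \<open>T\<close> are the \<open>d\<^sub>i\<^sup>2\<close>, each of even multiplicity.
  Locally, after subtracting a Rayleigh quotient and dividing by a power of \<open>t - t\<^sub>0\<close>, \<open>T\<close> is not scalar at
  \<open>t\<^sub>0\<close>, and a spectral projection at \<open>t\<^sub>0\<close> extends analytically as the limit of the Newton iteration
  \<open>X \<mapsto> 3 X\<^sup>2 - 2 X\<^sup>3\<close>; induction on the rank gives finitely many analytic eigenvalues. These continue
  along \<open>I\<close>. If \<open>(T - l\<^sub>0) \<dots> (T - l\<^sub>k) P = 0\<close>, then \<open>f = (T - l\<^sub>1) \<dots> (T - l\<^sub>k) P\<close> satisfies
  \<open>f\<^sup>2 = h f\<close> with \<open>h = (l\<^sub>0 - l\<^sub>1) \<dots> (l\<^sub>0 - l\<^sub>k)\<close>, so \<open>f / h\<close> is the spectral projection of \<open>l\<^sub>0\<close>, and it is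
  analytic even where \<open>h\<close> vanishes. The kernel of a nonzero \<open>K\<close>-invariant projection \<open>Q t\<close> has
  codimension at least 2, so some constant vector \<open>w\<close> avoids all these kernels; \<open>u\<close> is \<open>Q w\<close> normalised and
  \<open>v = - K u / d\<close>. Splitting off the plane of \<open>u, v\<close> and iterating gives the eigenbasis.
\<close>

section \<open>Real analytic functions of one variable\<close>

text \<open>The obstacle is crossings of eigenvalues: there the increasingly ordered
  \<open>symplectic_eigenvalue\<close> functions need not be differentiable, and eigenvectors chosen
  point by point may jump. With a single real parameter this can be repaired, because an analytic
  function that is not identically zero has isolated zeros and can be divided by a power of t - t0.
  Squaring K keeps everything real: K is skew for x . A y and has imaginary eigenvalues, whereas -
  K^2 is self-adjoint. Definiteness of this inner product leaves no room for nonzero self-adjoint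
  nilpotents, and this is what keeps the quotient f / h analytic at the zeros of h, the crossings.
  Newton's iteration suits the lifting because its iterates are polynomials, so that commutation and
  self-adjointness pass through every iterate to the limit, and because it converges uniformly on a
  small complex disc. The projections lifted in this way only serve to find germs of eigenvalues and
  are not continued along I; the global projections are built afresh from the continued
  eigenvalues.\<close>

definition real_analytic_at :: "(real \<Rightarrow> 'a::real_normed_vector) \<Rightarrow> real \<Rightarrow> bool" where
  "real_analytic_at f x \<longleftrightarrow>
    (\<exists>r>0. \<exists>c. \<forall>y. \<bar>y - x\<bar> < r \<longrightarrow> (\<lambda>k. (y - x) ^ k *\<^sub>R c k) sums f y)"

lemma real_analytic_on_iff_at: "real_analytic_on f S \<longleftrightarrow> (\<forall>x\<in>S. real_analytic_at f x)"
  by (simp add: real_analytic_on_def real_analytic_at_def)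

lemma eventually_nhds_real: "eventually P (nhds (x::real)) \<longleftrightarrow> (\<exists>r>0. \<forall>y. \<bar>y - x\<bar> < r \<longrightarrow> P y)"
  by (simp add: eventually_nhds_metric dist_real_def)

lemma real_analytic_at_cong:
  assumes "real_analytic_at f x" "\<forall>\<^sub>F y in nhds x. f y = g y"
  shows "real_analytic_at g x"
proof -
  obtain r c where r: "r > 0" and c: "\<And>y. \<bar>y - x\<bar> < r \<Longrightarrow> (\<lambda>k. (y - x) ^ k *\<^sub>R c k) sums f y"
    using assms(1) unfolding real_analytic_at_def by blast
  obtain s where s: "s > 0" and fg: "\<And>y. \<bar>y - x\<bar> < s \<Longrightarrow> f y = g y"
    using assms(2) unfolding eventually_nhds_real by blast
  show ?thesis unfolding real_analytic_at_def
    by (rule exI[of _ "min r s"]) (use r s c fg in force)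
qed

text \<open>The series converges at the real points \<open>x + q\<close> for all q below r, hence on
  the whole complex disc. Working with the extension replaces manipulation of products, quotients
  and recentred series by closure properties of holomorphic functions.\<close>

lemma real_analytic_at_holomorphic_extension:
  fixes f :: "real \<Rightarrow> real"
  assumes "real_analytic_at f x"
  obtains r F where "r > 0" "F holomorphic_on ball (of_real x) r"
    "\<And>y. \<bar>y - x\<bar> < r \<Longrightarrow> F (of_real y) = of_real (f y)"
proof -
  obtain r c where r: "r > 0" and c: "\<And>y. \<bar>y - x\<bar> < r \<Longrightarrow> (\<lambda>k. (y - x) ^ k *\<^sub>R c k) sums f y"
    using assms unfolding real_analytic_at_def by blast
  define F where "F z = (\<Sum>k. of_real (c k) * (z - of_real x) ^ k)" for z :: complex
  have real: "(\<lambda>k. of_real (c k) * (of_real y - of_real x) ^ k) sums (of_real (f y) :: complex)"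
    if "\<bar>y - x\<bar> < r" for y
    using sums_of_real[OF c[OF that], where 'a = complex] by (simp add: mult.commute)
  have "(\<lambda>k. of_real (c k) * (z - of_real x) ^ k) sums F z" if "z \<in> ball (of_real x) r" for z
  proof -
    have "cmod (z - of_real x) < r"
      using that by (simp add: dist_norm norm_minus_commute)
    then obtain q where q: "cmod (z - of_real x) < q" "q < r"
      using dense by blast
    have "0 < q" using q(1) norm_ge_zero le_less_trans by blast
    then have "summable (\<lambda>k. of_real (c k) * (of_real (x + q) - of_real x) ^ k :: complex)"
      using real[of "x + q"] q by (auto simp: sums_iff)
    then have "summable (\<lambda>k. of_real (c k) * (z - of_real x) ^ k)"
      by (rule powser_inside) (use q \<open>0 < q\<close> in simp)
    then show ?thesis unfolding F_def by (rule summable_sums)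
  qed
  then have "F holomorphic_on ball (of_real x) r"
    by (rule power_series_holomorphic)
  moreover have "F (of_real y) = of_real (f y)" if "\<bar>y - x\<bar> < r" for y
    using real[OF that] by (simp add: F_def sums_iff)
  ultimately show ?thesis using that r by blast
qed

text \<open>At real points the powers of \<open>y - x\<close> are real, so real parts can be taken
  coefficient by coefficient in the Taylor series; \<open>F\<close> may have nonreal values on the
  real axis.\<close>

lemma real_analytic_at_Re_holomorphic:
  assumes "r > 0" "F holomorphic_on ball (of_real x) r"
    and "\<And>y. \<bar>y - x\<bar> < r \<Longrightarrow> f y = Re (F (of_real y))"
  shows "real_analytic_at f x"
proof -
  define c where "c n = Re ((deriv ^^ n) F (of_real x) / fact n)" for n
  have "(\<lambda>k. (y - x) ^ k *\<^sub>R c k) sums f y" if y: "\<bar>y - x\<bar> < r" for y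
  proof -
    have "complex_of_real y \<in> ball (of_real x) r"
      using y by (simp add: dist_norm norm_minus_commute flip: of_real_diff)
    from sums_Re[OF holomorphic_power_series[OF assms(2) this]]
    have "(\<lambda>n. Re ((deriv ^^ n) F (of_real x) / fact n * of_real ((y - x) ^ n))) sums f y"
      using assms(3)[OF y] by simp
    then show ?thesis
      unfolding times_complex.sel Re_complex_of_real Im_complex_of_real c_def
      by (simp add: mult.commute)
  qed
  then show ?thesis unfolding real_analytic_at_def using assms(1) by blast
qed

text \<open>\<open>H\<close> lifts an operation on functions to their extensions. It may shrink the
  disc to \<open>s\<close>, as inverses and square roots must, and is told the values at the centre;
  unary operations pass the same function twice.\<close>

lemma real_analytic_at_combine:
  fixes f g :: "real \<Rightarrow> real" and h :: "real \<Rightarrow> real"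
  assumes f: "real_analytic_at f x" and g: "real_analytic_at g x"
    and H: "\<And>F G r. 0 < r \<Longrightarrow> F holomorphic_on ball (of_real x) r \<Longrightarrow> G holomorphic_on ball (of_real x) r
       \<Longrightarrow> F (of_real x) = of_real (f x) \<Longrightarrow> G (of_real x) = of_real (g x) \<Longrightarrow>
       \<exists>s>0. s \<le> r \<and> (H F G) holomorphic_on ball (of_real x) s \<and>
         (\<forall>y. \<bar>y - x\<bar> < s \<longrightarrow> F (of_real y) = of_real (f y) \<longrightarrow> G (of_real y) = of_real (g y) \<longrightarrow>
           h y = Re (H F G (of_real y)))"
  shows "real_analytic_at h x"
proof -
  obtain r1 F where F: "r1 > 0" "F holomorphic_on ball (of_real x) r1"
    "\<And>y. \<bar>y - x\<bar> < r1 \<Longrightarrow> F (of_real y) = of_real (f y)"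
    using real_analytic_at_holomorphic_extension[OF f] by blast
  obtain r2 G where G: "r2 > 0" "G holomorphic_on ball (of_real x) r2"
    "\<And>y. \<bar>y - x\<bar> < r2 \<Longrightarrow> G (of_real y) = of_real (g y)"
    using real_analytic_at_holomorphic_extension[OF g] by blast
  define r where "r = min r1 r2"
  have "F holomorphic_on ball (of_real x) r" "G holomorphic_on ball (of_real x) r" "0 < r"
    using F G by (auto simp: r_def elim!: holomorphic_on_subset)
  with H F(3)[of x] G(3)[of x] F(1) G(1) obtain s where s: "0 < s" "s \<le> r" "H F G holomorphic_on ball (of_real x) s"
    "\<And>y. \<bar>y - x\<bar> < s \<Longrightarrow> F (of_real y) = of_real (f y) \<Longrightarrow> G (of_real y) = of_real (g y) \<Longrightarrow>
           h y = Re (H F G (of_real y))"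
    by (metis abs_0 diff_self)
  show ?thesis
    by (rule real_analytic_at_Re_holomorphic[OF s(1,3)]) (use s F G in \<open>auto simp: r_def\<close>)
qed

section \<open>Closure properties of analytic functions\<close>

lemma real_analytic_at_const [simp, intro]: "real_analytic_at (\<lambda>_. c) x"
proof -
  have "(\<lambda>k. (y - x) ^ k *\<^sub>R (if k = 0 then c else 0)) sums c" for y
    using sums_single[of 0 "\<lambda>_. c"] by (rule sums_cong[THEN iffD1, rotated]) auto
  then show ?thesis
    unfolding real_analytic_at_def
    by (intro exI[of _ 1] conjI exI[of _ "\<lambda>k. if k = 0 then c else 0"]) auto
qed

lemma real_analytic_at_ident [simp, intro]: "real_analytic_at (\<lambda>t. t) x"
  by (rule real_analytic_at_Re_holomorphic[of 1 "\<lambda>z. z"]) (auto intro: holomorphic_intros)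

lemma real_analytic_at_add:
  assumes "real_analytic_at f x" "real_analytic_at g x"
  shows "real_analytic_at (\<lambda>t. f t + g t) x"
proof -
  obtain r c where r: "r > 0" and c: "\<And>y. \<bar>y - x\<bar> < r \<Longrightarrow> (\<lambda>k. (y - x) ^ k *\<^sub>R c k) sums f y"
    using assms(1) unfolding real_analytic_at_def by blast
  obtain s d where s: "s > 0" and d: "\<And>y. \<bar>y - x\<bar> < s \<Longrightarrow> (\<lambda>k. (y - x) ^ k *\<^sub>R d k) sums g y"
    using assms(2) unfolding real_analytic_at_def by blast
  show ?thesis unfolding real_analytic_at_def
  proof (intro exI[of _ "min r s"] conjI exI[of _ "\<lambda>k. c k + d k"] allI impI)
    fix y assume "\<bar>y - x\<bar> < min r s"
    then show "(\<lambda>k. (y - x) ^ k *\<^sub>R (c k + d k)) sums (f y + g y)"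
      using sums_add[OF c[of y] d[of y]] by (simp add: scaleR_add_right)
  qed (use r s in auto)
qed

lemma real_analytic_at_bounded_linear:
  assumes "bounded_linear L" "real_analytic_at f x"
  shows "real_analytic_at (\<lambda>t. L (f t)) x"
proof -
  obtain r c where r: "r > 0" and c: "\<And>y. \<bar>y - x\<bar> < r \<Longrightarrow> (\<lambda>k. (y - x) ^ k *\<^sub>R c k) sums f y"
    using assms(2) unfolding real_analytic_at_def by blast
  interpret bounded_linear L by fact
  show ?thesis unfolding real_analytic_at_def
    using r sums[OF c] by (intro exI[of _ r] conjI exI[of _ "\<lambda>k. L (c k)"]) (auto simp: scaleR)
qed

lemma real_analytic_at_mult:
  fixes f g :: "real \<Rightarrow> real"
  assumes "real_analytic_at f x" "real_analytic_at g x"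
  shows "real_analytic_at (\<lambda>t. f t * g t) x"
  by (rule real_analytic_at_combine[OF assms, where H = "\<lambda>F G z. F z * G z"])
     (auto intro!: holomorphic_intros)

lemma real_analytic_at_sum:
  "(\<And>i. i \<in> A \<Longrightarrow> real_analytic_at (f i) x) \<Longrightarrow> real_analytic_at (\<lambda>t. \<Sum>i\<in>A. f i t) x"
  by (induction A rule: infinite_finite_induct) (auto intro: real_analytic_at_add)

lemma real_analytic_at_minus:
  "real_analytic_at f x \<Longrightarrow> real_analytic_at (\<lambda>t. - f t) x"
  by (rule real_analytic_at_bounded_linear[OF bounded_linear_minus[OF bounded_linear_ident]])

lemma real_analytic_at_diff:
  "real_analytic_at f x \<Longrightarrow> real_analytic_at g x \<Longrightarrow> real_analytic_at (\<lambda>t. f t - g t) x"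
  using real_analytic_at_add[OF _ real_analytic_at_minus] by fastforce

lemma real_analytic_at_inner_left:
  fixes f :: "real \<Rightarrow> 'a::real_inner"
  shows "real_analytic_at f x \<Longrightarrow> real_analytic_at (\<lambda>t. f t \<bullet> b) x"
  by (rule real_analytic_at_bounded_linear[OF bounded_linear_inner_left])

lemma real_analytic_at_scaleR_const:
  fixes f :: "real \<Rightarrow> real"
  shows "real_analytic_at f x \<Longrightarrow> real_analytic_at (\<lambda>t. f t *\<^sub>R b) x"
  by (rule real_analytic_at_bounded_linear[OF bounded_linear_scaleR_left])

lemma real_analytic_at_euclidean_iff:
  fixes f :: "real \<Rightarrow> 'a::euclidean_space"
  shows "real_analytic_at f x \<longleftrightarrow> (\<forall>b\<in>Basis. real_analytic_at (\<lambda>t. f t \<bullet> b) x)"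
proof
  assume "\<forall>b\<in>Basis. real_analytic_at (\<lambda>t. f t \<bullet> b) x"
  then have "real_analytic_at (\<lambda>t. \<Sum>b\<in>Basis. (f t \<bullet> b) *\<^sub>R b) x"
    by (intro real_analytic_at_sum real_analytic_at_scaleR_const) auto
  then show "real_analytic_at f x" by (simp add: euclidean_representation)
qed (auto intro: real_analytic_at_inner_left)

lemma real_analytic_at_scaleR:
  fixes f :: "real \<Rightarrow> real" and g :: "real \<Rightarrow> 'a::euclidean_space"
  assumes "real_analytic_at f x" "real_analytic_at g x"
  shows "real_analytic_at (\<lambda>t. f t *\<^sub>R g t) x"
  using assms by (subst real_analytic_at_euclidean_iff)
    (auto intro!: real_analytic_at_mult real_analytic_at_inner_left)

lemma real_analytic_at_vec_iff:
  fixes f :: "real \<Rightarrow> 'a::euclidean_space ^ 'm"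
  shows "real_analytic_at f x \<longleftrightarrow> (\<forall>i. real_analytic_at (\<lambda>t. f t $ i) x)"
proof
  assume "\<forall>i. real_analytic_at (\<lambda>t. f t $ i) x"
  then show "real_analytic_at f x"
    by (subst real_analytic_at_euclidean_iff)
       (auto simp: Basis_vec_def inner_axis intro: real_analytic_at_inner_left)
qed (auto intro: real_analytic_at_bounded_linear[OF bounded_linear_vec_nth])

lemma real_analytic_at_inner:
  fixes f g :: "real \<Rightarrow> 'a::euclidean_space"
  assumes "real_analytic_at f x" "real_analytic_at g x"
  shows "real_analytic_at (\<lambda>t. f t \<bullet> g t) x"
  by (subst euclidean_inner)
    (intro real_analytic_at_sum real_analytic_at_mult real_analytic_at_inner_left assms)

lemma real_analytic_at_matrix_mult:
  fixes f :: "real \<Rightarrow> real ^ 'm::finite ^ 'k::finite" and g :: "real \<Rightarrow> real ^ 'l::finite ^ 'm"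
  assumes "real_analytic_at f x" "real_analytic_at g x"
  shows "real_analytic_at (\<lambda>t. f t ** g t) x"
  using assms unfolding real_analytic_at_vec_iff matrix_matrix_mult_def
  by (auto intro!: real_analytic_at_sum real_analytic_at_mult)

lemma real_analytic_at_matrix_vector_mult:
  fixes f :: "real \<Rightarrow> real ^ 'm::finite ^ 'k::finite" and g :: "real \<Rightarrow> real ^ 'm"
  assumes "real_analytic_at f x" "real_analytic_at g x"
  shows "real_analytic_at (\<lambda>t. f t *v g t) x"
  using assms unfolding real_analytic_at_vec_iff matrix_vector_mult_def
  by (auto intro!: real_analytic_at_sum real_analytic_at_mult)

lemma real_analytic_at_transpose:
  fixes f :: "real \<Rightarrow> real ^ 'm::finite ^ 'k::finite"
  assumes "real_analytic_at f x"
  shows "real_analytic_at (\<lambda>t. transpose (f t)) x"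
  using assms by (simp add: real_analytic_at_vec_iff transpose_def)

lemma real_analytic_at_inverse:
  fixes f :: "real \<Rightarrow> real"
  assumes "real_analytic_at f x" "f x \<noteq> 0"
  shows "real_analytic_at (\<lambda>t. inverse (f t)) x"
proof (rule real_analytic_at_combine[OF assms(1) assms(1), where H = "\<lambda>F G z. inverse (F z)"])
  fix F G :: "complex \<Rightarrow> complex" and r :: real
  assume r: "0 < r" "F holomorphic_on ball (of_real x) r" "F (of_real x) = of_real (f x)"
  then have "continuous_on (ball (of_real x) r) F"
    using holomorphic_on_imp_continuous_on by blast
  from continuous_on_avoid[OF this, of "of_real x" 0] obtain e where
    e: "e > 0" "\<And>y. y \<in> ball (of_real x) r \<Longrightarrow> dist (of_real x) y < e \<Longrightarrow> F y \<noteq> 0"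
    using r assms(2) by auto
  show "\<exists>s>0. s \<le> r \<and> (\<lambda>z. inverse (F z)) holomorphic_on ball (of_real x) s \<and>
         (\<forall>y. \<bar>y - x\<bar> < s \<longrightarrow> F (of_real y) = of_real (f y) \<longrightarrow> G (of_real y) = of_real (f y) \<longrightarrow>
           inverse (f y) = Re (inverse (F (of_real y))))"
    by (rule exI[of _ "min e r"])
       (use e r in \<open>auto intro!: holomorphic_on_inverse elim!: holomorphic_on_subset simp flip: of_real_inverse\<close>)
qed

lemma real_analytic_at_divide:
  fixes f g :: "real \<Rightarrow> real"
  assumes "real_analytic_at f x" "real_analytic_at g x" "g x \<noteq> 0"
  shows "real_analytic_at (\<lambda>t. f t / g t) x"
  unfolding divide_inverse using assms
  by (intro real_analytic_at_mult real_analytic_at_inverse)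

lemma real_analytic_at_sqrt:
  fixes f :: "real \<Rightarrow> real"
  assumes "real_analytic_at f x" "f x > 0"
  shows "real_analytic_at (\<lambda>t. sqrt (f t)) x"
proof (rule real_analytic_at_combine[OF assms(1) assms(1), where H = "\<lambda>F G z. csqrt (F z)"])
  fix F G :: "complex \<Rightarrow> complex" and r :: real
  assume r: "0 < r" "F holomorphic_on ball (of_real x) r" "F (of_real x) = of_real (f x)"
  then have "isCont F (of_real x)"
    using holomorphic_on_imp_continuous_on continuous_on_interior
    by (metis centre_in_ball interior_open open_ball)
  then have "isCont (\<lambda>z. Re (F z)) (of_real x)"
    unfolding isCont_def by (intro tendsto_intros)
  then have "((\<lambda>z. Re (F z)) \<longlongrightarrow> f x) (nhds (of_real x))"
    using r(3) tendsto_at_iff_tendsto_nhds[of "\<lambda>z. Re (F z)" "of_real x"] by (simp add: isCont_def)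
  \<comment> \<open>A positive real part keeps \<open>F\<close> off the nonpositive reals, the
    branch cut of \<open>csqrt\<close>.\<close>
  then have "\<forall>\<^sub>F z in nhds (of_real x). Re (F z) > 0"
    using assms(2) by (rule order_tendstoD)
  then obtain e where
    e: "e > 0" "\<And>y. dist y (of_real x) < e \<Longrightarrow> Re (F y) > 0"
    unfolding eventually_nhds_metric by blast
  have *: "z \<in> ball (of_real x) e \<Longrightarrow> F z \<notin> \<real>\<^sub>\<le>\<^sub>0" for z
    using e(2)[of z] by (force simp: dist_commute complex_nonpos_Reals_iff)
  show "\<exists>s>0. s \<le> r \<and> (\<lambda>z. csqrt (F z)) holomorphic_on ball (of_real x) s \<and>
         (\<forall>y. \<bar>y - x\<bar> < s \<longrightarrow> F (of_real y) = of_real (f y) \<longrightarrow> G (of_real y) = of_real (f y) \<longrightarrow>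
           sqrt (f y) = Re (csqrt (F (of_real y))))"
  proof (intro exI[of _ "min e r"] conjI allI impI)
    show "(\<lambda>z. csqrt (F z)) holomorphic_on ball (of_real x) (min e r)"
      by (intro holomorphic_on_csqrt' holomorphic_on_subset[OF r(2)]) (use * in auto)
    fix y assume y: "\<bar>y - x\<bar> < min e r" "F (of_real y) = of_real (f y)"
    then have "f y > 0"
      using e(2)[of "of_real y"] by (simp add: dist_norm flip: of_real_diff)
    then show "sqrt (f y) = Re (csqrt (F (of_real y)))"
      by (simp add: y(2) csqrt_of_real_nonneg)
  qed (use e r in auto)
qed

text \<open>Recentring is done on the extension: the disc about \<open>y\<close> of radius
  \<open>r - \<bar>y - x\<bar>\<close> lies inside the disc about \<open>x\<close>, so the same
  \<open>F\<close> serves at \<open>y\<close>.\<close>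

lemma real_analytic_at_eventually_aux:
  fixes f :: "real \<Rightarrow> real"
  assumes "real_analytic_at f x"
  shows "\<forall>\<^sub>F y in nhds x. real_analytic_at f y"
proof -
  obtain r F where F: "r > 0" "F holomorphic_on ball (of_real x) r"
    "\<And>y. \<bar>y - x\<bar> < r \<Longrightarrow> F (of_real y) = of_real (f y)"
    using real_analytic_at_holomorphic_extension[OF assms] by blast
  have "real_analytic_at f y" if y: "\<bar>y - x\<bar> < r" for y
  proof (rule real_analytic_at_Re_holomorphic[of "r - \<bar>y - x\<bar>" F])
    show "F holomorphic_on ball (of_real y) (r - \<bar>y - x\<bar>)"
      using F(2) by (rule holomorphic_on_subset)
        (auto simp: ball_subset_ball_iff dist_norm simp flip: of_real_diff)
  qed (use y F in auto)
  then show ?thesis unfolding eventually_nhds_real using F(1) by blast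
qed

lemma real_analytic_at_eventually:
  fixes f :: "real \<Rightarrow> 'a::euclidean_space"
  assumes "real_analytic_at f x"
  shows "\<forall>\<^sub>F y in nhds x. real_analytic_at f y"
  unfolding real_analytic_at_euclidean_iff[of f]
  by (rule eventually_ball_finite)
    (use assms in \<open>auto intro!: real_analytic_at_eventually_aux real_analytic_at_inner_left\<close>)

lemma real_analytic_at_isCont:
  fixes f :: "real \<Rightarrow> 'a::euclidean_space"
  assumes "real_analytic_at f x"
  shows "isCont f x"
proof -
  have real: "isCont g x" if g: "real_analytic_at g x" for g :: "real \<Rightarrow> real"
  proof -
    obtain r F where F: "r > 0" "F holomorphic_on ball (of_real x) r"
      "\<And>y. \<bar>y - x\<bar> < r \<Longrightarrow> F (of_real y) = of_real (g y)"
      using real_analytic_at_holomorphic_extension[OF g] by blast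
    have "isCont F (of_real x)"
      using F holomorphic_on_imp_continuous_on continuous_on_interior
      by (metis centre_in_ball interior_open open_ball)
    then have "isCont (\<lambda>y. F (of_real y)) x"
      by (intro isCont_o2[where f = of_real and g = F]) auto
    then have "isCont (\<lambda>y. Re (F (of_real y))) x"
      unfolding isCont_def by (intro tendsto_intros)
    moreover have "\<forall>\<^sub>F y in nhds x. Re (F (of_real y)) = g y"
      unfolding eventually_nhds_real using F by (intro exI[of _ r]) auto
    ultimately show ?thesis by (simp add: isCont_cong)
  qed
  have "isCont (\<lambda>t. \<Sum>b\<in>Basis. (f t \<bullet> b) *\<^sub>R b) x"
    by (intro continuous_intros real real_analytic_at_inner_left assms)
  then show ?thesis by (simp add: euclidean_representation)
qed

section \<open>Vanishing orders, the identity theorem and division\<close>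

lemma real_analytic_at_factor:
  fixes f :: "real \<Rightarrow> 'a::euclidean_space"
  assumes "real_analytic_at f x"
  obtains (zero) "\<forall>\<^sub>F y in nhds x. f y = 0"
  | (factor) k g where "real_analytic_at g x" "g x \<noteq> 0" "\<forall>\<^sub>F y in nhds x. f y = (y - x) ^ k *\<^sub>R g y"
proof -
  obtain r c where r: "r > 0" and c: "\<And>y. \<bar>y - x\<bar> < r \<Longrightarrow> (\<lambda>k. (y - x) ^ k *\<^sub>R c k) sums f y"
    using assms unfolding real_analytic_at_def by blast
  show thesis
  proof (cases "\<forall>k. c k = 0")
    case True
    then have "f y = 0" if "\<bar>y - x\<bar> < r" for y
      using c[OF that] by (simp add: sums_iff)
    then show thesis
      using r zero unfolding eventually_nhds_real by blast
  next
    case False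
    define k where "k = (LEAST k. c k \<noteq> 0)"
    have cl: "c l = 0" if "l < k" for l
      using not_less_Least[of l "\<lambda>k. c k \<noteq> 0"] that unfolding k_def by auto
    have ck: "c k \<noteq> 0" using False LeastI_ex[of "\<lambda>k. c k \<noteq> 0"] unfolding k_def by auto
    \<comment> \<open>At \<open>x\<close> the quotient gets the first nonzero coefficient as its
      value, so that \<open>g\<close> is the sum of the shifted series on the whole
      interval.\<close>
    define g where "g y = (if y = x then c k else inverse ((y - x) ^ k) *\<^sub>R f y)" for y
    have "(\<lambda>n. (y - x) ^ n *\<^sub>R c (n + k)) sums g y" if y: "\<bar>y - x\<bar> < r" for y
    proof (cases "y = x")
      case True
      have "(\<lambda>n. (0::real) ^ n *\<^sub>R c (n + k)) sums c k"
        using sums_single[of 0 "\<lambda>n. c (n + k)"]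
        by (simp add: power_0_left if_distrib[of "\<lambda>a. a *\<^sub>R _"] cong: if_cong)
      then show ?thesis using True by (simp add: g_def)
    next
      case False
      have "(\<lambda>n. (y - x) ^ (n + k) *\<^sub>R c (n + k)) sums f y"
        using c[OF y] cl by (subst sums_iff_shift) simp
      from sums_scaleR_right[OF this, of "inverse ((y - x) ^ k)"] False show ?thesis
        by (simp add: g_def power_add field_simps)
    qed
    then have "real_analytic_at g x"
      unfolding real_analytic_at_def using r by (intro exI[of _ r] conjI exI[of _ "\<lambda>n. c (n + k)"]) auto
    moreover have "f y = (y - x) ^ k *\<^sub>R g y" if y: "\<bar>y - x\<bar> < r" for y
    proof (cases "y = x")
      case True
      have "f x = c 0"
      proof -
        have "(\<lambda>n. (x - x) ^ n *\<^sub>R c n) sums c 0"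
          using sums_single[of 0 c]
          by (simp add: power_0_left if_distrib[of "\<lambda>a. a *\<^sub>R _"] cong: if_cong)
        then show ?thesis using c[of x] r sums_unique2 by fastforce
      qed
      then show ?thesis using True cl[of 0] by (cases k) (auto simp: g_def)
    qed (auto simp: g_def)
    moreover have "g x \<noteq> 0" using ck by (simp add: g_def)
    ultimately show thesis
      using factor r unfolding eventually_nhds_real by blast
  qed
qed

lemma eventually_nhds_imp_at: "eventually P (nhds x) \<Longrightarrow> eventually P (at x)"
  by (simp add: eventually_at_filter eventually_mono)

lemma eventually_at_neq: "\<forall>\<^sub>F y in at x. y \<noteq> x"
  by (simp add: eventually_at_filter)

lemma eventually_nhds_iff_at:
  fixes x :: "'a::topological_space"
  shows "eventually P (nhds x) \<longleftrightarrow> eventually P (at x) \<and> P x"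
proof safe
  assume "eventually P (at x)" "P x"
  then show "eventually P (nhds x)"
    unfolding eventually_at_filter by (auto elim!: eventually_mono)
qed (auto intro: eventually_nhds_imp_at eventually_nhds_x_imp_x)

lemma real_analytic_at_zero_dichotomy:
  fixes f :: "real \<Rightarrow> 'a::euclidean_space"
  assumes "real_analytic_at f x"
  shows "(\<forall>\<^sub>F y in nhds x. f y = 0) \<or> (\<forall>\<^sub>F y in at x. f y \<noteq> 0)"
  using assms
proof (cases rule: real_analytic_at_factor)
  case (factor k g)
  have "\<forall>\<^sub>F y in at x. g y \<noteq> 0"
    using factor(2) real_analytic_at_isCont[OF factor(1)]
    unfolding isCont_def by (rule tendsto_imp_eventually_ne[rotated])
  with eventually_at_neq eventually_nhds_imp_at[OF factor(3)]
  have "\<forall>\<^sub>F y in at x. f y \<noteq> 0"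
    by eventually_elim auto
  then show ?thesis ..
qed auto

text \<open>Points near which \<open>f\<close> vanishes and points with a zero-free punctured
  neighbourhood form two disjoint open sets, which cover \<open>S\<close> by the dichotomy;
  connectedness decides.\<close>

lemma real_analytic_identity:
  fixes f :: "real \<Rightarrow> 'a::euclidean_space"
  assumes S: "connected S" "\<And>x. x \<in> S \<Longrightarrow> real_analytic_at f x"
    and a: "a \<in> S" "\<forall>\<^sub>F y in nhds a. f y = 0"
    and x: "x \<in> S"
  shows "\<forall>\<^sub>F y in nhds x. f y = 0"
proof (rule ccontr)
  assume nx: "\<not> ?thesis"
  define U where "U = {x. \<forall>\<^sub>F y in nhds x. f y = 0}"
  define V where "V = {x. \<forall>\<^sub>F y in at x. f y \<noteq> 0}"
  have "open U"
  proof (rule topological_space_class.openI)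
    fix x assume "x \<in> U"
    then obtain T where T: "open T" "x \<in> T" "\<And>y. y \<in> T \<Longrightarrow> f y = 0"
      unfolding U_def eventually_nhds by auto
    then have "T \<subseteq> U"
      unfolding U_def eventually_nhds by blast
    then show "\<exists>T. open T \<and> x \<in> T \<and> T \<subseteq> U"
      using T by blast
  qed
  moreover have "open V"
  proof (rule topological_space_class.openI)
    fix x assume "x \<in> V"
    then obtain T where T: "open T" "x \<in> T" "\<And>y. y \<in> T \<Longrightarrow> y \<noteq> x \<Longrightarrow> f y \<noteq> 0"
      unfolding V_def eventually_at_topological by auto
    have "y \<in> V" if "y \<in> T" for y
    proof (cases "y = x")
      case False
      then have "\<forall>\<^sub>F z in nhds y. z \<in> T - {x}"
        using T that by (intro eventually_nhds_in_open) auto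
      then have "\<forall>\<^sub>F z in nhds y. f z \<noteq> 0"
        by eventually_elim (use T in auto)
      then show ?thesis by (auto simp: V_def dest: eventually_nhds_imp_at)
    qed (use \<open>x \<in> V\<close> in simp)
    then show "\<exists>T. open T \<and> x \<in> T \<and> T \<subseteq> V" using T by auto
  qed
  moreover have "U \<inter> V = {}"
  proof -
    have False if "y \<in> U" "y \<in> V" for y
    proof -
      have "\<forall>\<^sub>F z in at y. f z = 0" "\<forall>\<^sub>F z in at y. f z \<noteq> 0"
        using that by (auto simp: U_def V_def dest: eventually_nhds_imp_at)
      then have "\<forall>\<^sub>F z in at y. False" by eventually_elim simp
      then show False by (simp add: trivial_limit_at)
    qed
    then show ?thesis by blast
  qed
  moreover have "S \<subseteq> U \<union> V"
    using real_analytic_at_zero_dichotomy[OF S(2)] by (auto simp: U_def V_def)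
  ultimately have "U \<inter> S = {} \<or> V \<inter> S = {}"
    using connectedD[OF S(1), of U V] by blast
  moreover have "a \<in> U \<inter> S" using a by (simp add: U_def)
  moreover have "x \<in> V \<inter> S"
    using x nx real_analytic_at_zero_dichotomy[OF S(2)[OF x]] by (simp add: V_def)
  ultimately show False by blast
qed

lemma real_analytic_nonzero_eventually_at:
  fixes f :: "real \<Rightarrow> 'a::euclidean_space"
  assumes "connected S" "\<And>x. x \<in> S \<Longrightarrow> real_analytic_at f x"
    and a: "a \<in> S" "f a \<noteq> 0" and "x \<in> S"
  shows "\<forall>\<^sub>F y in at x. f y \<noteq> 0"
proof (rule ccontr)
  assume "\<not> ?thesis"
  then have "\<forall>\<^sub>F y in nhds x. f y = 0"
    using real_analytic_at_zero_dichotomy[OF assms(2)[OF assms(5)]] by simp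
  from real_analytic_identity[OF assms(1,2,5) this a(1)] have "f a = 0"
    by (rule eventually_nhds_x_imp_x)
  with a(2) show False ..
qed

lemma real_analytic_zeros_countable:
  fixes f :: "real \<Rightarrow> 'a::euclidean_space"
  assumes "connected S" "open S" "\<And>x. x \<in> S \<Longrightarrow> real_analytic_at f x" "a \<in> S" "f a \<noteq> 0"
  shows "countable {x \<in> S. f x = 0}"
proof -
  have "{x. f x = 0} sparse_in S"
    unfolding sparse_in_eventually_iff[OF assms(2)]
    using real_analytic_nonzero_eventually_at[OF assms(1,3,4,5)] by simp
  from sparse_imp_countable[OF assms(2) this] show ?thesis
    by (simp add: Int_def)
qed

lemma real_analytic_cancel:
  fixes f :: "real \<Rightarrow> 'a::euclidean_space" and h :: "real \<Rightarrow> real"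
  assumes h: "\<forall>\<^sub>F y in at x. h y \<noteq> 0" and f: "isCont f x" and hf: "\<forall>\<^sub>F y in nhds x. h y *\<^sub>R f y = 0"
  shows "f x = 0"
proof -
  from h eventually_nhds_imp_at[OF hf] have "\<forall>\<^sub>F y in at x. f y = 0"
    by eventually_elim auto
  then have "(f \<longlongrightarrow> 0) (at x)" by (simp add: tendsto_eventually)
  with f show ?thesis unfolding isCont_def by (rule tendsto_unique[rotated 1]) simp
qed

text \<open>Analytic germs form an integral domain: were no factor the zero germ, finitely many
  punctured neighbourhoods would intersect in one where the product has no zero. The identity
  theorem spreads the vanishing of a factor over \<open>S\<close>.\<close>

lemma real_analytic_prod_list_zero:
  fixes L :: "(real \<Rightarrow> real) list"
  assumes "connected S" "a \<in> S" "\<And>f x. f \<in> set L \<Longrightarrow> x \<in> S \<Longrightarrow> real_analytic_at f x"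
    and "\<forall>\<^sub>F y in at a. (\<Prod>f\<leftarrow>L. f y) = 0"
  shows "\<exists>f\<in>set L. \<forall>x\<in>S. \<forall>\<^sub>F y in nhds x. f y = 0"
proof (rule ccontr)
  assume "\<not> ?thesis"
  then have "\<forall>\<^sub>F y in at a. f y \<noteq> 0" if "f \<in> set L" for f
    using real_analytic_at_zero_dichotomy[OF assms(3)[OF that assms(2)]]
      real_analytic_identity[OF assms(1) assms(3)[OF that] assms(2)] that by metis
  then have "\<forall>\<^sub>F y in at a. \<forall>f\<in>set L. f y \<noteq> 0"
    by (simp add: eventually_ball_finite)
  with assms(4) have "\<forall>\<^sub>F y in at a. False"
    by eventually_elim (auto simp: prod_list_zero_iff)
  then show False by (simp add: trivial_limit_at)
qed

text \<open>The local quotients glue without any choice: where \<open>h\<close> is nonzero they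
  equal f / h, and at an isolated zero of \<open>h\<close> they equal its limit.\<close>

lemma real_analytic_quotient:
  fixes f :: "real \<Rightarrow> 'a::euclidean_space" and h :: "real \<Rightarrow> real"
  assumes h: "\<And>x. x \<in> S \<Longrightarrow> \<forall>\<^sub>F y in at x. h y \<noteq> 0"
    and loc: "\<And>x. x \<in> S \<Longrightarrow> \<exists>g. real_analytic_at g x \<and> (\<forall>\<^sub>F y in nhds x. f y = h y *\<^sub>R g y)"
  obtains g where "\<And>x. x \<in> S \<Longrightarrow> real_analytic_at g x" "\<And>x. x \<in> S \<Longrightarrow> f x = h x *\<^sub>R g x"
proof -
  define g where "g x = (if h x \<noteq> 0 then inverse (h x) *\<^sub>R f x else Lim (at x) (\<lambda>y. inverse (h y) *\<^sub>R f y))" for x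
  have "real_analytic_at g x \<and> f x = h x *\<^sub>R g x" if x: "x \<in> S" for x
  proof -
    obtain g' where g': "real_analytic_at g' x" "\<forall>\<^sub>F y in nhds x. f y = h y *\<^sub>R g' y"
      using loc[OF x] by blast
    have ev: "\<forall>\<^sub>F y in at x. inverse (h y) *\<^sub>R f y = g' y"
      using h[OF x] eventually_nhds_imp_at[OF g'(2)] by eventually_elim simp
    have "((\<lambda>y. inverse (h y) *\<^sub>R f y) \<longlongrightarrow> g' x) (at x)"
      using real_analytic_at_isCont[OF g'(1)] ev unfolding isCont_def
      by (subst tendsto_cong) auto
    then have "Lim (at x) (\<lambda>y. inverse (h y) *\<^sub>R f y) = g' x"
      by (intro tendsto_Lim) auto
    then have "g x = g' x"
      using eventually_nhds_x_imp_x[OF g'(2)] by (simp add: g_def)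
    moreover have "\<forall>\<^sub>F y in at x. g' y = g y"
      using ev h[OF x] by eventually_elim (simp add: g_def)
    ultimately have "\<forall>\<^sub>F y in nhds x. g' y = g y"
      by (simp add: eventually_nhds_iff_at)
    then show ?thesis
      using real_analytic_at_cong[OF g'(1)] eventually_nhds_x_imp_x[OF g'(2)] \<open>g x = g' x\<close> by simp
  qed
  then show thesis using that by blast
qed

section \<open>Analytic lifting of idempotents\<close>

lemma matrix_add_rdistrib: "(B + C) ** A = B ** A + C ** (A :: 'a::semiring_1 ^ 'n ^ 'm)"
  by (vector matrix_matrix_mult_def sum.distrib[symmetric] distrib_right)

lemma matrix_sub_ldistrib: "A ** (B - C) = A ** B - A ** (C :: 'a::ring_1 ^ 'n ^ 'm)"
  by (vector matrix_matrix_mult_def sum_subtractf[symmetric] right_diff_distrib)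

lemma matrix_sub_rdistrib: "(B - C) ** A = B ** A - C ** (A :: 'a::ring_1 ^ 'n ^ 'm)"
  by (vector matrix_matrix_mult_def sum_subtractf[symmetric] left_diff_distrib)

lemma matrix_minus_left: "(- B) ** A = - (B ** (A :: 'a::ring_1 ^ 'n ^ 'm))"
  by (vector matrix_matrix_mult_def sum_negf[symmetric])

lemma matrix_minus_right: "B ** (- A) = - (B ** (A :: 'a::ring_1 ^ 'n ^ 'm))"
  by (vector matrix_matrix_mult_def sum_negf[symmetric])

lemma matrix_scaleR_left: "(k *\<^sub>R A) ** B = k *\<^sub>R (A ** (B :: real ^ 'n ^ 'm))"
  by (simp add: scalar_matrix_assoc)

lemma matrix_scaleR_right: "A ** (k *\<^sub>R B) = k *\<^sub>R (A ** (B :: real ^ 'n ^ 'm))"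
  by (simp add: matrix_scalar_ac scalar_matrix_assoc)

lemmas matrix_distribs =
  matrix_add_ldistrib matrix_add_rdistrib matrix_sub_ldistrib matrix_sub_rdistrib
  matrix_minus_left matrix_minus_right matrix_scaleR_left matrix_scaleR_right

lemma transpose_add: "transpose (A + B) = transpose A + transpose B"
  by (simp add: transpose_def vec_eq_iff)

lemma transpose_diff: "transpose (A - B) = transpose A - transpose B"
  by (simp add: transpose_def vec_eq_iff)

lemma transpose_minus: "transpose (- A) = - transpose A"
  by (simp add: transpose_def vec_eq_iff)

lemma tendsto_matrix_mult:
  fixes f :: "'b \<Rightarrow> real ^ 'm::finite ^ 'k::finite" and g :: "'b \<Rightarrow> real ^ 'l::finite ^ 'm"
  assumes "(f \<longlongrightarrow> a) F" "(g \<longlongrightarrow> b) F"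
  shows "((\<lambda>x. f x ** g x) \<longlongrightarrow> a ** b) F"
  unfolding matrix_matrix_mult_def
  by (intro tendsto_vec_lambda tendsto_sum tendsto_mult tendsto_vec_nth assms)

text \<open>Newton's iteration for idempotents; sums replace the coefficients 3 and 2 so that no scalar action is needed.\<close>

definition newton_step :: "'a::ring_1 ^ 'm ^ 'm \<Rightarrow> 'a ^ 'm ^ 'm" where
  "newton_step X = (X ** X + X ** X + X ** X) - (X ** X ** X + X ** X ** X)"

definition idem_defect :: "'a::ring_1 ^ 'm ^ 'm \<Rightarrow> 'a ^ 'm ^ 'm" where
  "idem_defect X = X ** X - X"

text \<open>With E the defect, the increment is E - 2XE, a multiple of E; a small defect therefore
  means a small move.\<close>

lemma newton_step_diff:
  "newton_step X - X = idem_defect X - (X ** idem_defect X + X ** idem_defect X)"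
  by (simp add: newton_step_def idem_defect_def matrix_distribs(1-6) matrix_mul_assoc)

text \<open>For p = 3x^2 - 2x^3 one has p = x^2 (3 - 2x) and 1 - p = (1 - x)^2 (1 + 2x). Hence p^2 -
  p is divisible by the square of E = x^2 - x and equals 4E^3 - 3E^2: convergence is
  quadratic.\<close>

lemma idem_defect_newton_step:
  fixes X :: "'a::ring_1 ^ 'm ^ 'm"
  defines "E \<equiv> idem_defect X"
  shows "idem_defect (newton_step X) =
    (E ** E ** E + E ** E ** E + E ** E ** E + E ** E ** E) - (E ** E + E ** E + E ** E)"
  by (simp add: newton_step_def idem_defect_def E_def matrix_distribs(1-6) matrix_mul_assoc)

text \<open>This norm is submultiplicative, dominates every entry, is continuous by inspection, and
  serves real and complex matrices alike.\<close>

definition entry_norm :: "'a::real_normed_algebra_1 ^ 'm::finite ^ 'm \<Rightarrow> real" where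
  "entry_norm X = (\<Sum>i\<in>UNIV. \<Sum>j\<in>UNIV. norm (X $ i $ j))"

lemma entry_norm_nonneg: "0 \<le> entry_norm X"
  by (auto simp: entry_norm_def intro!: sum_nonneg)

lemma norm_entry_le: "norm (X $ i $ j) \<le> entry_norm X"
proof -
  have "norm (X $ i $ j) \<le> (\<Sum>j\<in>UNIV. norm (X $ i $ j))"
    by (rule member_le_sum) auto
  also have "\<dots> \<le> entry_norm X"
    unfolding entry_norm_def by (rule member_le_sum) (auto intro: sum_nonneg)
  finally show ?thesis .
qed

lemma entry_norm_add: "entry_norm (X + Y) \<le> entry_norm X + entry_norm Y"
  unfolding entry_norm_def sum.distrib[symmetric]
  by (intro sum_mono) (simp add: norm_triangle_ineq)

lemma entry_norm_diff: "entry_norm (X - Y) \<le> entry_norm X + entry_norm Y"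
  unfolding entry_norm_def sum.distrib[symmetric]
  by (intro sum_mono) (simp add: norm_triangle_ineq4)

lemma entry_norm_mult: "entry_norm (X ** Y) \<le> entry_norm X * entry_norm Y"
proof -
  have "entry_norm (X ** Y) \<le> (\<Sum>i\<in>UNIV. \<Sum>j\<in>UNIV. \<Sum>k\<in>UNIV. norm (X $ i $ k) * norm (Y $ k $ j))"
    unfolding entry_norm_def matrix_matrix_mult_def
    by (auto intro!: sum_mono order.trans[OF norm_sum] norm_mult_ineq)
  also have "\<dots> = (\<Sum>i\<in>UNIV. \<Sum>k\<in>UNIV. norm (X $ i $ k) * (\<Sum>j\<in>UNIV. norm (Y $ k $ j)))"
    by (subst sum.swap) (simp add: sum_distrib_left)
  also have "\<dots> \<le> (\<Sum>i\<in>UNIV. \<Sum>k\<in>UNIV. norm (X $ i $ k) * entry_norm Y)"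
    unfolding entry_norm_def
    by (intro sum_mono mult_left_mono member_le_sum[where f = "\<lambda>k. \<Sum>j\<in>UNIV. norm (Y $ k $ j)"])
       (auto intro: sum_nonneg)
  also have "\<dots> = entry_norm X * entry_norm Y"
    by (simp add: entry_norm_def sum_distrib_right)
  finally show ?thesis .
qed

text \<open>The new defect is at most 4e^3 + 3e^2, which is below e/4 once 4e^2 + 3e is at most 1/4.
  At e = 1/14 that expression is 23/98; 1/13 would already be too large. The rate 1/4 is chosen to
  beat the growth 2^k allowed to the iterates below.\<close>

lemma entry_norm_idem_defect_newton_step:
  assumes "entry_norm (idem_defect X) \<le> 1 / 14"
  shows "entry_norm (idem_defect (newton_step X)) \<le> entry_norm (idem_defect X) / 4"
proof -
  define E where "E = idem_defect X"
  define e where "e = entry_norm E"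
  have e: "0 \<le> e" "e \<le> 1/14" using assms by (auto simp: e_def E_def entry_norm_nonneg)
  have 2: "entry_norm (E ** E) \<le> e * e" using entry_norm_mult[of E E] by (simp add: e_def)
  have 3: "entry_norm (E ** E ** E) \<le> e * e * e"
    using entry_norm_mult[of "E ** E" E] mult_right_mono[OF 2 e(1)] by (simp add: e_def)
  have "entry_norm (idem_defect (newton_step X)) \<le> 4 * (e * e * e) + 3 * (e * e)"
    unfolding idem_defect_newton_step E_def[symmetric]
    using entry_norm_diff[of "E ** E ** E + E ** E ** E + E ** E ** E + E ** E ** E" "E ** E + E ** E + E ** E"]
      entry_norm_add[of "E ** E ** E + E ** E ** E + E ** E ** E" "E ** E ** E"]
      entry_norm_add[of "E ** E ** E + E ** E ** E" "E ** E ** E"]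
      entry_norm_add[of "E ** E ** E" "E ** E ** E"]
      entry_norm_add[of "E ** E + E ** E" "E ** E"]
      entry_norm_add[of "E ** E" "E ** E"] 2 3 by linarith
  also have "\<dots> = e * (4 * (e * e) + 3 * e)" by (simp add: algebra_simps)
  also have "\<dots> \<le> e * (1 / 4)"
  proof (rule mult_left_mono)
    have "e * e \<le> 1/14 * (1/14)" using e by (intro mult_mono) auto
    then show "4 * (e * e) + 3 * e \<le> 1 / 4" using e by simp
  qed (use e in simp)
  finally show ?thesis by (simp add: e_def E_def)
qed

lemma entry_norm_newton_step_diff:
  "entry_norm (newton_step X - X) \<le> entry_norm (idem_defect X) * (1 + 2 * entry_norm X)"
proof -
  have "entry_norm (newton_step X - X) \<le> entry_norm (idem_defect X) +
     (entry_norm X * entry_norm (idem_defect X) + entry_norm X * entry_norm (idem_defect X))"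
    unfolding newton_step_diff
    using entry_norm_diff[of "idem_defect X" "X ** idem_defect X + X ** idem_defect X"]
      entry_norm_add[of "X ** idem_defect X" "X ** idem_defect X"]
      entry_norm_mult[of X "idem_defect X"] by linarith
  then show ?thesis by (simp add: algebra_simps)
qed

lemma idem_defect_newton_iterate:
  assumes "entry_norm (idem_defect X) \<le> 1 / 14"
  shows "entry_norm (idem_defect ((newton_step ^^ k) X)) \<le> 1 / 14 * (1 / 4) ^ k"
proof (induction k)
  case (Suc k)
  have "(1/4) ^ k \<le> (1::real)" by (rule power_le_one) auto
  with Suc have "entry_norm (idem_defect ((newton_step ^^ k) X)) \<le> 1 / 14" by linarith
  from entry_norm_idem_defect_newton_step[OF this] Suc show ?case by simp
qed (use assms in simp)

text \<open>The iterates are only shown to grow at most like 2^k, but the defect decays like 4^(-k),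
  and the increment is bounded by the product of the two. The resulting summable bound depends on
  \<open>X\<close> through \<open>B\<close> alone, hence is uniform over a disc.\<close>

lemma newton_iterate_diff:
  assumes "entry_norm (idem_defect X) \<le> 1 / 14" "entry_norm X + 1 \<le> B"
  shows "entry_norm ((newton_step ^^ Suc k) X - (newton_step ^^ k) X) \<le> B * (1 / 2) ^ k"
proof -
  let ?N = "\<lambda>k. (newton_step ^^ k) X"
  have d: "entry_norm (idem_defect (?N k)) \<le> 1 / 14 * (1 / 4) ^ k" for k
    using idem_defect_newton_iterate[OF assms(1)] .
  have b: "entry_norm (?N k) + 1 \<le> B * 2 ^ k" for k
  proof (induction k)
    case (Suc k)
    have "(1/4) ^ k \<le> (1::real)" by (rule power_le_one) auto
    with d[of k] have "entry_norm (idem_defect (?N k)) \<le> 1 / 14" by linarith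
    then have "entry_norm (idem_defect (?N k)) * (1 + 2 * entry_norm (?N k)) \<le> 1 / 14 * (1 + 2 * entry_norm (?N k))"
      by (rule mult_right_mono) (simp add: entry_norm_nonneg)
    moreover have "entry_norm (?N (Suc k)) \<le> entry_norm (?N (Suc k) - ?N k) + entry_norm (?N k)"
      using entry_norm_add[of "?N (Suc k) - ?N k" "?N k"] by simp
    moreover have "entry_norm (?N (Suc k) - ?N k) \<le> entry_norm (idem_defect (?N k)) * (1 + 2 * entry_norm (?N k))"
      using entry_norm_newton_step_diff[of "?N k"] by simp
    ultimately have "entry_norm (?N (Suc k)) \<le> 1 / 14 * (1 + 2 * entry_norm (?N k)) + entry_norm (?N k)"
      by (smt (verit))
    then have "entry_norm (?N (Suc k)) + 1 \<le> 2 * (entry_norm (?N k) + 1)"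
      using entry_norm_nonneg[of "?N k"] by argo
    with Suc show ?case by simp
  qed (use assms in simp)
  have "entry_norm (?N (Suc k) - ?N k) \<le> entry_norm (idem_defect (?N k)) * (1 + 2 * entry_norm (?N k))"
    using entry_norm_newton_step_diff[of "?N k"] by simp
  also have "\<dots> \<le> (1 / 14 * (1 / 4) ^ k) * (2 * (B * 2 ^ k))"
    by (rule mult_mono) (use d[of k] b[of k] entry_norm_nonneg[of "?N k"] in auto)
  also have "\<dots> = 1 / 7 * B * ((1/4 * 2) ^ k)" by (simp only: power_mult_distrib) simp
  also have "\<dots> \<le> B * (1/2) ^ k"
    using assms(2) entry_norm_nonneg[of X] by (simp add: mult_left_le)
  finally show ?thesis .
qed

lemma newton_step_idem: "X ** X = X \<Longrightarrow> newton_step X = X"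
  by (simp add: newton_step_def)

lemma newton_iterate_idem: "X ** X = X \<Longrightarrow> (newton_step ^^ k) X = X"
  by (induction k) (auto simp: newton_step_idem)

text \<open>Two matrices are allowed so that Y = X gives commutation, while B = A and Y =
  \<open>transpose X\<close> give self-adjointness for x . A y.\<close>

lemma newton_step_intertwine:
  assumes "B ** X = Y ** B"
  shows "B ** newton_step X = newton_step Y ** B"
proof -
  have 2: "B ** (X ** X) = Y ** Y ** B"
    by (metis assms matrix_mul_assoc)
  have 3: "B ** (X ** X ** X) = Y ** Y ** Y ** B"
    by (metis assms 2 matrix_mul_assoc)
  show ?thesis by (simp add: newton_step_def matrix_distribs(1-4) 2 3)
qed

lemma newton_iterate_intertwine:
  "B ** X = Y ** B \<Longrightarrow> B ** (newton_step ^^ k) X = (newton_step ^^ k) Y ** B"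
  by (induction k) (auto simp: newton_step_intertwine)

lemma newton_iterate_absorb:
  assumes "P ** X = X"
  shows "P ** (newton_step ^^ k) X = (newton_step ^^ k) X"
proof -
  have "P ** newton_step Y = newton_step Y" if "P ** Y = Y" for Y
    using that by (simp add: newton_step_def matrix_distribs(1-4) matrix_mul_assoc)
  then show ?thesis using assms by (induction k) auto
qed

lemma transpose_newton_step:
  fixes X :: "'a::comm_ring_1 ^ 'm ^ 'm"
  shows "transpose (newton_step X) = newton_step (transpose X)"
  by (simp only: newton_step_def transpose_add transpose_diff matrix_transpose_mul matrix_mul_assoc)

lemma transpose_newton_iterate:
  fixes X :: "'a::comm_ring_1 ^ 'm ^ 'm"
  shows "transpose ((newton_step ^^ k) X) = (newton_step ^^ k) (transpose X)"
  by (induction k) (auto simp: transpose_newton_step)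

section \<open>Complexification and the analytic limit\<close>

definition complex_matrix :: "real ^ 'm ^ 'm \<Rightarrow> complex ^ 'm ^ 'm" where
  "complex_matrix X = (\<chi> i j. of_real (X $ i $ j))"

lemma newton_step_complex_matrix:
  "newton_step (complex_matrix X) = complex_matrix (newton_step X)"
  by (simp add: newton_step_def complex_matrix_def matrix_matrix_mult_def vec_eq_iff)

lemma newton_iterate_complex_matrix:
  "(newton_step ^^ k) (complex_matrix X) = complex_matrix ((newton_step ^^ k) X)"
  by (induction k) (auto simp: newton_step_complex_matrix)

lemma holomorphic_newton_iterate:
  fixes X :: "complex \<Rightarrow> complex ^ 'm::finite ^ 'm"
  assumes "\<And>i j. (\<lambda>z. X z $ i $ j) holomorphic_on S"
  shows "(\<lambda>z. (newton_step ^^ k) (X z) $ i $ j) holomorphic_on S"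
proof (induction k arbitrary: i j)
  case (Suc k)
  then show ?case
    by (simp add: newton_step_def matrix_matrix_mult_def) (intro holomorphic_intros)
qed (use assms in simp)

text \<open>Near an idempotent the increments have a common geometric majorant, so the M-test and
  Weierstrass's theorem on uniform limits apply entrywise. The defect bound is passed on because
  idempotency of the limit is derived from it later, on the real axis.\<close>

lemma holomorphic_newton_limit:
  fixes X :: "complex \<Rightarrow> complex ^ 'm::finite ^ 'm"
  assumes r: "r > 0" and hol: "\<And>i j. (\<lambda>z. X z $ i $ j) holomorphic_on ball z0 r"
    and idem: "X z0 ** X z0 = X z0"
  obtains s Y where "0 < s" "s \<le> r" "\<And>i j. (\<lambda>z. Y z $ i $ j) holomorphic_on ball z0 s"
    "\<And>i j z. z \<in> ball z0 s \<Longrightarrow> (\<lambda>k. (newton_step ^^ k) (X z) $ i $ j) \<longlonglongrightarrow> Y z $ i $ j"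
    "\<And>z. z \<in> ball z0 s \<Longrightarrow> entry_norm (idem_defect (X z)) \<le> 1 / 14"
proof -
  have ent: "continuous_on (ball z0 r) (\<lambda>z. X z $ i $ j)" for i j
    using hol holomorphic_on_imp_continuous_on by blast
  have "continuous_on (ball z0 r) (\<lambda>z. entry_norm (X z))"
    unfolding entry_norm_def by (intro continuous_intros ent)
  then have c1: "((\<lambda>z. entry_norm (X z)) \<longlongrightarrow> entry_norm (X z0)) (at z0)"
    using r by (simp add: continuous_on_eq_continuous_at isCont_def)
  have "continuous_on (ball z0 r) (\<lambda>z. entry_norm (idem_defect (X z)))"
    unfolding entry_norm_def idem_defect_def matrix_matrix_mult_def
    by (simp, intro continuous_intros ent)
  then have c2: "((\<lambda>z. entry_norm (idem_defect (X z))) \<longlongrightarrow> entry_norm (idem_defect (X z0))) (at z0)"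
    using r by (simp add: continuous_on_eq_continuous_at isCont_def)
  have "entry_norm (idem_defect (X z0)) = 0"
    using idem by (simp add: idem_defect_def entry_norm_def)
  then have "\<forall>\<^sub>F z in at z0. entry_norm (X z) < entry_norm (X z0) + 1 \<and> entry_norm (idem_defect (X z)) < 1 / 14"
    using order_tendstoD(2)[OF c1, of "entry_norm (X z0) + 1"] order_tendstoD(2)[OF c2, of "1 / 14"]
    by (simp add: eventually_conj)
  then have "\<forall>\<^sub>F z in nhds z0. entry_norm (X z) < entry_norm (X z0) + 1 \<and> entry_norm (idem_defect (X z)) < 1 / 14"
    using \<open>entry_norm (idem_defect (X z0)) = 0\<close> by (subst eventually_nhds_iff_at) simp
  then obtain s' where s': "s' > 0" "\<And>z. dist z z0 < s' \<Longrightarrow> entry_norm (X z) < entry_norm (X z0) + 1"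
    "\<And>z. dist z z0 < s' \<Longrightarrow> entry_norm (idem_defect (X z)) < 1 / 14"
    unfolding eventually_nhds_metric by blast
  define s where "s = min s' r"
  \<comment> \<open>One unit covers the variation of the norm on the disc, the other the hypothesis
    \<open>entry_norm X + 1 \<le> B\<close> of \<open>newton_iterate_diff\<close>.\<close>
  define B where "B = entry_norm (X z0) + 2"
  have s: "0 < s" "s \<le> r" using s' r by (auto simp: s_def)
  have X: "entry_norm (X z) + 1 \<le> B" "entry_norm (idem_defect (X z)) \<le> 1 / 14" if "z \<in> ball z0 s" for z
    using s'(2,3)[of z] that by (auto simp: s_def B_def dist_commute)
  define D where "D i j k z = (newton_step ^^ Suc k) (X z) $ i $ j - (newton_step ^^ k) (X z) $ i $ j" for i j k z
  define Y where "Y z = (\<chi> i j. X z $ i $ j + (\<Sum>k. D i j k z))" for z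
  have D: "norm (D i j k z) \<le> B * (1/2)^k" if "z \<in> ball z0 s" for i j k z
    using norm_entry_le[of "(newton_step ^^ Suc k) (X z) - (newton_step ^^ k) (X z)" i j]
      newton_iterate_diff[OF X(2,1)[OF that], of k] by (simp add: D_def)
  have "uniform_limit (ball z0 s) (\<lambda>n z. \<Sum>k<n. D i j k z) (\<lambda>z. \<Sum>k. D i j k z) sequentially" for i j
    by (rule Weierstrass_m_test[OF D]) (auto intro!: summable_mult summable_geometric)
  then have "uniform_limit (ball z0 s) (\<lambda>n z. X z $ i $ j + (\<Sum>k<n. D i j k z)) (\<lambda>z. Y z $ i $ j) sequentially" for i j
    by (simp add: Y_def uniform_limit_intros)
  moreover have "X z $ i $ j + (\<Sum>k<n. D i j k z) = (newton_step ^^ n) (X z) $ i $ j" for n z i j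
    unfolding D_def by (subst sum_lessThan_telescope) simp
  ultimately have lim: "uniform_limit (ball z0 s) (\<lambda>n z. (newton_step ^^ n) (X z) $ i $ j) (\<lambda>z. Y z $ i $ j) sequentially" for i j
    by simp
  have "(\<lambda>z. Y z $ i $ j) holomorphic_on ball z0 s" for i j
  proof (rule holomorphic_uniform_sequence)
    show "(\<lambda>z. (newton_step ^^ n) (X z) $ i $ j) holomorphic_on ball z0 s" for n
      using s by (intro holomorphic_newton_iterate holomorphic_on_subset[OF hol]) auto
    fix z assume "z \<in> ball z0 s"
    then obtain d where "d > 0" "cball z d \<subseteq> ball z0 s"
      using open_contains_cball by blast
    then show "\<exists>d>0. cball z d \<subseteq> ball z0 s \<and>
        uniform_limit (cball z d) (\<lambda>n z. (newton_step ^^ n) (X z) $ i $ j) (\<lambda>z. Y z $ i $ j) sequentially"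
      using lim uniform_limit_on_subset by blast
  qed auto
  moreover have "(\<lambda>k. (newton_step ^^ k) (X z) $ i $ j) \<longlonglongrightarrow> Y z $ i $ j" if "z \<in> ball z0 s" for z i j
    using tendsto_uniform_limitI[OF lim that] .
  ultimately show thesis using that s X(2) by blast
qed

text \<open>Convergence of the iterates is part of the conclusion so that algebraic relations of
  \<open>X t\<close> can be handed on to \<open>Q t\<close>. Nothing moves at \<open>x\<close>,
  since idempotents are fixed points of the iteration.\<close>

lemma real_analytic_idempotent_lift:
  fixes X :: "real \<Rightarrow> real ^ 'm::finite ^ 'm"
  assumes X: "real_analytic_at X x" and idem: "X x ** X x = X x"
  obtains Q where "real_analytic_at Q x" "Q x = X x"
    "\<forall>\<^sub>F t in nhds x. (\<lambda>k. (newton_step ^^ k) (X t)) \<longlonglongrightarrow> Q t"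
    "\<forall>\<^sub>F t in nhds x. Q t ** Q t = Q t"
proof -
  have "\<exists>r F. r > 0 \<and> F holomorphic_on ball (of_real x) r \<and>
      (\<forall>y. \<bar>y - x\<bar> < r \<longrightarrow> F (of_real y) = of_real (X y $ i $ j))" for i j
  proof -
    have "real_analytic_at (\<lambda>t. X t $ i $ j) x"
      using X by (simp add: real_analytic_at_vec_iff)
    then show ?thesis
      by (rule real_analytic_at_holomorphic_extension) blast
  qed
  then obtain R F where R: "\<And>i j. R i j > 0" and F: "\<And>i j. F i j holomorphic_on ball (of_real x) (R i j)"
      "\<And>i j y. \<bar>y - x\<bar> < R i j \<Longrightarrow> F i j (of_real y) = of_real (X y $ i $ j)"
    by metis
  \<comment> \<open>The entries are extended separately; finitely many of them share a
    radius.\<close>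
  define r where "r = Min (range (\<lambda>(i, j). R i j))"
  have "R i j \<in> range (\<lambda>(i, j). R i j)" for i j
    by (rule image_eqI[of _ _ "(i, j)"]) auto
  then have r: "r > 0" "r \<le> R i j" for i j
    using R by (auto simp: r_def)
  define Z where "Z z = (\<chi> i j. F i j z)" for z
  have Z: "Z (of_real y) = complex_matrix (X y)" if "\<bar>y - x\<bar> < r" for y
    using F(2)[OF less_le_trans[OF that r(2)]] by (simp add: Z_def complex_matrix_def vec_eq_iff)
  have hol: "(\<lambda>z. Z z $ i $ j) holomorphic_on ball (of_real x) r" for i j
    using F(1)[of i j] r(2)[of i j] by (simp add: Z_def) (auto elim!: holomorphic_on_subset)
  have idem_Z: "Z (of_real x) ** Z (of_real x) = Z (of_real x)"
  proof -
    have "complex_matrix (X x) ** complex_matrix (X x) = complex_matrix (X x ** X x)"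
      by (simp add: complex_matrix_def matrix_matrix_mult_def vec_eq_iff)
    then show ?thesis using Z[of x] r idem by simp
  qed
  obtain s Y where s: "0 < s" "s \<le> r"
    and Y: "\<And>i j. (\<lambda>z. Y z $ i $ j) holomorphic_on ball (of_real x) s"
    "\<And>i j z. z \<in> ball (of_real x) s \<Longrightarrow> (\<lambda>k. (newton_step ^^ k) (Z z) $ i $ j) \<longlonglongrightarrow> Y z $ i $ j"
    and small: "\<And>z. z \<in> ball (of_real x) s \<Longrightarrow> entry_norm (idem_defect (Z z)) \<le> 1 / 14"
    by (rule holomorphic_newton_limit[OF r(1) hol idem_Z]) (rule that)
  define Q where "Q t = (\<chi> i j. Re (Y (of_real t) $ i $ j))" for t :: real
  have inball: "of_real t \<in> ball (complex_of_real x) s" if "\<bar>t - x\<bar> < s" for t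
    using that by (simp add: dist_norm norm_minus_commute flip: of_real_diff)
  have "real_analytic_at Q x"
    unfolding real_analytic_at_vec_iff Q_def
    by (intro allI real_analytic_at_Re_holomorphic[OF s(1) Y(1)]) simp
  moreover have lim: "(\<lambda>k. (newton_step ^^ k) (X t)) \<longlonglongrightarrow> Q t" if t: "\<bar>t - x\<bar> < s" for t
  proof (intro vec_tendstoI)
    fix i j
    have "(\<lambda>k. complex_matrix ((newton_step ^^ k) (X t)) $ i $ j) \<longlonglongrightarrow> Y (of_real t) $ i $ j"
      using Y(2)[OF inball[OF t], of i j] Z[of t] t s by (simp add: newton_iterate_complex_matrix)
    from tendsto_Re[OF this] show "(\<lambda>k. (newton_step ^^ k) (X t) $ i $ j) \<longlonglongrightarrow> Q t $ i $ j"
      by (simp add: complex_matrix_def Q_def)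
  qed
  moreover have "Q t ** Q t = Q t" if t: "\<bar>t - x\<bar> < s" for t
  proof -
    have "idem_defect (complex_matrix (X t)) = complex_matrix (idem_defect (X t))"
      by (simp add: idem_defect_def complex_matrix_def matrix_matrix_mult_def vec_eq_iff)
    then have "entry_norm (idem_defect (X t)) = entry_norm (idem_defect (complex_matrix (X t)))"
      by (simp add: entry_norm_def complex_matrix_def)
    then have "entry_norm (idem_defect (X t)) \<le> 1 / 14"
      using small[OF inball[OF t]] Z[of t] t s by simp
    from idem_defect_newton_iterate[OF this]
    have "norm (idem_defect ((newton_step ^^ k) (X t)) $ i $ j) \<le> 1 / 14 * (1 / 4) ^ k" for i j k
      by (rule order.trans[OF norm_entry_le])
    note le = this
    have "(\<lambda>k. (1 / 4) ^ k) \<longlonglongrightarrow> (0::real)"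
      by (rule LIMSEQ_realpow_zero) auto
    from tendsto_mult_right_zero[OF this, of "1 / 14"]
    have null: "(\<lambda>k. 1 / 14 * (1 / 4) ^ k :: real) \<longlonglongrightarrow> 0" .
    have "(\<lambda>k. idem_defect ((newton_step ^^ k) (X t)) $ i $ j) \<longlonglongrightarrow> 0" for i j
      by (rule Lim_null_comparison[OF always_eventually null]) (use le in blast)
    then have "(\<lambda>k. idem_defect ((newton_step ^^ k) (X t))) \<longlonglongrightarrow> 0"
      by (intro vec_tendstoI) simp
    moreover have "(\<lambda>k. idem_defect ((newton_step ^^ k) (X t))) \<longlonglongrightarrow> Q t ** Q t - Q t"
      unfolding idem_defect_def by (intro tendsto_diff tendsto_matrix_mult lim t)
    ultimately have "Q t ** Q t - Q t = 0" using LIMSEQ_unique by blast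
    then show ?thesis by simp
  qed
  moreover have "Q x = X x"
    using lim[of x] s newton_iterate_idem[OF idem] by (simp add: LIMSEQ_const_iff)
  moreover have "\<forall>\<^sub>F t in nhds x. \<bar>t - x\<bar> < s"
    unfolding eventually_nhds_real using s(1) by (intro exI[of _ s]) simp
  ultimately show thesis
    by (intro that[of Q]) (auto elim!: eventually_mono)
qed

section \<open>Spectral projections of a single self-adjoint matrix\<close>

text \<open>Self-adjointness for x . A y, written as a matrix equation: for families in t it is then
  an identity between analytic functions, which survives cancellation and limits.\<close>

definition self_adj :: "real ^ 'm ^ 'm \<Rightarrow> real ^ 'm ^ 'm \<Rightarrow> bool" where
  "self_adj A X \<longleftrightarrow> transpose X ** A = A ** X"

lemma inner_matrix_left: "(M *v x) \<bullet> y = x \<bullet> (transpose M *v (y :: real ^ 'n::finite))"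
  for x :: "real ^ 'm::finite"
  using dot_lmul_matrix[of x "transpose M" y] by simp

lemma positive_definite_symmetric: "positive_definite A \<Longrightarrow> transpose A = A"
  by (simp add: positive_definite_def)

lemma positive_definite_inner_commute:
  "positive_definite A \<Longrightarrow> x \<bullet> (A *v y) = y \<bullet> (A *v x)"
  by (metis inner_commute inner_matrix_left positive_definite_symmetric)

lemma positive_definite_pos: "positive_definite A \<Longrightarrow> x \<noteq> 0 \<Longrightarrow> 0 < x \<bullet> (A *v x)"
  by (simp add: positive_definite_def)

lemma positive_definite_eq_0: "positive_definite A \<Longrightarrow> x \<bullet> (A *v x) = 0 \<Longrightarrow> x = 0"
  using positive_definite_pos by force

lemma self_adj_inner:
  assumes "self_adj A X"
  shows "(X *v x) \<bullet> (A *v y) = x \<bullet> (A *v (X *v y))"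
proof -
  have "(X *v x) \<bullet> (A *v y) = x \<bullet> ((transpose X ** A) *v y)"
    by (simp add: inner_matrix_left matrix_vector_mul_assoc del: transpose_matrix_vector)
  then show ?thesis using assms by (simp add: self_adj_def matrix_vector_mul_assoc)
qed

lemma self_adj_diff: "self_adj A X \<Longrightarrow> self_adj A Y \<Longrightarrow> self_adj A (X - Y)"
  by (simp add: self_adj_def transpose_diff matrix_distribs)

lemma self_adj_scaleR: "self_adj A X \<Longrightarrow> self_adj A (c *\<^sub>R X)"
  by (simp add: self_adj_def transpose_scalar matrix_distribs)

lemma self_adj_scaleR_iff: "c \<noteq> 0 \<Longrightarrow> self_adj A (c *\<^sub>R X) \<longleftrightarrow> self_adj A X"
  by (simp add: self_adj_def transpose_scalar matrix_distribs)

lemma self_adj_mat_1: "transpose A = A \<Longrightarrow> self_adj A (mat 1)"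
  by (simp add: self_adj_def)

lemma self_adj_mult:
  assumes "self_adj A X" "self_adj A Y" "X ** Y = Y ** X"
  shows "self_adj A (X ** Y)"
proof -
  have "transpose (X ** Y) ** A = transpose Y ** (transpose X ** A)"
    by (simp add: matrix_transpose_mul matrix_mul_assoc)
  also have "\<dots> = A ** (Y ** X)"
    using assms(1,2) by (simp add: self_adj_def matrix_mul_assoc)
  finally show ?thesis using assms(3) by (simp add: self_adj_def)
qed

text \<open>The squared A-length of f x is x . A (f (f x)) = 0. Every later exclusion of nilpotents
  rests on this.\<close>

lemma self_adj_square_eq_0:
  assumes "positive_definite A" "self_adj A f" "f ** f = 0"
  shows "f = 0"
proof -
  have "f *v x = 0" for x
  proof (rule positive_definite_eq_0[OF assms(1)])
    show "(f *v x) \<bullet> (A *v (f *v x)) = 0"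
      using self_adj_inner[OF assms(2), of x "f *v x"] assms(3)
      by (simp add: matrix_vector_mul_assoc flip: matrix_mul_assoc)
  qed
  then show ?thesis by (simp add: matrix_eq)
qed

text \<open>The Rayleigh quotient attains its maximum on the unit sphere of \<open>V\<close>, and
  the vanishing of its first variation there is the eigenvector equation.\<close>

lemma self_adj_eigenvector:
  fixes A S :: "real ^ 'm::finite ^ 'm"
  assumes A: "positive_definite A" and S: "self_adj A S"
    and V: "subspace V" "\<And>x. x \<in> V \<Longrightarrow> S *v x \<in> V" and v: "v \<in> V" "v \<noteq> 0"
  obtains x \<mu> where "x \<in> V" "x \<noteq> 0" "S *v x = \<mu> *\<^sub>R x"
proof -
  define \<phi> where "\<phi> x = (x \<bullet> (A *v (S *v x))) / (x \<bullet> (A *v x))" for x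
  let ?K = "V \<inter> sphere 0 1"
  have "compact ?K"
    by (intro closed_Int_compact closed_subspace V(1)) simp
  moreover have "v /\<^sub>R norm v \<in> ?K"
    using v V(1) by (simp add: subspace_scale)
  moreover have "continuous_on ?K \<phi>"
  proof -
    have "continuous_on ?K (\<lambda>x. M *v x)" for M :: "real ^ 'm ^ 'm"
      by (intro linear_continuous_on linear_conv_bounded_linear[THEN iffD1] matrix_vector_mul_linear)
    moreover have "x \<bullet> (A *v x) \<noteq> 0" if "x \<in> ?K" for x
      using positive_definite_eq_0[OF A, of x] that by auto
    ultimately show ?thesis
      unfolding \<phi>_def matrix_vector_mul_assoc by (intro continuous_intros) auto
  qed
  ultimately have "\<exists>x\<in>?K. \<forall>y\<in>?K. \<phi> y \<le> \<phi> x"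
    by (intro continuous_attains_sup) auto
  then obtain x where x: "x \<in> ?K" and max: "\<And>y. y \<in> ?K \<Longrightarrow> \<phi> y \<le> \<phi> x"
    by blast
  \<comment> \<open>With the denominator cleared, the maximum property says that a quadratic form is
    nonpositive on \<open>V\<close> and zero at \<open>x\<close>.\<close>
  define g where "g y = y \<bullet> (A *v (S *v y)) - \<phi> x * (y \<bullet> (A *v y))" for y
  have x0: "x \<noteq> 0" "x \<in> V" using x by auto
  have gx: "g x = 0" using positive_definite_pos[OF A x0(1)] by (simp add: g_def \<phi>_def)
  have g: "g y \<le> 0" if "y \<in> V" for y
  proof (cases "y = 0")
    case False
    have "\<phi> (y /\<^sub>R norm y) = \<phi> y"
      using False by (simp add: \<phi>_def matrix_vector_mult_scaleR)
    with max[of "y /\<^sub>R norm y"] False that V(1) have "\<phi> y \<le> \<phi> x" by (simp add: subspace_scale)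
    then show ?thesis using positive_definite_pos[OF A False] by (simp add: g_def \<phi>_def field_simps)
  qed (simp add: g_def)
  \<comment> \<open>The residual itself serves as the direction of variation; the first-order
    coefficient is then twice its own squared A-length \<open>b\<close>.\<close>
  define y where "y = S *v x - \<phi> x *\<^sub>R x"
  have y: "y \<in> V" using x0 V by (simp add: y_def subspace_diff subspace_scale)
  define b where "b = y \<bullet> (A *v y)"
  have exp: "g (x + s *\<^sub>R y) = g x + 2 * s * b + s\<^sup>2 * g y" for s
  proof -
    have 1: "x \<bullet> (A *v (S *v y)) = y \<bullet> (A *v (S *v x))"
      using positive_definite_inner_commute[OF A, of "S *v x" y] self_adj_inner[OF S, of x y] by simp
    have 2: "x \<bullet> (A *v y) = y \<bullet> (A *v x)"
      by (rule positive_definite_inner_commute[OF A])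
    have 3: "b = y \<bullet> (A *v (S *v x)) - \<phi> x * (y \<bullet> (A *v x))"
      unfolding b_def by (subst (2) y_def) (simp add: algebra_simps)
    show ?thesis unfolding 3 g_def
      by (simp add: algebra_simps 1 2 power2_eq_square)
  qed
  have "2 * s * b + s\<^sup>2 * g y \<le> 0" for s
    using g[of "x + s *\<^sub>R y"] x0 y V(1) exp[of s] gx by (simp add: subspace_add subspace_scale)
  \<comment> \<open>The step \<open>b / (1 - g y)\<close> has a positive denominator because
    \<open>g y\<close> is nonpositive, so \<open>g y = 0\<close> is no exception; clearing it leaves
    b^2 (2 - g y) \<le> 0.\<close>
  from mult_right_mono[OF this[of "b / (1 - g y)"], of "(1 - g y)\<^sup>2"]
  have "(2 * (b / (1 - g y)) * b + (b / (1 - g y))\<^sup>2 * g y) * (1 - g y)\<^sup>2 \<le> 0" by simp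
  also have "(2 * (b / (1 - g y)) * b + (b / (1 - g y))\<^sup>2 * g y) * (1 - g y)\<^sup>2 = b * b * (2 - g y)"
    using g[OF y] by (simp add: power2_eq_square divide_simps) (simp add: algebra_simps)
  finally have "b * b * (2 - g y) \<le> 0" .
  moreover have "b * b * 2 \<le> b * b * (2 - g y)"
    using g[OF y] by (intro mult_left_mono) auto
  ultimately have "b = 0"
    using zero_le_square[of b] by (metis mult_eq_0_iff mult_le_0_iff order.trans order_antisym zero_less_numeral linorder_not_le)
  then have "y = 0" using positive_definite_eq_0[OF A] by (simp add: b_def)
  then show thesis using that x0 by (simp add: y_def)
qed

text \<open>A monic polynomial in \<open>S\<close>, encoded by the list of its roots because these
  will become functions of t.\<close>

primrec matrix_prod :: "real ^ 'm ^ 'm \<Rightarrow> real list \<Rightarrow> real ^ 'm ^ 'm" where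
  "matrix_prod S [] = mat 1"
| "matrix_prod S (a # L) = (S - a *\<^sub>R mat 1) ** matrix_prod S L"

lemma matrix_prod_commute:
  assumes "B ** S = S ** B"
  shows "B ** matrix_prod S L = matrix_prod S L ** B"
proof (induction L)
  case (Cons a L)
  have "B ** matrix_prod S (a # L) = (B ** (S - a *\<^sub>R mat 1)) ** matrix_prod S L"
    by (simp add: matrix_mul_assoc)
  also have "\<dots> = (S - a *\<^sub>R mat 1) ** (B ** matrix_prod S L)"
    using assms by (simp add: matrix_distribs matrix_mul_assoc)
  finally show ?case using Cons by (simp add: matrix_mul_assoc)
qed simp

lemma matrix_prod_append: "matrix_prod S (L @ L') = matrix_prod S L ** matrix_prod S L'"
  by (induction L) (auto simp: matrix_mul_assoc)

lemma matrix_prod_eigen: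
  assumes "S ** X = \<mu> *\<^sub>R X"
  shows "matrix_prod S L ** X = (\<Prod>l\<leftarrow>L. \<mu> - l) *\<^sub>R X"
proof (induction L)
  case (Cons a L)
  have "matrix_prod S (a # L) ** X = (S - a *\<^sub>R mat 1) ** ((\<Prod>l\<leftarrow>L. \<mu> - l) *\<^sub>R X)"
    using Cons by (simp flip: matrix_mul_assoc)
  then show ?case using assms by (simp add: matrix_distribs algebra_simps)
qed simp

lemma matrix_prod_eigenvector:
  assumes "S *v x = \<mu> *\<^sub>R x"
  shows "matrix_prod S L *v x = (\<Prod>l\<leftarrow>L. \<mu> - l) *\<^sub>R x"
proof (induction L)
  case (Cons a L)
  have "matrix_prod S (a # L) *v x = (S - a *\<^sub>R mat 1) *v ((\<Prod>l\<leftarrow>L. \<mu> - l) *\<^sub>R x)"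
    using Cons by (simp flip: matrix_vector_mul_assoc)
  then show ?case using assms
    by (simp add: algebra_simps flip: scaleR_matrix_vector_assoc)
qed simp

lemma self_adj_matrix_prod:
  assumes "transpose A = A" "self_adj A S"
  shows "self_adj A (matrix_prod S L)"
proof (induction L)
  case (Cons a L)
  have "(S - a *\<^sub>R mat 1) ** matrix_prod S L = matrix_prod S L ** (S - a *\<^sub>R mat 1)"
    by (rule matrix_prod_commute) (simp add: matrix_distribs)
  then show ?case
    using Cons assms by (auto intro!: self_adj_mult self_adj_diff self_adj_scaleR self_adj_mat_1)
qed (simp add: assms self_adj_mat_1)

text \<open>Diagonalisability in polynomial form. The A-orthogonal complement of an eigenvector
  inside an invariant subspace is again invariant and has smaller dimension; each eigenvector
  contributes one factor.\<close>

lemma self_adj_matrix_prod_eq_0: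
  assumes A: "positive_definite A" and S: "self_adj A S"
  obtains L where "matrix_prod S L = 0"
proof -
  have "\<exists>L. \<forall>x\<in>V. matrix_prod S L *v x = 0"
    if "subspace V" "\<And>x. x \<in> V \<Longrightarrow> S *v x \<in> V" for V
    using that
  proof (induction "dim V" arbitrary: V rule: less_induct)
    case less
    show ?case
    proof (cases "\<exists>v\<in>V. v \<noteq> 0")
      case True
      then obtain x \<mu> where x: "x \<in> V" "x \<noteq> 0" "S *v x = \<mu> *\<^sub>R x"
        using self_adj_eigenvector[OF A S less.prems] by metis
      define W where "W = V \<inter> {y. x \<bullet> (A *v y) = 0}"
      have W: "subspace W"
        using less.prems(1) by (auto simp: W_def subspace_def algebra_simps)
      have inv: "S *v y \<in> W" if "y \<in> W" for y
        using that less.prems(2) self_adj_inner[OF S, of x y] x(3) by (simp add: W_def)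
      have "x \<notin> W" using positive_definite_pos[OF A x(2)] by (simp add: W_def)
      then have "dim W < dim V"
        using subspace_dim_equal[OF W less.prems(1)] x(1) dim_subset[of W V]
        by (metis Int_lower1 W_def linorder_not_le)
      from less.hyps[OF this W inv] obtain L where L: "\<And>y. y \<in> W \<Longrightarrow> matrix_prod S L *v y = 0"
        by blast
      have "matrix_prod S (\<mu> # L) *v y = 0" if y: "y \<in> V" for y
      proof -
        define c where "c = (x \<bullet> (A *v y)) / (x \<bullet> (A *v x))"
        define w where "w = y - c *\<^sub>R x"
        have w: "w \<in> W"
          using y x(1) less.prems(1) positive_definite_pos[OF A x(2)]
          by (simp add: w_def W_def c_def subspace_diff subspace_scale algebra_simps)
        have yw: "y = w + c *\<^sub>R x" by (simp add: w_def)
        have "(S - \<mu> *\<^sub>R mat 1) *v (c *\<^sub>R x) = 0"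
          using x(3) by (simp add: algebra_simps flip: scaleR_matrix_vector_assoc)
        moreover have "(S - \<mu> *\<^sub>R mat 1) *v w \<in> W"
          using w inv[OF w] W by (simp add: algebra_simps subspace_diff subspace_scale flip: scaleR_matrix_vector_assoc)
        \<comment> \<open>The new factor is moved to the right, where it acts first: it kills the
          eigenvector component and keeps the rest in \<open>W\<close>.\<close>
        moreover have "matrix_prod S (\<mu> # L) = matrix_prod S L ** (S - \<mu> *\<^sub>R mat 1)"
          unfolding matrix_prod.simps by (rule matrix_prod_commute) (simp add: matrix_distribs)
        ultimately show ?thesis
          using L by (simp add: yw matrix_vector_right_distrib flip: matrix_vector_mul_assoc)
      qed
      then show ?thesis by blast
    qed (auto intro: exI[of _ "[]"])
  qed
  from this[of UNIV] show thesis using that by (auto simp: matrix_eq)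
qed

text \<open>The factor belonging to \<open>\<mu>\<close> kills the range of \<open>f\<close>, so
  \<open>S\<close> acts there as \<open>\<mu>\<close>, and the remaining product acts as the scalar
  obtained by substituting \<open>\<mu>\<close> for \<open>S\<close>.\<close>

lemma spectral_peel:
  assumes "P ** P = P" "P ** S = S ** P" "matrix_prod S (\<mu> # L) ** P = 0"
  defines "f \<equiv> matrix_prod S L ** P"
  shows "S ** f = \<mu> *\<^sub>R f" "f ** f = (\<Prod>l\<leftarrow>L. \<mu> - l) *\<^sub>R f"
proof -
  have "(S - \<mu> *\<^sub>R mat 1) ** f = 0"
    using assms(3) by (simp add: f_def matrix_mul_assoc)
  then show S: "S ** f = \<mu> *\<^sub>R f"
    by (simp add: matrix_distribs)
  have "P ** f = (P ** matrix_prod S L) ** P"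
    by (simp add: f_def matrix_mul_assoc)
  also have "\<dots> = f"
    using matrix_prod_commute[OF assms(2), of L] assms(1) by (simp add: f_def flip: matrix_mul_assoc)
  finally have "f ** f = matrix_prod S L ** f"
    by (metis f_def matrix_mul_assoc)
  with matrix_prod_eigen[OF S] show "f ** f = (\<Prod>l\<leftarrow>L. \<mu> - l) *\<^sub>R f" by simp
qed

text \<open>Take a shortest list of roots annihilating \<open>P\<close> and drop the first: f is
  nonzero by minimality and not nilpotent, so f^2 = h f with nonzero h. The result differs from
  \<open>P\<close> because \<open>S\<close> acts on it as a scalar. The explicit polynomial form
  matters, as it will be evaluated at neighbouring t.\<close>

lemma spectral_projection:
  assumes A: "positive_definite A" and S: "self_adj A S"
    and P: "P ** P = P" "P ** S = S ** P" "self_adj A P" "P \<noteq> 0" "\<And>c. S ** P \<noteq> c *\<^sub>R P"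
  obtains L h where "h \<noteq> 0"
    "let Q = inverse h *\<^sub>R (matrix_prod S L ** P) in Q ** Q = Q \<and> Q \<noteq> 0 \<and> Q \<noteq> P"
proof -
  have "\<exists>L. matrix_prod S L ** P = 0"
    using self_adj_matrix_prod_eq_0[OF A S] by (metis times0_left)
  then obtain L0 where L0: "matrix_prod S L0 ** P = 0"
    and min: "\<And>L. matrix_prod S L ** P = 0 \<Longrightarrow> length L0 \<le> length L"
    using ex_has_least_nat[of "\<lambda>L. matrix_prod S L ** P = 0" _ length] by metis
  with P(4) obtain \<mu> L where L: "L0 = \<mu> # L" by (cases L0) auto
  define f where "f = matrix_prod S L ** P"
  define h where "h = (\<Prod>l\<leftarrow>L. \<mu> - l)"
  have f0: "f \<noteq> 0" using min[of L] L by (auto simp: f_def)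
  have f: "S ** f = \<mu> *\<^sub>R f" "f ** f = h *\<^sub>R f"
    using spectral_peel[OF P(1,2), of \<mu> L] L0 L by (auto simp: f_def h_def)
  have "self_adj A f"
    unfolding f_def using matrix_prod_commute[OF P(2), of L]
    by (intro self_adj_mult self_adj_matrix_prod positive_definite_symmetric A S P) simp
  then have h: "h \<noteq> 0"
    using self_adj_square_eq_0[OF A] f(2) f0 by auto
  define Q where "Q = inverse h *\<^sub>R f"
  have "Q ** Q = Q" using f(2) h by (simp add: Q_def matrix_distribs)
  moreover have "Q \<noteq> 0" using h f0 by (simp add: Q_def)
  moreover have "Q \<noteq> P"
    using f(1) P(5)[of \<mu>] by (auto simp: Q_def matrix_distribs)
  ultimately show thesis using that[OF h, of L] by (simp add: Q_def f_def)
qed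

lemma dim_range_idempotent_less:
  fixes P Q :: "real ^ 'm::finite ^ 'm"
  assumes "P ** Q = Q" "Q ** P = Q" "Q ** Q = Q" "Q \<noteq> P"
  shows "dim (range ((*v) Q)) < dim (range ((*v) P))"
proof -
  have sub: "subspace (range ((*v) X))" for X :: "real ^ 'm ^ 'm"
    by (intro linear_subspace_image) auto
  have le: "range ((*v) Q) \<subseteq> range ((*v) P)"
    using assms(1) by (metis (no_types, lifting) image_subsetI matrix_vector_mul_assoc rangeI)
  have "range ((*v) Q) \<noteq> range ((*v) P)"
  proof
    assume eq: "range ((*v) Q) = range ((*v) P)"
    have "Q *v (P *v x) = P *v x" for x
    proof -
      obtain y where "P *v x = Q *v y" using eq by blast
      then show ?thesis using assms(3) by (simp add: matrix_vector_mul_assoc)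
    qed
    then have "Q ** P = P" by (simp add: matrix_eq matrix_vector_mul_assoc)
    with assms(2,4) show False by simp
  qed
  then show ?thesis
    using subspace_dim_equal[OF sub sub le] by (metis linorder_not_le)
qed

section \<open>Analytic eigenvalues\<close>

text \<open>Idempotency bounds the norm by its own square. This gap forces a continuous projection
  that vanishes at a point to vanish near it.\<close>

lemma idempotent_entry_norm_less_1:
  assumes "P ** P = P" "entry_norm P < 1"
  shows "P = 0"
proof -
  have "entry_norm P \<le> entry_norm P * entry_norm P"
    using entry_norm_mult[of P P] assms(1) by simp
  then have "entry_norm P = 0"
    using assms(2) entry_norm_nonneg[of P] mult_strict_left_mono[of "entry_norm P" 1 "entry_norm P"]
    by linarith
  then show ?thesis
    using norm_entry_le[of P] by (simp add: vec_eq_iff)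
qed

lemma isCont_entry_norm:
  fixes P :: "real \<Rightarrow> real ^ 'm::finite ^ 'm"
  shows "isCont P x \<Longrightarrow> isCont (\<lambda>t. entry_norm (P t)) x"
  unfolding entry_norm_def by (intro continuous_intros)

lemma idempotent_eventually_0:
  fixes P :: "real \<Rightarrow> real ^ 'm::finite ^ 'm"
  assumes "isCont P x" "\<forall>\<^sub>F t in nhds x. P t ** P t = P t" "P x = 0"
  shows "\<forall>\<^sub>F t in nhds x. P t = 0"
proof -
  have "((\<lambda>t. entry_norm (P t)) \<longlongrightarrow> entry_norm (P x)) (nhds x)"
    using isCont_entry_norm[OF assms(1)] tendsto_at_iff_tendsto_nhds[of "\<lambda>t. entry_norm (P t)" x]
    by (simp add: isCont_def)
  moreover have "entry_norm (P x) < 1" using assms(3) by (simp add: entry_norm_def)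
  ultimately have "\<forall>\<^sub>F t in nhds x. entry_norm (P t) < 1"
    by (rule order_tendstoD(2))
  with assms(2) show ?thesis
    by eventually_elim (rule idempotent_entry_norm_less_1)
qed

text \<open>Identities obtained by dividing by a power of t - x hold only off \<open>x\<close>;
  continuity of both sides supplies the point itself.\<close>

lemma real_analytic_eq_extend:
  fixes f g :: "real \<Rightarrow> 'a::euclidean_space"
  assumes "real_analytic_at f x" "real_analytic_at g x" "\<forall>\<^sub>F t in at x. f t = g t"
  shows "\<forall>\<^sub>F t in nhds x. f t = g t"
proof -
  have f: "(f \<longlongrightarrow> f x) (at x)" and g: "(g \<longlongrightarrow> g x) (at x)"
    using assms(1,2)[THEN real_analytic_at_isCont] by (auto simp: isCont_def)
  have "(f \<longlongrightarrow> g x) (at x)"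
    using tendsto_cong[OF assms(3)] g by blast
  with f have "f x = g x"
    by (rule tendsto_unique[OF trivial_limit_at])
  with assms(3) show ?thesis by (simp add: eventually_nhds_iff_at)
qed

lemma real_analytic_at_matrix_prod:
  assumes "real_analytic_at S x" "\<And>l. l \<in> set L \<Longrightarrow> real_analytic_at l x"
  shows "real_analytic_at (\<lambda>t. matrix_prod (S t) (map (\<lambda>l. l t) L)) x"
  using assms(2)
  by (induction L)
     (auto intro!: real_analytic_at_matrix_mult real_analytic_at_diff real_analytic_at_scaleR assms(1))

lemma newton_limit_intertwine:
  fixes X Y :: "real ^ 'm::finite ^ 'm"
  assumes "B ** X = Y ** B" "(\<lambda>k. (newton_step ^^ k) X) \<longlonglongrightarrow> Q" "(\<lambda>k. (newton_step ^^ k) Y) \<longlonglongrightarrow> R"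
  shows "B ** Q = R ** B"
proof -
  have "(\<lambda>k. B ** (newton_step ^^ k) X) \<longlonglongrightarrow> B ** Q"
    by (intro tendsto_matrix_mult tendsto_const assms)
  moreover have "(\<lambda>k. (newton_step ^^ k) Y ** B) \<longlonglongrightarrow> R ** B"
    by (intro tendsto_matrix_mult tendsto_const assms)
  ultimately show ?thesis
    unfolding newton_iterate_intertwine[OF assms(1)] by (rule LIMSEQ_unique)
qed

lemma newton_limit_self_adj:
  fixes X :: "real ^ 'm::finite ^ 'm"
  assumes "self_adj A X" "(\<lambda>k. (newton_step ^^ k) X) \<longlonglongrightarrow> Q"
  shows "self_adj A Q"
proof -
  have "(\<lambda>k. (newton_step ^^ k) (transpose X)) \<longlonglongrightarrow> transpose Q"
    unfolding transpose_newton_iterate[symmetric] using assms(2)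
    unfolding transpose_def by (intro tendsto_vec_lambda tendsto_vec_nth)
  from newton_limit_intertwine[OF _ assms(2) this, of A] assms(1) show ?thesis
    by (simp add: self_adj_def)
qed

lemma newton_limit_absorb:
  fixes X :: "real ^ 'm::finite ^ 'm"
  assumes "P ** X = X" "(\<lambda>k. (newton_step ^^ k) X) \<longlonglongrightarrow> Q"
  shows "P ** Q = Q"
proof -
  have "(\<lambda>k. P ** (newton_step ^^ k) X) \<longlonglongrightarrow> P ** Q"
    by (intro tendsto_matrix_mult tendsto_const assms)
  with assms(2) show ?thesis
    unfolding newton_iterate_absorb[OF assms(1)] using LIMSEQ_unique by blast
qed

definition eigenvalue :: "real ^ 'm ^ 'm \<Rightarrow> real \<Rightarrow> bool" where
  "eigenvalue M \<mu> \<longleftrightarrow> (\<exists>v. v \<noteq> 0 \<and> M *v v = \<mu> *\<^sub>R v)"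

text \<open>A Rayleigh quotient is subtracted because it is visibly analytic. Let g x be the leading
  coefficient of S = T P - \<open>\<mu>\<close> P, if S is not zero near x. It inherits p . A (g p)
  = 0 for the test vector p; were it a scalar c on the range of \<open>P x\<close>, this would force
  c = 0 and then g x = 0. So g x has a proper spectral projection, which is lifted to nearby
  t.\<close>

lemma local_splitting:
  fixes A T P :: "real \<Rightarrow> real ^ 'm::finite ^ 'm"
  assumes A: "real_analytic_at A x" "\<forall>\<^sub>F t in nhds x. positive_definite (A t)"
    and T: "real_analytic_at T x" "\<forall>\<^sub>F t in nhds x. self_adj (A t) (T t)"
    and P: "real_analytic_at P x"
      "\<forall>\<^sub>F t in nhds x. P t ** P t = P t \<and> self_adj (A t) (P t) \<and> P t ** T t = T t ** P t"
    and Px: "P x \<noteq> 0"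
  obtains (scalar) \<mu> where "real_analytic_at \<mu> x" "\<forall>\<^sub>F t in nhds x. eigenvalue (T t) (\<mu> t)"
      "\<forall>\<^sub>F t in nhds x. T t ** P t = \<mu> t *\<^sub>R P t"
  | (split) Q where "real_analytic_at Q x" "Q x \<noteq> 0" "Q x \<noteq> P x"
      "\<forall>\<^sub>F t in nhds x. Q t ** Q t = Q t \<and> self_adj (A t) (Q t) \<and> Q t ** T t = T t ** Q t \<and>
        P t ** Q t = Q t \<and> Q t ** P t = Q t"
proof -
  obtain w where w: "P x *v w \<noteq> 0" using Px by (auto simp: matrix_eq)
  define p where "p t = P t *v w" for t
  have p: "real_analytic_at p x" unfolding p_def
    by (intro real_analytic_at_matrix_vector_mult P) auto
  define d where "d t = p t \<bullet> (A t *v p t)" for t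
  have d: "real_analytic_at d x" unfolding d_def
    by (intro real_analytic_at_matrix_vector_mult real_analytic_at_inner A p)
  have Ax: "positive_definite (A x)" using A(2) by (rule eventually_nhds_x_imp_x)
  have dx: "d x \<noteq> 0" using positive_definite_pos[OF Ax w] by (simp add: d_def p_def)
  have d_ev: "\<forall>\<^sub>F t in nhds x. d t \<noteq> 0"
    using real_analytic_at_isCont[OF d] dx
      tendsto_imp_eventually_ne[of d "d x" "nhds x" 0] tendsto_at_iff_tendsto_nhds[of d x]
    by (simp add: isCont_def)
  define \<mu> where "\<mu> t = (p t \<bullet> (A t *v (T t *v p t))) / d t" for t
  have \<mu>: "real_analytic_at \<mu> x" unfolding \<mu>_def
    by (intro real_analytic_at_divide real_analytic_at_matrix_vector_mult real_analytic_at_inner A T p d dx)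
  define S where "S t = T t ** P t - \<mu> t *\<^sub>R P t" for t
  have S: "real_analytic_at S x" unfolding S_def
    by (intro real_analytic_at_diff real_analytic_at_scaleR real_analytic_at_matrix_mult T P \<mu>)
  show thesis
    using S
  proof (cases rule: real_analytic_at_factor)
    case zero
    have "\<forall>\<^sub>F t in nhds x. eigenvalue (T t) (\<mu> t)"
      using zero P(2) d_ev
    proof eventually_elim
      case (elim t)
      have "T t *v p t = (T t ** P t) *v p t"
        using elim(2) by (simp add: p_def matrix_vector_mul_assoc flip: matrix_mul_assoc)
      also have "\<dots> = \<mu> t *\<^sub>R (P t *v p t)"
        using elim(1) by (simp add: S_def scaleR_matrix_vector_assoc)
      also have "P t *v p t = p t"
        using elim(2) by (simp add: p_def matrix_vector_mul_assoc)
      finally have "T t *v p t = \<mu> t *\<^sub>R p t" .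
      moreover have "p t \<noteq> 0" using elim(3) by (auto simp: d_def)
      ultimately show ?case unfolding eigenvalue_def by blast
    qed
    moreover have "\<forall>\<^sub>F t in nhds x. T t ** P t = \<mu> t *\<^sub>R P t"
      using zero by eventually_elim (simp add: S_def)
    ultimately show thesis using scalar \<mu> by blast
  next
    case (factor k g)
    have "\<forall>\<^sub>F t in at x. g t = inverse ((t - x) ^ k) *\<^sub>R S t \<and>
        P t ** P t = P t \<and> self_adj (A t) (P t) \<and> P t ** T t = T t ** P t \<and> self_adj (A t) (T t) \<and> d t \<noteq> 0"
      using eventually_nhds_imp_at[OF factor(3)] eventually_at_neq[of x]
        eventually_nhds_imp_at[OF P(2)] eventually_nhds_imp_at[OF T(2)] eventually_nhds_imp_at[OF d_ev]
      by eventually_elim simp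
    then have "\<forall>\<^sub>F t in at x. transpose (g t) ** A t = A t ** g t \<and> P t ** g t = g t \<and> g t ** P t = g t \<and>
        g t ** T t = T t ** g t \<and> p t \<bullet> (A t *v (g t *v p t)) = 0"
    proof eventually_elim
      case (elim t)
      then have PP: "P t ** P t = P t" and PT: "P t ** T t = T t ** P t"
        and sa: "self_adj (A t) (P t)" "self_adj (A t) (T t)" by auto
      have "self_adj (A t) (S t)" unfolding S_def
        by (intro self_adj_diff self_adj_scaleR self_adj_mult sa PT[symmetric])
      then have "self_adj (A t) (inverse ((t - x) ^ k) *\<^sub>R S t)" by (rule self_adj_scaleR)
      then have "transpose (g t) ** A t = A t ** g t"
        using elim by (simp add: self_adj_def)
      moreover have "P t ** S t = S t"
        using PP PT by (simp add: S_def matrix_distribs matrix_mul_assoc) (simp flip: matrix_mul_assoc)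
      moreover have "S t ** P t = S t"
        using PP by (simp add: S_def matrix_distribs flip: matrix_mul_assoc)
      moreover have "S t ** T t = T t ** S t"
        using PT by (simp add: S_def matrix_distribs flip: matrix_mul_assoc)
      moreover have "p t \<bullet> (A t *v (S t *v p t)) = 0"
      proof -
        have "S t *v p t = T t *v p t - \<mu> t *\<^sub>R p t"
          using PP by (simp add: S_def p_def matrix_vector_mul_assoc matrix_distribs matrix_vector_mult_diff_rdistrib
              flip: matrix_mul_assoc scaleR_matrix_vector_assoc)
        then have "p t \<bullet> (A t *v (S t *v p t)) = p t \<bullet> (A t *v (T t *v p t)) - \<mu> t * d t"
          by (simp only: matrix_vector_mult_diff_distrib inner_diff_right matrix_vector_mult_scaleR inner_scaleR_right d_def)
        then show ?thesis using elim by (simp add: \<mu>_def)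
      qed
      ultimately show ?case
        using elim by (simp add: matrix_distribs matrix_vector_mult_scaleR flip: scaleR_matrix_vector_assoc)
    qed
    then have "\<forall>\<^sub>F t in at x. transpose (g t) ** A t = A t ** g t" "\<forall>\<^sub>F t in at x. P t ** g t = g t"
      "\<forall>\<^sub>F t in at x. g t ** P t = g t" "\<forall>\<^sub>F t in at x. g t ** T t = T t ** g t"
      "\<forall>\<^sub>F t in at x. p t \<bullet> (A t *v (g t *v p t)) = 0"
      by (auto elim!: eventually_mono)
    \<comment> \<open>All five relations are equations between analytic functions, so they reach the
      point \<open>x\<close>, where \<open>S\<close> itself may vanish.\<close>
    note this[THEN real_analytic_eq_extend[rotated 2]]
    then have g: "\<forall>\<^sub>F t in nhds x. transpose (g t) ** A t = A t ** g t" "\<forall>\<^sub>F t in nhds x. P t ** g t = g t"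
      "\<forall>\<^sub>F t in nhds x. g t ** P t = g t" "\<forall>\<^sub>F t in nhds x. g t ** T t = T t ** g t"
      "\<forall>\<^sub>F t in nhds x. p t \<bullet> (A t *v (g t *v p t)) = 0"
      by (simp_all add: real_analytic_at_matrix_mult real_analytic_at_transpose factor(1) A(1) P(1) T(1) p
          real_analytic_at_inner real_analytic_at_matrix_vector_mult)
    have gx: "self_adj (A x) (g x)" "P x ** g x = g x" "g x ** P x = g x" "p x \<bullet> (A x *v (g x *v p x)) = 0"
      using g[THEN eventually_nhds_x_imp_x] by (simp_all add: self_adj_def)
    have Px': "P x ** P x = P x" "self_adj (A x) (P x)"
      using eventually_nhds_x_imp_x[OF P(2)] by auto
    have "g x ** P x \<noteq> c *\<^sub>R P x" for c
    proof
      assume c: "g x ** P x = c *\<^sub>R P x"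
      then have "g x *v p x = c *\<^sub>R p x"
        using Px'(1) gx(3) by (simp add: p_def matrix_vector_mul_assoc matrix_distribs flip: scaleR_matrix_vector_assoc)
      with gx(4) dx have "c = 0" by (simp add: d_def matrix_vector_mult_scaleR)
      with c gx(3) factor(2) show False by simp
    qed
    then obtain L h where h: "h \<noteq> 0"
      and Q0: "let Q = inverse h *\<^sub>R (matrix_prod (g x) L ** P x) in Q ** Q = Q \<and> Q \<noteq> 0 \<and> Q \<noteq> P x"
      using spectral_projection[OF Ax gx(1) Px'(1) _ Px'(2) Px] gx(2,3) by metis
    \<comment> \<open>\<open>L\<close> and \<open>h\<close> are frozen at their values for
      \<open>x\<close>, so \<open>X t\<close> is known to be idempotent only at
      \<open>t = x\<close>; Newton's iteration corrects it elsewhere.\<close>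
    define X where "X t = inverse h *\<^sub>R (matrix_prod (g t) L ** P t)" for t
    have "real_analytic_at (\<lambda>t. matrix_prod (g t) (map (\<lambda>l. l t) (map (\<lambda>c _. c) L))) x"
      by (rule real_analytic_at_matrix_prod[OF factor(1)]) auto
    then have "real_analytic_at (\<lambda>t. matrix_prod (g t) L) x" by (simp add: comp_def)
    then have "real_analytic_at X x" unfolding X_def
      by (intro real_analytic_at_scaleR real_analytic_at_matrix_mult P) auto
    moreover have "X x ** X x = X x" using Q0 by (simp add: X_def Let_def)
    ultimately obtain Q where Q: "real_analytic_at Q x" "Q x = X x"
      "\<forall>\<^sub>F t in nhds x. (\<lambda>k. (newton_step ^^ k) (X t)) \<longlonglongrightarrow> Q t"
      "\<forall>\<^sub>F t in nhds x. Q t ** Q t = Q t"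
      by (rule real_analytic_idempotent_lift) (rule that)
    have "\<forall>\<^sub>F t in nhds x. Q t ** Q t = Q t \<and> self_adj (A t) (Q t) \<and> Q t ** T t = T t ** Q t \<and>
        P t ** Q t = Q t \<and> Q t ** P t = Q t"
      using Q(3,4) g(1-4) P(2) A(2)
    proof eventually_elim
      case (elim t)
      let ?M = "matrix_prod (g t) L"
      have PM: "P t ** ?M = ?M ** P t" by (rule matrix_prod_commute) (simp add: elim)
      have TM: "T t ** ?M = ?M ** T t" by (rule matrix_prod_commute) (simp add: elim)
      have "self_adj (A t) ?M"
        using elim positive_definite_symmetric by (intro self_adj_matrix_prod) (auto simp: self_adj_def)
      then have "self_adj (A t) (X t)" unfolding X_def using PM elim
        by (intro self_adj_scaleR self_adj_mult) auto
      then have 1: "self_adj (A t) (Q t)" by (rule newton_limit_self_adj[OF _ elim(1)])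
      have PX: "P t ** X t = X t"
        using elim by (simp add: X_def matrix_distribs matrix_mul_assoc PM) (simp flip: matrix_mul_assoc)
      then have 2: "P t ** Q t = Q t" by (rule newton_limit_absorb[OF _ elim(1)])
      have "X t ** P t = X t"
        using elim by (simp add: X_def matrix_distribs flip: matrix_mul_assoc)
      then have "P t ** X t = X t ** P t" using PX by simp
      then have 3: "P t ** Q t = Q t ** P t" by (rule newton_limit_intertwine[OF _ elim(1) elim(1)])
      have "T t ** X t = X t ** T t"
        using elim by (simp add: X_def matrix_distribs matrix_mul_assoc TM) (simp flip: matrix_mul_assoc)
      then have "T t ** Q t = Q t ** T t" by (rule newton_limit_intertwine[OF _ elim(1) elim(1)])
      with 1 2 3 elim(2) show ?case by simp
    qed
    moreover have "Q x \<noteq> 0" "Q x \<noteq> P x" using Q0 Q(2) by (auto simp: X_def Let_def)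
    ultimately show thesis using split Q(1) by blast
  qed
qed

text \<open>Besides annihilating T on the range of P, the functions are recorded to be actual
  eigenvalues nearby: in the continuation along an interval they must be roots of the lists found at
  other points.\<close>

lemma local_eigenvalues:
  fixes A T P :: "real \<Rightarrow> real ^ 'm::finite ^ 'm"
  assumes A: "real_analytic_at A x" "\<forall>\<^sub>F t in nhds x. positive_definite (A t)"
    and T: "real_analytic_at T x" "\<forall>\<^sub>F t in nhds x. self_adj (A t) (T t)"
    and P: "real_analytic_at P x"
      "\<forall>\<^sub>F t in nhds x. P t ** P t = P t \<and> self_adj (A t) (P t) \<and> P t ** T t = T t ** P t"
  shows "\<exists>L. (\<forall>l\<in>set L. real_analytic_at l x \<and> (\<forall>\<^sub>F t in nhds x. eigenvalue (T t) (l t))) \<and>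
    (\<forall>\<^sub>F t in nhds x. matrix_prod (T t) (map (\<lambda>l. l t) L) ** P t = 0)"
  using P
proof (induction "dim (range ((*v) (P x)))" arbitrary: P rule: less_induct)
  case less
  show ?case
  proof (cases "P x = 0")
    case True
    have "\<forall>\<^sub>F t in nhds x. P t = 0"
      using less.prems(2)
      by (intro idempotent_eventually_0 real_analytic_at_isCont less.prems True) (auto elim: eventually_mono)
    then show ?thesis by (intro exI[of _ "[]"]) simp
  next
    case False
    from A T less.prems this show ?thesis
    proof (cases rule: local_splitting)
      case (scalar \<mu>)
      have "\<forall>\<^sub>F t in nhds x. matrix_prod (T t) [\<mu> t] ** P t = 0"
        using scalar(3) by eventually_elim (simp add: matrix_distribs)
      with scalar show ?thesis by (intro exI[of _ "[\<mu>]"]) simp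
    next
      case (split Q)
      define R where "R t = P t - Q t" for t
      have R: "real_analytic_at R x" unfolding R_def by (intro real_analytic_at_diff split less.prems)
      have R': "\<forall>\<^sub>F t in nhds x. R t ** R t = R t \<and> self_adj (A t) (R t) \<and> R t ** T t = T t ** R t \<and>
          P t ** R t = R t \<and> R t ** P t = R t"
        using split(4) less.prems(2) by eventually_elim (simp add: R_def matrix_distribs self_adj_diff)
      have "dim (range ((*v) (Q x))) < dim (range ((*v) (P x)))"
        using eventually_nhds_x_imp_x[OF split(4)] split(3) by (intro dim_range_idempotent_less) auto
      from less.hyps[OF this split(1) eventually_mono[OF split(4)]] obtain L1 where
        L1: "\<forall>l\<in>set L1. real_analytic_at l x \<and> (\<forall>\<^sub>F t in nhds x. eigenvalue (T t) (l t))"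
        "\<forall>\<^sub>F t in nhds x. matrix_prod (T t) (map (\<lambda>l. l t) L1) ** Q t = 0"
        by blast
      have "dim (range ((*v) (R x))) < dim (range ((*v) (P x)))"
        using eventually_nhds_x_imp_x[OF R'] split(2) by (intro dim_range_idempotent_less) (auto simp: R_def)
      from less.hyps[OF this R eventually_mono[OF R']] obtain L2 where
        L2: "\<forall>l\<in>set L2. real_analytic_at l x \<and> (\<forall>\<^sub>F t in nhds x. eigenvalue (T t) (l t))"
        "\<forall>\<^sub>F t in nhds x. matrix_prod (T t) (map (\<lambda>l. l t) L2) ** R t = 0"
        by blast
      have "\<forall>\<^sub>F t in nhds x. matrix_prod (T t) (map (\<lambda>l. l t) (L1 @ L2)) ** P t = 0"
        using L1(2) L2(2)
      proof eventually_elim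
        case (elim t)
        let ?M1 = "matrix_prod (T t) (map (\<lambda>l. l t) L1)" and ?M2 = "matrix_prod (T t) (map (\<lambda>l. l t) L2)"
        \<comment> \<open>Polynomials in \<open>T t\<close> commute, so either half can be moved
          next to the projection that it annihilates.\<close>
        have "?M1 ** ?M2 = ?M2 ** ?M1"
          by (intro matrix_prod_commute) (rule matrix_prod_commute[symmetric], simp)
        then have "?M1 ** ?M2 ** Q t = 0"
          using elim(1) by (simp flip: matrix_mul_assoc)
        moreover have "?M1 ** ?M2 ** R t = 0"
          using elim(2) by (simp flip: matrix_mul_assoc)
        moreover have "P t = Q t + R t" by (simp add: R_def)
        ultimately show ?case
          by (simp only: map_append matrix_prod_append matrix_add_ldistrib) simp
      qed
      with L1(1) L2(1) show ?thesis by (intro exI[of _ "L1 @ L2"]) auto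
    qed
  qed
qed

lemma eigenvalue_matrix_prod_0:
  assumes "matrix_prod M L = 0" "eigenvalue M \<mu>"
  shows "(\<Prod>l\<leftarrow>L. \<mu> - l) = 0"
proof -
  obtain v where v: "v \<noteq> 0" "M *v v = \<mu> *\<^sub>R v" using assms(2) by (auto simp: eigenvalue_def)
  show ?thesis using matrix_prod_eigenvector[OF v(2), of L] assms(1) v(1) by simp
qed

text \<open>The germ of an analytic eigenvalue is continued along the union of all intervals to which it
  extends; at a boundary point of this union the locally complete list of eigenvalues continues it further.\<close>

lemma eigenvalue_extension:
  fixes T :: "real \<Rightarrow> real ^ 'm::finite ^ 'm"
  assumes I: "open I" "connected I"
    and loc: "\<And>x. x \<in> I \<Longrightarrow> \<exists>L. (\<forall>l\<in>set L. real_analytic_at l x \<and> (\<forall>\<^sub>F t in nhds x. eigenvalue (T t) (l t))) \<and>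
       (\<forall>\<^sub>F t in nhds x. matrix_prod (T t) (map (\<lambda>l. l t) L) = 0)"
    and x0: "x0 \<in> I" "real_analytic_at l0 x0" "\<forall>\<^sub>F t in nhds x0. eigenvalue (T t) (l0 t)"
  obtains l where "\<And>x. x \<in> I \<Longrightarrow> real_analytic_at l x" "\<forall>\<^sub>F t in nhds x0. l t = l0 t"
proof -
  \<comment> \<open>Solutions must be eigenvalues on all of \<open>U\<close>, which ties them to the
    root lists at boundary points. Two such intervals meet in an interval around \<open>x0\<close>,
    whence uniqueness.\<close>
  define sol where "sol f U \<longleftrightarrow> open U \<and> connected U \<and> U \<subseteq> I \<and> x0 \<in> U \<and>
    (\<forall>x\<in>U. real_analytic_at f x \<and> eigenvalue (T x) (f x)) \<and> (\<forall>\<^sub>F t in nhds x0. f t = l0 t)" for f U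
  have uniq: "f x = g x" if "sol f U" "sol g V" "x \<in> U" "x \<in> V" for f g U V x
  proof -
    have conn: "connected (U \<inter> V)"
      using that by (simp add: sol_def is_interval_Int flip: is_interval_connected_1)
    have "\<forall>\<^sub>F t in nhds x0. f t = l0 t" "\<forall>\<^sub>F t in nhds x0. g t = l0 t"
      using that by (simp_all add: sol_def)
    then have "\<forall>\<^sub>F t in nhds x0. f t - g t = 0"
      by eventually_elim simp
    then have "\<forall>\<^sub>F t in nhds x. f t - g t = 0"
      by (rule real_analytic_identity[OF conn real_analytic_at_diff, rotated 3])
        (use that in \<open>auto simp: sol_def\<close>)
    from eventually_nhds_x_imp_x[OF this] show ?thesis by simp
  qed
  define W where "W = \<Union> {U. \<exists>f. sol f U}"
  \<comment> \<open>By \<open>uniq\<close> any solution defined at \<open>x\<close> may supply the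
    value, so the union carries a single maximal solution.\<close>
  define F where "F x = (SOME f. \<exists>U. sol f U \<and> x \<in> U) x" for x
  have F: "F x = f x" if "sol f U" "x \<in> U" for f U x
  proof -
    have "\<exists>V. sol (SOME f. \<exists>U. sol f U \<and> x \<in> U) V \<and> x \<in> V"
      by (rule someI[of "\<lambda>f. \<exists>U. sol f U \<and> x \<in> U"]) (use that in blast)
    then show ?thesis unfolding F_def using uniq that by blast
  qed
  have F_ev: "\<forall>\<^sub>F t in nhds x. f t = F t" if "sol f U" "x \<in> U" for f U x
    using F[OF that(1)] that unfolding eventually_nhds sol_def by (intro exI[of _ U]) auto
  obtain f0 U0 where U0: "sol f0 U0"
  proof -
    have "\<forall>\<^sub>F t in nhds x0. t \<in> I \<and> real_analytic_at l0 t \<and> eigenvalue (T t) (l0 t)"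
      using eventually_nhds_in_open[OF I(1) x0(1)] real_analytic_at_eventually[OF x0(2)] x0(3)
      by eventually_elim simp
    then obtain r where r: "r > 0" "\<And>t. t \<in> ball x0 r \<Longrightarrow> t \<in> I \<and> real_analytic_at l0 t \<and> eigenvalue (T t) (l0 t)"
      unfolding eventually_nhds_metric by (auto simp: dist_commute)
    have "sol l0 (ball x0 r)"
      unfolding sol_def using r by (intro conjI) auto
    then show thesis using that by blast
  qed
  have W: "open W" "W \<subseteq> I" "x0 \<in> W"
    using U0 by (auto simp: W_def sol_def)
  have "connected W"
    unfolding W_def by (rule connected_Union) (auto simp: sol_def)
  have FW: "real_analytic_at F x \<and> eigenvalue (T x) (F x)" if "x \<in> W" for x
  proof -
    obtain f U where fU: "sol f U" "x \<in> U" using \<open>x \<in> W\<close> by (auto simp: W_def)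
    then show ?thesis
      using real_analytic_at_cong[OF _ F_ev[OF fU]] F[OF fU] by (auto simp: sol_def)
  qed
  have F0: "\<forall>\<^sub>F t in nhds x0. F t = l0 t"
  proof -
    have "\<forall>\<^sub>F t in nhds x0. f0 t = F t" "\<forall>\<^sub>F t in nhds x0. f0 t = l0 t"
      using F_ev[OF U0] U0 by (auto simp: sol_def)
    then show ?thesis by eventually_elim simp
  qed
  have "I \<inter> closure W \<subseteq> W"
  proof
    fix x assume x: "x \<in> I \<inter> closure W"
    obtain L where L: "\<And>l. l \<in> set L \<Longrightarrow> real_analytic_at l x"
      "\<And>l. l \<in> set L \<Longrightarrow> \<forall>\<^sub>F t in nhds x. eigenvalue (T t) (l t)"
      "\<forall>\<^sub>F t in nhds x. matrix_prod (T t) (map (\<lambda>l. l t) L) = 0"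
      using loc x by blast
    have "\<forall>\<^sub>F t in nhds x. \<forall>l\<in>set L. real_analytic_at l t \<and> eigenvalue (T t) (l t)"
      by (intro eventually_ball_finite ballI eventually_conj real_analytic_at_eventually L) auto
    then have "\<forall>\<^sub>F t in nhds x. t \<in> I \<and> matrix_prod (T t) (map (\<lambda>l. l t) L) = 0 \<and>
        (\<forall>l\<in>set L. real_analytic_at l t \<and> eigenvalue (T t) (l t))"
      using eventually_nhds_in_open[OF I(1)] x L(3) by (auto intro: eventually_conj)
    then obtain r where r: "r > 0" and rI: "\<And>t. t \<in> ball x r \<Longrightarrow> t \<in> I"
      and rT: "\<And>t. t \<in> ball x r \<Longrightarrow> matrix_prod (T t) (map (\<lambda>l. l t) L) = 0"
      and rL: "\<And>t l. t \<in> ball x r \<Longrightarrow> l \<in> set L \<Longrightarrow> real_analytic_at l t \<and> eigenvalue (T t) (l t)"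
      unfolding eventually_nhds_metric by (auto simp: dist_commute)
    define J where "J = ball x r \<inter> W"
    have J: "connected J" "open J"
      using \<open>connected W\<close> W by (auto simp: J_def is_interval_Int is_interval_ball_real simp flip: is_interval_connected_1)
    have "\<exists>y\<in>W. dist y x < r"
      using x r by (simp add: closure_approachable)
    then obtain y where y: "y \<in> J"
      unfolding J_def by (auto simp: dist_commute)
    \<comment> \<open>On the overlap \<open>F t\<close> is an eigenvalue, hence a root of the local
      annihilating polynomial. As the product of the differences vanishes on \<open>J\<close>, one
      function of the list agrees with \<open>F\<close> on all of \<open>J\<close>.\<close>
    have prod0: "(\<Prod>f\<leftarrow>map (\<lambda>l t. F t - l t) L. f t) = 0" if "t \<in> J" for t
      using eigenvalue_matrix_prod_0[OF rT, of t "F t"] FW[of t] that by (simp add: J_def comp_def)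
    have "\<forall>\<^sub>F t in nhds y. t \<in> J" using J(2) y by (rule eventually_nhds_in_open)
    from eventually_mono[OF eventually_nhds_imp_at[OF this] prod0]
    have "\<forall>\<^sub>F t in at y. (\<Prod>f\<leftarrow>map (\<lambda>l t. F t - l t) L. f t) = 0" .
    then have "\<exists>f\<in>set (map (\<lambda>l t. F t - l t) L). \<forall>x\<in>J. \<forall>\<^sub>F y in nhds x. f y = 0"
      using rL FW by (intro real_analytic_prod_list_zero[OF J(1) y]) (auto simp: J_def intro!: real_analytic_at_diff)
    then obtain l where l: "l \<in> set L" "\<And>t. t \<in> J \<Longrightarrow> \<forall>\<^sub>F s in nhds t. F s - l s = 0" by auto
    have lF: "F t = l t" if "t \<in> J" for t
      using eventually_nhds_x_imp_x[OF l(2)[OF that]] by simp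
    define G where "G t = (if t \<in> W then F t else l t)" for t
    have GW: "\<forall>\<^sub>F t in nhds z. F t = G t" if "z \<in> W" for z
      using eventually_nhds_in_open[OF W(1) that] by eventually_elim (simp add: G_def)
    have Gb: "\<forall>\<^sub>F t in nhds z. l t = G t" if "z \<in> ball x r" for z
      using eventually_nhds_in_open[OF open_ball that] by eventually_elim (use lF in \<open>auto simp: G_def J_def\<close>)
    have "real_analytic_at G z \<and> eigenvalue (T z) (G z)" if "z \<in> W \<union> ball x r" for z
      using that
    proof
      assume z: "z \<in> W"
      then show ?thesis
        using real_analytic_at_cong[OF _ GW[OF z]] FW[OF z] eventually_nhds_x_imp_x[OF GW[OF z]] by simp
    next
      assume z: "z \<in> ball x r"
      then show ?thesis
        using real_analytic_at_cong[OF _ Gb[OF z]] rL[OF z l(1)] eventually_nhds_x_imp_x[OF Gb[OF z]] by simp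
    qed
    moreover have "\<forall>\<^sub>F t in nhds x0. G t = l0 t"
      using GW[OF W(3)] F0 by eventually_elim simp
    moreover have "connected (W \<union> ball x r)"
      using \<open>connected W\<close> y by (intro connected_Un) (auto simp: J_def)
    ultimately have "sol G (W \<union> ball x r)"
      using W rI by (auto simp: sol_def)
    moreover have "x \<in> W \<union> ball x r" using r by simp
    ultimately show "x \<in> W" unfolding W_def by blast
  qed
  then have "I \<subseteq> W \<union> - closure W" by blast
  moreover have "W \<inter> - closure W \<inter> I = {}" using closure_subset by blast
  ultimately have "W \<inter> I = {} \<or> - closure W \<inter> I = {}"
    using connectedD[OF I(2), of W "- closure W"] W(1) by blast
  then have "I \<subseteq> W" using W \<open>I \<inter> closure W \<subseteq> W\<close> x0(1) by blast
  then show thesis using that[of F] FW F0 by blast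
qed

text \<open>Only the list found at \<open>x0\<close> is continued. That it annihilates T is an
  identity between analytic functions near \<open>x0\<close> and therefore persists along
  \<open>I\<close>.\<close>

lemma global_eigenvalues:
  fixes A T :: "real \<Rightarrow> real ^ 'm::finite ^ 'm"
  assumes I: "open I" "connected I" "I \<noteq> {}"
    and A: "\<And>x. x \<in> I \<Longrightarrow> real_analytic_at A x" "\<And>x. x \<in> I \<Longrightarrow> positive_definite (A x)"
    and T: "\<And>x. x \<in> I \<Longrightarrow> real_analytic_at T x" "\<And>x. x \<in> I \<Longrightarrow> self_adj (A x) (T x)"
  obtains L where "\<And>l x. l \<in> set L \<Longrightarrow> x \<in> I \<Longrightarrow> real_analytic_at l x"
    "\<And>x. x \<in> I \<Longrightarrow> matrix_prod (T x) (map (\<lambda>l. l x) L) = 0"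
proof -
  have ev: "\<forall>\<^sub>F t in nhds x. t \<in> I" if "x \<in> I" for x
    using I(1) that by (rule eventually_nhds_in_open)
  have loc: "\<exists>L. (\<forall>l\<in>set L. real_analytic_at l x \<and> (\<forall>\<^sub>F t in nhds x. eigenvalue (T t) (l t))) \<and>
       (\<forall>\<^sub>F t in nhds x. matrix_prod (T t) (map (\<lambda>l. l t) L) = 0)" if x: "x \<in> I" for x
  proof -
    have "\<forall>\<^sub>F t in nhds x. positive_definite (A t)" "\<forall>\<^sub>F t in nhds x. self_adj (A t) (T t)"
      "\<forall>\<^sub>F t in nhds x. mat 1 ** mat 1 = (mat 1 :: real ^ 'm ^ 'm) \<and> self_adj (A t) (mat 1) \<and> mat 1 ** T t = T t ** mat 1"
      using ev[OF x] A(2) T(2)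
      by (auto elim!: eventually_mono simp: self_adj_mat_1 positive_definite_symmetric)
    from local_eigenvalues[OF A(1)[OF x] this(1) T(1)[OF x] this(2) _ this(3)]
    show ?thesis by simp
  qed
  obtain x0 where x0: "x0 \<in> I" using I(3) by blast
  obtain L0 where L0: "\<And>l. l \<in> set L0 \<Longrightarrow> real_analytic_at l x0"
      "\<And>l. l \<in> set L0 \<Longrightarrow> \<forall>\<^sub>F t in nhds x0. eigenvalue (T t) (l t)"
      "\<forall>\<^sub>F t in nhds x0. matrix_prod (T t) (map (\<lambda>l. l t) L0) = 0"
    using loc[OF x0] by blast
  have "\<exists>l'. (\<forall>x\<in>I. real_analytic_at l' x) \<and> (\<forall>\<^sub>F t in nhds x0. l' t = l t)" if "l \<in> set L0" for l
    using eigenvalue_extension[OF I(1,2) loc x0 L0(1)[OF that] L0(2)[OF that]] by metis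
  then obtain e where e: "\<And>l x. l \<in> set L0 \<Longrightarrow> x \<in> I \<Longrightarrow> real_analytic_at (e l) x"
    "\<And>l. l \<in> set L0 \<Longrightarrow> \<forall>\<^sub>F t in nhds x0. e l t = l t" by metis
  let ?L = "map e L0"
  have an: "real_analytic_at l x" if "l \<in> set ?L" "x \<in> I" for l x
    using that e by auto
  have "\<forall>\<^sub>F t in nhds x0. \<forall>l\<in>set L0. e l t = l t"
    using e(2) by (intro eventually_ball_finite) auto
  with L0(3) have "\<forall>\<^sub>F t in nhds x0. matrix_prod (T t) (map (\<lambda>l. l t) ?L) = 0"
  proof eventually_elim
    case (elim t)
    then have "map (\<lambda>l. l t) ?L = map (\<lambda>l. l t) L0" by simp
    with elim(1) show ?case by (simp only:)
  qed
  note zero_x0 = this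
  have "real_analytic_at (\<lambda>t. matrix_prod (T t) (map (\<lambda>l. l t) ?L)) x" if "x \<in> I" for x
    by (rule real_analytic_at_matrix_prod[OF T(1)[OF that] an[OF _ that]])
  note zero = eventually_nhds_x_imp_x[OF real_analytic_identity[OF I(2) this x0 zero_x0]]
  show thesis by (rule that[of ?L, OF an zero])
qed

section \<open>Analytic frames of eigenspaces\<close>

text \<open>Proper subspaces are Lebesgue null sets, and so is a countable union of them.\<close>

lemma countable_proper_subspaces_Union:
  fixes \<S> :: "'a::euclidean_space set set"
  assumes "countable \<S>" "\<And>S. S \<in> \<S> \<Longrightarrow> subspace S \<and> S \<noteq> UNIV"
  obtains w where "\<And>S. S \<in> \<S> \<Longrightarrow> w \<notin> S"
proof -
  have "negligible S" if "S \<in> \<S>" for S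
  proof -
    have "dim S < DIM('a)"
      using assms(2)[OF that] dim_eq_full[of S] dim_subset_UNIV[of S] span_eq_iff[of S] by (metis le_neq_implies_less)
    then show ?thesis by (rule negligible_lowdim)
  qed
  then have "negligible (\<Union>\<S>)" using assms(1) by (intro negligible_countable_Union)
  then have "\<Union>\<S> \<noteq> UNIV" using non_negligible_UNIV by metis
  then show thesis using that by blast
qed

text \<open>The equality case of Cauchy-Schwarz: up to the factor x . x, the Gram determinant is the
  squared length of the component of y orthogonal to x.\<close>

lemma gram_zero_imp_parallel:
  fixes x y :: "'a::real_inner"
  assumes "x \<noteq> 0" "(x \<bullet> x) * (y \<bullet> y) - (x \<bullet> y)\<^sup>2 = 0"
  shows "y = ((x \<bullet> y) / (x \<bullet> x)) *\<^sub>R x"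
proof -
  define c where "c = (x \<bullet> y) / (x \<bullet> x)"
  have "(y - c *\<^sub>R x) \<bullet> (y - c *\<^sub>R x) = y \<bullet> y - 2 * c * (x \<bullet> y) + c\<^sup>2 * (x \<bullet> x)"
    by (simp add: algebra_simps inner_commute power2_eq_square)
  also have "\<dots> = 0"
    using assms by (simp add: c_def power2_eq_square field_simps)
  finally show ?thesis by (simp add: c_def)
qed

text \<open>Choose \<open>w = p + s w\<^sub>1\<close>, where \<open>Q t p\<close> and \<open>Q t w\<^sub>1\<close> never vanish simultaneously. They are parallel for
  only countably many \<open>t\<close>, and each such \<open>t\<close> excludes at most one \<open>s\<close>.\<close>

lemma nonvanishing_vector:
  fixes Q :: "real \<Rightarrow> real ^ 'm::finite ^ 'm"
  assumes I: "open I" "connected I" and Q: "\<And>t. t \<in> I \<Longrightarrow> real_analytic_at Q t" "\<And>t. t \<in> I \<Longrightarrow> Q t \<noteq> 0"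
    and t0: "t0 \<in> I" and p: "Q t0 *v p \<noteq> 0" and q: "\<And>c. Q t0 *v q \<noteq> c *\<^sub>R (Q t0 *v p)"
  obtains w where "\<And>t. t \<in> I \<Longrightarrow> Q t *v w \<noteq> 0"
proof -
  have an: "real_analytic_at (\<lambda>t. Q t *v w) t" if "t \<in> I" for w t
    using Q(1)[OF that] by (intro real_analytic_at_matrix_vector_mult) auto
  define Z0 where "Z0 = {t \<in> I. Q t *v p = 0}"
  have Z0: "countable Z0"
    unfolding Z0_def using real_analytic_zeros_countable[OF I(2,1) an t0 p] by simp
  \<comment> \<open>Avoiding \<open>B\<close> makes the images of \<open>w1\<close> and
    \<open>p\<close> under \<open>Q t0\<close> independent, so the Gram determinant \<open>G\<close>
    below is nonzero at \<open>t0\<close> and has only countably many zeros.\<close>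
  define B where "B = {w. \<exists>c. Q t0 *v w = c *\<^sub>R (Q t0 *v p)}"
  have "subspace B"
  proof (rule subspaceI)
    show "0 \<in> B" by (auto simp: B_def intro: exI[of _ 0])
    show "x + y \<in> B" if "x \<in> B" "y \<in> B" for x y
      using that by (auto simp: B_def matrix_vector_right_distrib simp flip: scaleR_left_distrib)
    show "c *\<^sub>R x \<in> B" if "x \<in> B" for c x
      using that by (auto simp: B_def matrix_vector_mult_scaleR)
  qed
  moreover have "B \<noteq> UNIV" using q by (auto simp: B_def)
  moreover have "subspace {w. Q t *v w = 0}" for t
    by (auto simp: subspace_def algebra_simps)
  moreover have "{w. Q t *v w = 0} \<noteq> UNIV" if "t \<in> Z0" for t
  proof
    assume "{w. Q t *v w = 0} = UNIV"
    then have "Q t = 0" by (auto simp: matrix_eq)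
    with Q(2) that show False by (auto simp: Z0_def)
  qed
  ultimately have "subspace S \<and> S \<noteq> UNIV" if "S \<in> insert B ((\<lambda>t. {w. Q t *v w = 0}) ` Z0)" for S
    using that by blast
  moreover have "countable (insert B ((\<lambda>t. {w. Q t *v w = 0}) ` Z0))" using Z0 by simp
  ultimately obtain w1 where "\<And>S. S \<in> insert B ((\<lambda>t. {w. Q t *v w = 0}) ` Z0) \<Longrightarrow> w1 \<notin> S"
    using countable_proper_subspaces_Union by metis
  then have w1: "w1 \<notin> B" "\<And>t. t \<in> Z0 \<Longrightarrow> Q t *v w1 \<noteq> 0" by auto
  define G where "G t = ((Q t *v p) \<bullet> (Q t *v p)) * ((Q t *v w1) \<bullet> (Q t *v w1)) - ((Q t *v p) \<bullet> (Q t *v w1))\<^sup>2" for t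
  have "real_analytic_at G t" if "t \<in> I" for t
    unfolding G_def power2_eq_square
    by (intro real_analytic_at_diff real_analytic_at_mult real_analytic_at_inner an that)
  moreover have "G t0 \<noteq> 0"
    using gram_zero_imp_parallel[OF p, of "Q t0 *v w1"] w1(1) unfolding G_def B_def by blast
  ultimately have Z: "countable {t \<in> I. G t = 0}"
    by (intro real_analytic_zeros_countable[OF I(2,1) _ t0])
  define bad where "bad t = {s. Q t *v p + s *\<^sub>R (Q t *v w1) = 0}" for t
  have "countable (bad t)" if "t \<in> I" for t
  proof -
    have "s = s'" if s: "s \<in> bad t" "s' \<in> bad t" for s s'
    proof -
      have "(s - s') *\<^sub>R (Q t *v w1) =
          (Q t *v p + s *\<^sub>R (Q t *v w1)) - (Q t *v p + s' *\<^sub>R (Q t *v w1))"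
        by (simp add: scaleR_diff_left)
      also have "\<dots> = 0"
        using s by (simp only: bad_def mem_Collect_eq) simp
      finally have "(s - s') *\<^sub>R (Q t *v w1) = 0" .
      moreover have "Q t *v w1 \<noteq> 0"
        using s w1(2)[of t] \<open>t \<in> I\<close> by (auto simp: bad_def Z0_def)
      ultimately show ?thesis by simp
    qed
    then have "bad t \<subseteq> {SOME s. s \<in> bad t}"
      by (metis singletonI someI subsetI)
    then show ?thesis using countable_subset by blast
  qed
  then have "countable (\<Union>t\<in>{t \<in> I. G t = 0}. bad t)"
    by (intro countable_UN Z) auto
  then have "(\<Union>t\<in>{t \<in> I. G t = 0}. bad t) \<noteq> UNIV"
    using uncountable_UNIV_real by metis
  then obtain s where s: "\<And>t. t \<in> I \<Longrightarrow> G t = 0 \<Longrightarrow> s \<notin> bad t" by blast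
  have "Q t *v (p + s *\<^sub>R w1) \<noteq> 0" if t: "t \<in> I" for t
  proof
    assume "Q t *v (p + s *\<^sub>R w1) = 0"
    then have 0: "Q t *v p + s *\<^sub>R (Q t *v w1) = 0"
      by (simp add: matrix_vector_right_distrib matrix_vector_mult_scaleR)
    then have "Q t *v p = - s *\<^sub>R (Q t *v w1)" by (simp add: eq_neg_iff_add_eq_0)
    then have "G t = 0" by (simp add: G_def power2_eq_square)
    with s[OF t] 0 show False by (simp add: bad_def)
  qed
  then show thesis using that by blast
qed

text \<open>A leading coefficient of \<open>f\<close> is self-adjoint, hence not nilpotent, so \<open>f\<^sup>2 = h f\<close> forces the vanishing
  order of \<open>f\<close> to be at least that of \<open>h\<close>.\<close>

lemma idempotent_quotient_local:
  fixes A f :: "real \<Rightarrow> real ^ 'm::finite ^ 'm" and h :: "real \<Rightarrow> real"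
  assumes A: "real_analytic_at A x" "positive_definite (A x)"
    and f: "real_analytic_at f x" and h: "real_analytic_at h x" "\<forall>\<^sub>F t in at x. h t \<noteq> 0"
    and sa: "\<forall>\<^sub>F t in nhds x. self_adj (A t) (f t)" and ff: "\<forall>\<^sub>F t in nhds x. f t ** f t = h t *\<^sub>R f t"
  shows "\<exists>g. real_analytic_at g x \<and> (\<forall>\<^sub>F t in nhds x. f t = h t *\<^sub>R g t)"
  using f
proof (cases rule: real_analytic_at_factor)
  case zero
  then show ?thesis by (intro exI[of _ "\<lambda>_. 0"]) simp
next
  case (factor k f1)
  show ?thesis
    using h(1)
  proof (cases rule: real_analytic_at_factor)
    case zero
    from h(2) eventually_nhds_imp_at[OF zero] have "\<forall>\<^sub>F t in at x. False" by eventually_elim simp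
    then show ?thesis by simp
  next
    case h1: (factor l h1)
    note f1 = factor
    \<comment> \<open>One factor (t - x)^k is cancelled from (t - x)^(2k) f1^2 = (t - x)^(k + l) h1
      f1.\<close>
    have cancel: "\<forall>\<^sub>F t in at x. (t - x) ^ k *\<^sub>R (f1 t ** f1 t) = ((t - x) ^ l * h1 t) *\<^sub>R f1 t"
      using eventually_at_neq[of x] eventually_nhds_imp_at[OF f1(3)]
        eventually_nhds_imp_at[OF h1(3)] eventually_nhds_imp_at[OF ff]
    proof eventually_elim
      case (elim t)
      then have "(t - x) ^ k *\<^sub>R ((t - x) ^ k *\<^sub>R (f1 t ** f1 t)) = (t - x) ^ k *\<^sub>R (((t - x) ^ l * h1 t) *\<^sub>R f1 t)"
        by (simp add: matrix_distribs mult_ac)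
      with elim(1) show ?case by (simp only: scaleR_cancel_left) simp
    qed
    have "l \<le> k"
    proof (rule ccontr)
      assume "\<not> l \<le> k"
      then have l: "l = k + (l - k)" "l - k \<noteq> 0" by auto
      have "\<forall>\<^sub>F t in at x. f1 t ** f1 t = ((t - x) ^ (l - k) * h1 t) *\<^sub>R f1 t"
        using cancel eventually_at_neq[of x]
      proof eventually_elim
        case (elim t)
        then have "(t - x) ^ k *\<^sub>R (f1 t ** f1 t) = (t - x) ^ k *\<^sub>R (((t - x) ^ (l - k) * h1 t) *\<^sub>R f1 t)"
          by (subst (asm) l(1)) (simp add: power_add mult_ac)
        with elim(2) show ?case by (simp only: scaleR_cancel_left) simp
      qed
      then have "\<forall>\<^sub>F t in nhds x. f1 t ** f1 t = ((t - x) ^ (l - k) * h1 t) *\<^sub>R f1 t"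
      proof (rule real_analytic_eq_extend[rotated 2])
        have "real_analytic_at (\<lambda>t. (t - x) ^ n) x" for n
          by (induction n) (auto intro!: real_analytic_at_mult real_analytic_at_diff)
        then show "real_analytic_at (\<lambda>t. ((t - x) ^ (l - k) * h1 t) *\<^sub>R f1 t) x"
          by (intro real_analytic_at_scaleR real_analytic_at_mult f1 h1)
      qed (intro real_analytic_at_matrix_mult f1)
      \<comment> \<open>For l > k a positive power of t - x is left on the right and vanishes at
        \<open>x\<close>, so the leading coefficient is nilpotent.\<close>
      from eventually_nhds_x_imp_x[OF this] l(2) have "f1 x ** f1 x = 0"
        by (simp add: power_0_left)
      moreover have "\<forall>\<^sub>F t in at x. transpose (f1 t) ** A t = A t ** f1 t"
        using eventually_at_neq[of x] eventually_nhds_imp_at[OF f1(3)] eventually_nhds_imp_at[OF sa]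
      proof eventually_elim
        case (elim t)
        then have "self_adj (A t) (f1 t)" by (simp add: self_adj_scaleR_iff)
        then show ?case by (simp add: self_adj_def)
      qed
      then have "\<forall>\<^sub>F t in nhds x. transpose (f1 t) ** A t = A t ** f1 t"
        by (rule real_analytic_eq_extend[rotated 2])
          (intro real_analytic_at_matrix_mult real_analytic_at_transpose A f1)+
      then have "self_adj (A x) (f1 x)"
        unfolding self_adj_def by (rule eventually_nhds_x_imp_x)
      ultimately have "f1 x = 0" using self_adj_square_eq_0[OF A(2)] by blast
      with f1(2) show False ..
    qed
    define g where "g t = ((t - x) ^ (k - l) / h1 t) *\<^sub>R f1 t" for t
    have "real_analytic_at (\<lambda>t. (t - x) ^ n) x" for n
      by (induction n) (auto intro!: real_analytic_at_mult real_analytic_at_diff)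
    then have "real_analytic_at g x"
      unfolding g_def by (intro real_analytic_at_scaleR real_analytic_at_divide f1 h1)
    moreover have "\<forall>\<^sub>F t in nhds x. h1 t \<noteq> 0"
      using real_analytic_at_isCont[OF h1(1)] h1(2)
        tendsto_imp_eventually_ne[of h1 "h1 x" "nhds x" 0] tendsto_at_iff_tendsto_nhds[of h1 x]
      by (simp add: isCont_def)
    with f1(3) h1(3) have "\<forall>\<^sub>F t in nhds x. f t = h t *\<^sub>R g t"
      by eventually_elim (use \<open>l \<le> k\<close> in \<open>simp add: g_def flip: power_add\<close>)
    ultimately show ?thesis by blast
  qed
qed

section \<open>The standard symplectic form\<close>

lemma sum_UNIV_Plus: "(\<Sum>j\<in>UNIV. f j) = (\<Sum>j\<in>UNIV. f (Inl j)) + (\<Sum>j\<in>UNIV. f (Inr j))"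
  for f :: "'n::finite + 'n \<Rightarrow> real"
  using sum.Plus[of UNIV UNIV f] by (simp add: UNIV_Plus_UNIV comp_def)

lemma symplectic_J_vec_nth [simp]:
  fixes x :: "real ^ ('n::finite + 'n)"
  shows "(symplectic_J *v x) $ Inl i = x $ Inr i" "(symplectic_J *v x) $ Inr i = - (x $ Inl i)"
  by (simp_all add: matrix_vector_mult_def symplectic_J_def block_matrix_def sum_UNIV_Plus mat_def
      if_distrib[of "\<lambda>a. a * _"] sum.delta' sum_negf cong: if_cong)

lemma vec_eq_sum_iff: "x = y \<longleftrightarrow> (\<forall>i. x $ Inl i = y $ Inl i) \<and> (\<forall>i. x $ Inr i = y $ Inr i)"
  for x y :: "'a ^ ('n::finite + 'n)"
  by (metis sumE vec_eq_iff)

lemma minus_matrix_vector_mult: "(- M) *v x = - (M *v x)" for M :: "real ^ 'm::finite ^ 'k::finite"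
  by (simp add: matrix_vector_mult_def vec_eq_iff sum_negf)

lemma transpose_symplectic_J: "transpose symplectic_J = - symplectic_J"
  by (simp add: vec_eq_iff transpose_def symplectic_J_def block_matrix_def mat_def split: sum.split)

lemma symplectic_J_square: "symplectic_J ** symplectic_J = - mat 1"
  by (simp add: matrix_eq vec_eq_sum_iff minus_matrix_vector_mult flip: matrix_vector_mul_assoc)

lemma symplectic_J_twice [simp]: "symplectic_J *v (symplectic_J *v x) = - x"
  by (simp add: vec_eq_sum_iff)

lemma inner_symplectic_J_commute: "x \<bullet> (symplectic_J *v y) = - (y \<bullet> (symplectic_J *v x))"
proof -
  have "(symplectic_J *v x) \<bullet> y = x \<bullet> ((- symplectic_J) *v y)"
    using inner_matrix_left[of symplectic_J x y] by (simp only: transpose_symplectic_J)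
  then show ?thesis by (simp add: minus_matrix_vector_mult inner_commute)
qed

lemma inner_symplectic_J_self [simp]: "x \<bullet> (symplectic_J *v x) = 0"
  using inner_symplectic_J_commute[of x x] by simp

lemma matrix_vector_mult_minus: "M *v (- x) = - (M *v x)" for M :: "real ^ 'm::finite ^ 'k::finite"
  by (simp add: matrix_vector_mult_def vec_eq_iff sum_negf)

lemma self_adjI:
  assumes "\<And>x y. (X *v x) \<bullet> (A *v y) = x \<bullet> (A *v (X *v y))"
  shows "self_adj A X"
proof -
  have "x \<bullet> ((transpose X ** A) *v y) = x \<bullet> ((A ** X) *v y)" for x y
    using assms[of x y] by (simp add: inner_matrix_left matrix_vector_mul_assoc del: transpose_matrix_vector)
  then have "(transpose X ** A) *v y = (A ** X) *v y" for y
    using vector_eq_ldot by blast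
  then show ?thesis by (simp add: self_adj_def matrix_eq)
qed

text \<open>\<open>A\<close> is symmetric and J antisymmetric, so the form x . A J A y is
  antisymmetric; in other words K = J A is skew for x . A y.\<close>

lemma symplectic_hamiltonian_skew:
  assumes "positive_definite A"
  shows "x \<bullet> (A *v (symplectic_J *v (A *v y))) = - ((symplectic_J *v (A *v x)) \<bullet> (A *v y))"
proof -
  have "x \<bullet> (A *v z) = (A *v x) \<bullet> z" for z
    using positive_definite_inner_commute[OF assms, of x z] by (simp add: inner_commute)
  then show ?thesis
    using inner_symplectic_J_commute[of "A *v x" "A *v y"] by (simp add: inner_commute)
qed

section \<open>Planes spanned by Williamson pairs\<close>

definition outer_product :: "real ^ 'm \<Rightarrow> real ^ 'm \<Rightarrow> real ^ 'm ^ 'm" where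
  "outer_product x y = (\<chi> i j. x $ i * y $ j)"

lemma outer_product_mult_vec: "outer_product x y *v z = (y \<bullet> z) *\<^sub>R x"
  by (simp add: outer_product_def matrix_vector_mult_def vec_eq_iff inner_vec_def sum_distrib_left mult_ac)

lemma real_analytic_at_outer_product:
  fixes f g :: "real \<Rightarrow> real ^ 'm::finite"
  assumes "real_analytic_at f x" "real_analytic_at g x"
  shows "real_analytic_at (\<lambda>t. outer_product (f t) (g t)) x"
  using assms unfolding real_analytic_at_vec_iff outer_product_def
  by (auto intro!: real_analytic_at_mult)

text \<open>The last condition is the normalisation u . J v = 1, since A u = d J v with d nonzero;
  in terms of A it suits arguments by A-orthogonality.\<close>

definition williamson_pair where
  "williamson_pair A d u v \<longleftrightarrow> d > 0 \<and> A *v u = d *\<^sub>R (symplectic_J *v v) \<and>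
     A *v v = - (d *\<^sub>R (symplectic_J *v u)) \<and> u \<bullet> (A *v u) = d"

text \<open>For a Williamson pair this is the A-orthogonal projection onto the span of
  \<open>u\<close> and \<open>v\<close>: they are A-orthogonal and both have squared A-length
  \<open>d\<close>, whence the factor \<open>1 / d\<close>.\<close>

definition pair_projection where
  "pair_projection A d u v = (1 / d) *\<^sub>R (outer_product u (A *v u) + outer_product v (A *v v))"

context
  fixes A :: "real ^ ('n::finite + 'n) ^ ('n + 'n)" and d u v
  assumes A: "positive_definite A" and pair: "williamson_pair A d u v"
begin

lemma williamson_pair_d: "d > 0"
  and williamson_pair_u: "A *v u = d *\<^sub>R (symplectic_J *v v)"
  and williamson_pair_v: "A *v v = - (d *\<^sub>R (symplectic_J *v u))"
  and williamson_pair_uu: "u \<bullet> (A *v u) = d"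
  using pair unfolding williamson_pair_def by blast+

lemma williamson_pair_Ju: "symplectic_J *v (A *v u) = - (d *\<^sub>R v)"
  and williamson_pair_Jv: "symplectic_J *v (A *v v) = d *\<^sub>R u"
  unfolding williamson_pair_u williamson_pair_v
  by (simp_all add: matrix_vector_mult_scaleR matrix_vector_mult_minus)

lemma williamson_pair_uv: "u \<bullet> (A *v v) = 0" and williamson_pair_vu: "v \<bullet> (A *v u) = 0"
  unfolding williamson_pair_u williamson_pair_v by simp_all

lemma williamson_pair_vv: "v \<bullet> (A *v v) = d"
proof -
  have "d * (u \<bullet> (symplectic_J *v v)) = d"
    using williamson_pair_uu by (simp only: williamson_pair_u inner_scaleR_right)
  then show ?thesis
    using inner_symplectic_J_commute[of v u] by (simp add: williamson_pair_v)
qed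

lemma pair_projection_apply:
  "pair_projection A d u v *v z = ((u \<bullet> (A *v z)) / d) *\<^sub>R u + ((v \<bullet> (A *v z)) / d) *\<^sub>R v"
proof -
  have "(A *v x) \<bullet> z = x \<bullet> (A *v z)" for x
    using positive_definite_inner_commute[OF A, of x z] by (simp add: inner_commute)
  then show ?thesis
    by (simp add: pair_projection_def outer_product_mult_vec matrix_vector_mult_add_rdistrib
        scaleR_add_right flip: scaleR_matrix_vector_assoc)
qed

lemma pair_projection_u: "pair_projection A d u v *v u = u"
  and pair_projection_v: "pair_projection A d u v *v v = v"
  using williamson_pair_d
  by (simp_all add: pair_projection_apply williamson_pair_uu williamson_pair_uv williamson_pair_vu williamson_pair_vv)

text \<open>The trace of a projection is its rank. It shows that the projection is nonzero and later
  counts the pairs of a full frame.\<close>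

lemma trace_pair_projection: "trace (pair_projection A d u v) = 2"
proof -
  have "trace (pair_projection A d u v) = (1 / d) * (u \<bullet> (A *v u) + v \<bullet> (A *v v))"
    by (simp add: pair_projection_def trace_def outer_product_def inner_vec_def sum.distrib add_divide_distrib sum_divide_distrib)
  then show ?thesis using williamson_pair_d by (simp add: williamson_pair_uu williamson_pair_vv)
qed

lemma pair_projection_absorb_left:
  assumes "Q *v u = u" "Q *v v = v"
  shows "Q ** pair_projection A d u v = pair_projection A d u v"
  by (simp add: matrix_eq pair_projection_apply assms matrix_vector_right_distrib matrix_vector_mult_scaleR
      flip: matrix_vector_mul_assoc)

lemma pair_projection_absorb_right:
  assumes "Q *v u = u" "Q *v v = v" "self_adj A Q"
  shows "pair_projection A d u v ** Q = pair_projection A d u v"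
  using self_adj_inner[OF assms(3), of u] self_adj_inner[OF assms(3), of v] assms(1,2)
  by (simp add: matrix_eq pair_projection_apply flip: matrix_vector_mul_assoc)

lemma pair_projection_idem:
  "pair_projection A d u v ** pair_projection A d u v = pair_projection A d u v"
  by (rule pair_projection_absorb_left[OF pair_projection_u pair_projection_v])

lemma self_adj_pair_projection: "self_adj A (pair_projection A d u v)"
proof (rule self_adjI)
  fix x y
  show "(pair_projection A d u v *v x) \<bullet> (A *v y) = x \<bullet> (A *v (pair_projection A d u v *v y))"
    using positive_definite_inner_commute[OF A, of x]
    by (simp add: pair_projection_apply matrix_vector_right_distrib matrix_vector_mult_scaleR inner_add_left inner_add_right mult.commute)
qed

text \<open>K rotates the plane, K u = - d v and K v = d u; by skewness the coefficients of K z
  along \<open>u\<close> and \<open>v\<close> arise from those of z by the same rotation.\<close>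

lemma pair_projection_commute:
  "pair_projection A d u v ** (symplectic_J ** A) = (symplectic_J ** A) ** pair_projection A d u v"
proof -
  have "u \<bullet> (A *v (symplectic_J *v (A *v z))) = d * (v \<bullet> (A *v z))"
    "v \<bullet> (A *v (symplectic_J *v (A *v z))) = - (d * (u \<bullet> (A *v z)))" for z
    using symplectic_hamiltonian_skew[OF A, of u z] symplectic_hamiltonian_skew[OF A, of v z]
    by (simp_all add: williamson_pair_Ju williamson_pair_Jv)
  then show ?thesis
    using williamson_pair_d
    by (simp add: matrix_eq pair_projection_apply matrix_vector_right_distrib matrix_vector_mult_scaleR
        williamson_pair_Ju williamson_pair_Jv flip: matrix_vector_mul_assoc)
qed

end

text \<open>The hypothesis reads K^2 x = - d^2 x. With x scaled to squared A-length d and v = - K u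
  / d, it says K u = - d v and K v = d u; applying J and J^2 = - 1 gives the eigenbasis
  relations.\<close>

lemma williamson_pairI:
  fixes A :: "real ^ ('n::finite + 'n) ^ ('n + 'n)"
  assumes A: "positive_definite A" and d: "d > 0" and x: "x \<noteq> 0"
    and eig: "symplectic_J *v (A *v (symplectic_J *v (A *v x))) = - (d\<^sup>2 *\<^sub>R x)"
  defines "u \<equiv> sqrt (d / (x \<bullet> (A *v x))) *\<^sub>R x"
  shows "williamson_pair A d u (- ((1 / d) *\<^sub>R (symplectic_J *v (A *v u))))"
proof -
  define v where "v = - ((1 / d) *\<^sub>R (symplectic_J *v (A *v u)))"
  have pos: "x \<bullet> (A *v x) > 0" using positive_definite_pos[OF A x] .
  have eigu: "symplectic_J *v (A *v (symplectic_J *v (A *v u))) = - (d\<^sup>2 *\<^sub>R u)"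
    using eig by (simp add: u_def matrix_vector_mult_scaleR)
  have "symplectic_J *v v = (1 / d) *\<^sub>R (A *v u)"
    by (simp add: v_def matrix_vector_mult_scaleR matrix_vector_mult_minus)
  then have 1: "A *v u = d *\<^sub>R (symplectic_J *v v)" using d by simp
  have "symplectic_J *v (A *v v) = d *\<^sub>R u"
    using d by (simp add: v_def matrix_vector_mult_scaleR matrix_vector_mult_minus eigu power2_eq_square)
  then have "symplectic_J *v (symplectic_J *v (A *v v)) = d *\<^sub>R (symplectic_J *v u)"
    by (simp only: matrix_vector_mult_scaleR)
  then have 2: "A *v v = - (d *\<^sub>R (symplectic_J *v u))" by (metis add.inverse_inverse symplectic_J_twice)
  have "u \<bullet> (A *v u) = sqrt (d / (x \<bullet> (A *v x))) * (sqrt (d / (x \<bullet> (A *v x))) * (x \<bullet> (A *v x)))"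
    by (simp only: u_def matrix_vector_mult_scaleR inner_scaleR_left inner_scaleR_right)
  also have "\<dots> = (sqrt (d / (x \<bullet> (A *v x))))\<^sup>2 * (x \<bullet> (A *v x))"
    by (simp only: power2_eq_square mult.assoc)
  also have "(sqrt (d / (x \<bullet> (A *v x))))\<^sup>2 = d / (x \<bullet> (A *v x))"
    using d pos by (intro real_sqrt_pow2) simp
  also have "d / (x \<bullet> (A *v x)) * (x \<bullet> (A *v x)) = d" using pos by simp
  finally have "williamson_pair A d u v"
    unfolding williamson_pair_def using 1 2 d by blast
  then show ?thesis by (simp only: v_def)
qed

section \<open>Analytic pairs and frames of invariant projections\<close>

type_synonym 'n pair_curve = "(real \<Rightarrow> real) \<times> (real \<Rightarrow> real ^ ('n + 'n)) \<times> (real \<Rightarrow> real ^ ('n + 'n))"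

locale analytic_positive_definite =
  fixes A :: "real \<Rightarrow> real ^ ('n::finite + 'n) ^ ('n + 'n)" and I :: "real set"
  assumes open_I: "open I" and connected_I: "connected I"
    and analytic_A: "\<And>t. t \<in> I \<Longrightarrow> real_analytic_at A t"
    and pd: "\<And>t. t \<in> I \<Longrightarrow> positive_definite (A t)"
begin

definition K where "K t = symplectic_J ** A t"

definition T where "T t = - (K t ** K t)"

lemma K_apply: "K t *v x = symplectic_J *v (A t *v x)"
  by (simp add: K_def matrix_vector_mul_assoc)

lemma T_apply: "T t *v x = - (K t *v (K t *v x))"
  by (simp add: T_def minus_matrix_vector_mult matrix_vector_mul_assoc)

lemma analytic_K: "t \<in> I \<Longrightarrow> real_analytic_at K t"
  unfolding K_def by (intro real_analytic_at_matrix_mult analytic_A) auto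

lemma analytic_T: "t \<in> I \<Longrightarrow> real_analytic_at T t"
  unfolding T_def by (intro real_analytic_at_minus real_analytic_at_matrix_mult analytic_K)

lemma K_skew: "t \<in> I \<Longrightarrow> x \<bullet> (A t *v (K t *v y)) = - ((K t *v x) \<bullet> (A t *v y))"
  using symplectic_hamiltonian_skew[OF pd] by (simp add: K_apply)

lemma K_isotropic: "t \<in> I \<Longrightarrow> x \<bullet> (A t *v (K t *v x)) = 0"
  using K_skew[of t x x] positive_definite_inner_commute[OF pd, of t "K t *v x" x] by simp

lemma K_eq_0: "t \<in> I \<Longrightarrow> K t *v x = 0 \<Longrightarrow> x = 0"
proof -
  assume t: "t \<in> I" and "K t *v x = 0"
  then have "symplectic_J *v (symplectic_J *v (A t *v x)) = 0" by (simp only: K_apply) simp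
  then have "A t *v x = 0" by simp
  then show "x = 0" using positive_definite_eq_0[OF pd[OF t], of x] by simp
qed

lemma self_adj_T: "t \<in> I \<Longrightarrow> self_adj (A t) (T t)"
  by (rule self_adjI) (simp add: T_apply matrix_vector_mult_minus K_skew)

lemma commute_T: "X ** K t = K t ** X \<Longrightarrow> X ** T t = T t ** X"
  unfolding T_def matrix_minus_left matrix_minus_right by (metis matrix_mul_assoc)

definition pair_curve :: "'n pair_curve \<Rightarrow> bool" where
  "pair_curve = (\<lambda>(d, u, v). \<forall>t\<in>I. real_analytic_at d t \<and> real_analytic_at u t \<and> real_analytic_at v t \<and>
     williamson_pair (A t) (d t) (u t) (v t))"

definition projection_of :: "'n pair_curve \<Rightarrow> real \<Rightarrow> real ^ ('n + 'n) ^ ('n + 'n)" where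
  "projection_of = (\<lambda>(d, u, v) t. pair_projection (A t) (d t) (u t) (v t))"

definition fixed_by :: "(real \<Rightarrow> real ^ ('n + 'n) ^ ('n + 'n)) \<Rightarrow> 'n pair_curve \<Rightarrow> bool" where
  "fixed_by P = (\<lambda>(d, u, v). \<forall>t\<in>I. P t *v u t = u t \<and> P t *v v t = v t)"

definition orthogonal_pairs :: "'n pair_curve \<Rightarrow> 'n pair_curve \<Rightarrow> bool" where
  "orthogonal_pairs = (\<lambda>(d, u, v) (d', u', v'). \<forall>t\<in>I.
     \<forall>x\<in>{u t, v t}. \<forall>y\<in>{u' t, v' t}. x \<bullet> (A t *v y) = 0)"

text \<open>\<open>sorted_wrt\<close> imposes orthogonality between each pair and the later ones;
  symmetry of \<open>A t\<close> gives the other half. The summation clause makes the planes exhaust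
  the range of \<open>P t\<close>.\<close>

definition frame :: "'n pair_curve list \<Rightarrow> (real \<Rightarrow> real ^ ('n + 'n) ^ ('n + 'n)) \<Rightarrow> bool" where
  "frame L P \<longleftrightarrow> (\<forall>p\<in>set L. pair_curve p \<and> fixed_by P p) \<and> sorted_wrt orthogonal_pairs L \<and>
     (\<forall>t\<in>I. P t = (\<Sum>p\<leftarrow>L. projection_of p t))"

definition invariant_projection :: "(real \<Rightarrow> real ^ ('n + 'n) ^ ('n + 'n)) \<Rightarrow> bool" where
  "invariant_projection P \<longleftrightarrow> (\<forall>t\<in>I. real_analytic_at P t \<and> P t ** P t = P t \<and> self_adj (A t) (P t) \<and>
     P t ** K t = K t ** P t)"

lemma frame_append:
  assumes L: "frame L1 Q" "frame L2 R"
    and Q: "\<And>t. t \<in> I \<Longrightarrow> self_adj (A t) (Q t)"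
    and QR: "\<And>t. t \<in> I \<Longrightarrow> Q t ** R t = 0" "\<And>t. t \<in> I \<Longrightarrow> R t ** Q t = 0"
  shows "frame (L1 @ L2) (\<lambda>t. Q t + R t)"
proof -
  have "fixed_by (\<lambda>t. Q t + R t) p" if "p \<in> set L1" for p
  proof -
    have "fixed_by Q p" using L(1) that by (auto simp: frame_def)
    moreover have "(Q t + R t) *v x = x" if "t \<in> I" "Q t *v x = x" for t x
    proof -
      have "R t *v x = (R t ** Q t) *v x" using that(2) by (simp flip: matrix_vector_mul_assoc)
      then show ?thesis using that QR(2) by (simp add: matrix_vector_mult_add_rdistrib)
    qed
    ultimately show ?thesis by (auto simp: fixed_by_def)
  qed
  moreover have "fixed_by (\<lambda>t. Q t + R t) p" if "p \<in> set L2" for p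
  proof -
    have "fixed_by R p" using L(2) that by (auto simp: frame_def)
    moreover have "(Q t + R t) *v x = x" if "t \<in> I" "R t *v x = x" for t x
    proof -
      have "Q t *v x = (Q t ** R t) *v x" using that(2) by (simp flip: matrix_vector_mul_assoc)
      then show ?thesis using that QR(1) by (simp add: matrix_vector_mult_add_rdistrib)
    qed
    ultimately show ?thesis by (auto simp: fixed_by_def)
  qed
  moreover have "orthogonal_pairs p q" if "p \<in> set L1" "q \<in> set L2" for p q
  proof -
    have "fixed_by Q p" "fixed_by R q" using L that by (auto simp: frame_def)
    moreover have "x \<bullet> (A t *v y) = 0" if t: "t \<in> I" "Q t *v x = x" "R t *v y = y" for t x y
    proof -
      have "x \<bullet> (A t *v y) = x \<bullet> (A t *v (Q t *v (R t *v y)))"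
        using self_adj_inner[OF Q[OF t(1)], of x y] t by simp
      then show ?thesis using QR(1)[OF t(1)] by (simp add: matrix_vector_mul_assoc flip: matrix_mul_assoc)
    qed
    ultimately show ?thesis by (auto simp: orthogonal_pairs_def fixed_by_def)
  qed
  ultimately show ?thesis
    using L by (auto simp: frame_def sorted_wrt_append)
qed

lemma real_analytic_on_I_zero:
  fixes f :: "real \<Rightarrow> 'b::euclidean_space"
  assumes "\<And>t. t \<in> I \<Longrightarrow> real_analytic_at f t" "a \<in> I" "\<forall>\<^sub>F t in nhds a. f t = 0" "x \<in> I"
  shows "f x = 0"
  using eventually_nhds_x_imp_x[OF real_analytic_identity[OF connected_I assms]] .

text \<open>The norm gap of idempotents makes \<open>P\<close> vanish near \<open>a\<close>, and the
  identity theorem does the rest. So a projection that is nonzero at one point is nonzero at all of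
  them.\<close>

lemma invariant_projection_zero:
  assumes P: "invariant_projection P" and "a \<in> I" "P a = 0" "x \<in> I"
  shows "P x = 0"
proof (rule real_analytic_on_I_zero)
  show "\<forall>\<^sub>F t in nhds a. P t = 0"
    using P assms(2,3) eventually_nhds_in_open[OF open_I assms(2)]
    by (intro idempotent_eventually_0 real_analytic_at_isCont)
       (auto simp: invariant_projection_def elim!: eventually_mono)
qed (use P assms in \<open>auto simp: invariant_projection_def\<close>)

lemma cancel_analytic_factor:
  fixes f :: "real \<Rightarrow> 'b::euclidean_space"
  assumes "\<forall>x\<in>I. \<forall>\<^sub>F t in at x. h t \<noteq> 0" "\<And>x. x \<in> I \<Longrightarrow> real_analytic_at f x"
    and "\<And>x. x \<in> I \<Longrightarrow> h x *\<^sub>R f x = 0" and x: "x \<in> I"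
  shows "f x = 0"
proof (rule real_analytic_cancel[OF bspec[OF assms(1) x] real_analytic_at_isCont[OF assms(2)[OF x]]])
  show "\<forall>\<^sub>F t in nhds x. h t *\<^sub>R f t = 0"
    using eventually_nhds_in_open[OF open_I x] by eventually_elim (rule assms(3))
qed

lemma frame_of_pair:
  assumes "pair_curve p"
  shows "frame [p] (projection_of p)" "invariant_projection (projection_of p)"
proof -
  obtain d u v where p: "p = (d, u, v)" by (cases p)
  have dv: "real_analytic_at d t" "real_analytic_at u t" "real_analytic_at v t"
    "williamson_pair (A t) (d t) (u t) (v t)" if "t \<in> I" for t
    using assms that by (auto simp: p pair_curve_def)
  show "frame [p] (projection_of p)"
    using assms dv(4) pair_projection_u[OF pd] pair_projection_v[OF pd]
    by (auto simp: frame_def fixed_by_def p projection_of_def)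
  have "real_analytic_at (\<lambda>t. pair_projection (A t) (d t) (u t) (v t)) t" if t: "t \<in> I" for t
    unfolding pair_projection_def using williamson_pair_d[OF pd dv(4), OF t t]
    by (intro real_analytic_at_scaleR real_analytic_at_divide real_analytic_at_add real_analytic_at_outer_product
        real_analytic_at_matrix_vector_mult dv analytic_A t) auto
  then show "invariant_projection (projection_of p)"
    using dv(4) pair_projection_idem[OF pd] self_adj_pair_projection[OF pd] pair_projection_commute[OF pd]
    by (auto simp: invariant_projection_def p projection_of_def K_def)
qed

lemma invariant_projection_diff:
  assumes P: "invariant_projection P" and Q: "invariant_projection Q"
    and PQ: "\<And>t. t \<in> I \<Longrightarrow> P t ** Q t = Q t" "\<And>t. t \<in> I \<Longrightarrow> Q t ** P t = Q t"
  shows "invariant_projection (\<lambda>t. P t - Q t)"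
  using P Q PQ unfolding invariant_projection_def
  by (auto intro!: real_analytic_at_diff self_adj_diff simp: matrix_distribs)

lemma frame_extend:
  assumes P: "invariant_projection P" and Q: "invariant_projection Q"
    and PQ: "\<And>t. t \<in> I \<Longrightarrow> P t ** Q t = Q t" "\<And>t. t \<in> I \<Longrightarrow> Q t ** P t = Q t"
    and L: "frame L1 Q" "frame L2 (\<lambda>t. P t - Q t)"
  shows "frame (L1 @ L2) P"
proof -
  have "frame (L1 @ L2) (\<lambda>t. Q t + (P t - Q t))"
    using Q PQ by (intro frame_append L) (auto simp: invariant_projection_def matrix_distribs)
  then show ?thesis by simp
qed

lemma eigenspace_pair:
  assumes Q: "invariant_projection Q" and l: "\<And>t. t \<in> I \<Longrightarrow> real_analytic_at l t"
    and TQ: "\<And>t. t \<in> I \<Longrightarrow> T t ** Q t = l t *\<^sub>R Q t" and t0: "t0 \<in> I" "Q t0 \<noteq> 0"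
  obtains p where "pair_curve p" "fixed_by Q p"
proof -
  have Qn: "Q t \<noteq> 0" if "t \<in> I" for t
    using invariant_projection_zero[OF Q that _ t0(1)] t0(2) by blast
  have an: "real_analytic_at Q t" and QQ: "Q t ** Q t = Q t" and QK: "Q t ** K t = K t ** Q t"
    if "t \<in> I" for t
    using Q that by (auto simp: invariant_projection_def)
  have lpos: "l t > 0" if t: "t \<in> I" for t
  proof -
    obtain x where x: "Q t *v x \<noteq> 0" using Qn[OF t] by (auto simp: matrix_eq)
    define y where "y = Q t *v x"
    have "T t *v y = l t *\<^sub>R y"
      using TQ[OF t] by (simp add: y_def matrix_vector_mul_assoc flip: scaleR_matrix_vector_assoc)
    then have "l t * (y \<bullet> (A t *v y)) = y \<bullet> (A t *v (T t *v y))"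
      by (simp add: matrix_vector_mult_scaleR)
    \<comment> \<open>Skewness turns - y . A K^2 y into the squared A-length of K y, which is
      positive because K is injective.\<close>
    also have "\<dots> = (K t *v y) \<bullet> (A t *v (K t *v y))"
      by (simp add: T_apply matrix_vector_mult_minus K_skew[OF t])
    also have "\<dots> > 0"
      using positive_definite_pos[OF pd[OF t]] K_eq_0[OF t] x by (auto simp: y_def)
    finally show ?thesis
      using positive_definite_pos[OF pd[OF t], of y] x by (simp add: y_def zero_less_mult_iff)
  qed
  obtain w0 where w0: "Q t0 *v w0 \<noteq> 0" using t0(2) by (auto simp: matrix_eq)
  \<comment> \<open>\<open>K t0\<close> supplies the second direction: from K y = c y and y . A K y
    = 0 follows c = 0, against injectivity of K.\<close>
  have "Q t0 *v (K t0 *v w0) \<noteq> c *\<^sub>R (Q t0 *v w0)" for c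
  proof
    let ?y = "Q t0 *v w0"
    assume "Q t0 *v (K t0 *v w0) = c *\<^sub>R ?y"
    then have Ky: "K t0 *v ?y = c *\<^sub>R ?y" using QK[OF t0(1)] by (simp add: matrix_vector_mul_assoc)
    have "c * (?y \<bullet> (A t0 *v ?y)) = ?y \<bullet> (A t0 *v (K t0 *v ?y))"
      by (simp add: Ky matrix_vector_mult_scaleR)
    also have "\<dots> = 0" by (rule K_isotropic[OF t0(1)])
    finally have "c = 0" using positive_definite_pos[OF pd[OF t0(1)] w0] by simp
    with Ky have "?y = 0" using K_eq_0[OF t0(1)] by simp
    with w0 show False ..
  qed
  then obtain w where w: "\<And>t. t \<in> I \<Longrightarrow> Q t *v w \<noteq> 0"
    using nonvanishing_vector[OF open_I connected_I an Qn t0(1) w0] by metis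
  define x where "x t = Q t *v w" for t
  define d where "d t = sqrt (l t)" for t
  define u where "u t = sqrt (d t / (x t \<bullet> (A t *v x t))) *\<^sub>R x t" for t
  define v where "v t = - ((1 / d t) *\<^sub>R (symplectic_J *v (A t *v u t)))" for t
  have dpos: "d t > 0" if "t \<in> I" for t using lpos[OF that] by (simp add: d_def)
  have xpos: "x t \<bullet> (A t *v x t) > 0" if "t \<in> I" for t
    using positive_definite_pos[OF pd[OF that] w[OF that]] by (simp add: x_def)
  have an_x: "real_analytic_at x t" if "t \<in> I" for t
    unfolding x_def by (intro real_analytic_at_matrix_vector_mult an that) auto
  have an_d: "real_analytic_at d t" if "t \<in> I" for t
    unfolding d_def by (intro real_analytic_at_sqrt l lpos that)
  have an_u: "real_analytic_at u t" if t: "t \<in> I" for t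
    unfolding u_def using dpos[OF t] xpos[OF t]
    by (intro real_analytic_at_scaleR real_analytic_at_sqrt real_analytic_at_divide an_d an_x t
        real_analytic_at_inner real_analytic_at_matrix_vector_mult analytic_A) auto
  have an_v: "real_analytic_at v t" if t: "t \<in> I" for t
    unfolding v_def using dpos[OF t]
    by (intro real_analytic_at_minus real_analytic_at_scaleR real_analytic_at_divide an_d an_u t
        real_analytic_at_matrix_vector_mult analytic_A) auto
  have "williamson_pair (A t) (d t) (u t) (v t)" if t: "t \<in> I" for t
    unfolding u_def v_def
  proof (rule williamson_pairI[OF pd[OF t] dpos[OF t]])
    show "x t \<noteq> 0" using w[OF t] by (simp add: x_def)
    have "T t *v x t = l t *\<^sub>R x t"
      using TQ[OF t] by (simp add: x_def matrix_vector_mul_assoc flip: scaleR_matrix_vector_assoc)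
    then have "- (T t *v x t) = - ((d t)\<^sup>2 *\<^sub>R x t)" using lpos[OF t] by (simp add: d_def)
    then show "symplectic_J *v (A t *v (symplectic_J *v (A t *v x t))) = - ((d t)\<^sup>2 *\<^sub>R x t)"
      by (simp add: T_apply K_apply)
  qed
  then have "pair_curve (d, u, v)"
    using an_d an_u an_v by (simp add: pair_curve_def)
  moreover have "fixed_by Q (d, u, v)"
  proof -
    have Qu: "Q t *v u t = u t" if "t \<in> I" for t
      using QQ[OF that] by (simp add: u_def x_def matrix_vector_mult_scaleR matrix_vector_mul_assoc)
    moreover have "Q t *v v t = v t" if t: "t \<in> I" for t
    proof -
      have "Q t *v (K t *v u t) = K t *v (Q t *v u t)"
        using QK[OF t] by (simp add: matrix_vector_mul_assoc)
      then show ?thesis using Qu[OF t]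
        by (simp add: v_def K_apply matrix_vector_mult_scaleR matrix_vector_mult_minus)
    qed
    ultimately show ?thesis by (simp add: fixed_by_def)
  qed
  ultimately show thesis using that by blast
qed

text \<open>Measuring the rank at the single point \<open>t0\<close> suffices: if the projection is
  nonzero there it yields a pair on all of \<open>I\<close>, and if it is zero there it vanishes on
  all of \<open>I\<close>.\<close>

lemma frame_eigenspace:
  assumes t0: "t0 \<in> I" and l: "\<And>t. t \<in> I \<Longrightarrow> real_analytic_at l t"
    and Q: "invariant_projection Q" "\<And>t. t \<in> I \<Longrightarrow> T t ** Q t = l t *\<^sub>R Q t"
  shows "\<exists>L. frame L Q"
  using Q
proof (induction "dim (range ((*v) (Q t0)))" arbitrary: Q rule: less_induct)
  case less
  note Q = less.prems
  show ?case
  proof (cases "Q t0 = 0")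
    case True
    then have "Q t = 0" if "t \<in> I" for t
      using invariant_projection_zero[OF Q(1) t0 _ that] by blast
    then have "frame [] Q" by (simp add: frame_def)
    then show ?thesis by blast
  next
    case False
    obtain p where p: "pair_curve p" "fixed_by Q p"
      using eigenspace_pair[OF Q(1) l Q(2) t0 False] by blast
    define R where "R = projection_of p"
    have R: "frame [p] R" "invariant_projection R"
      using frame_of_pair[OF p(1)] by (simp_all add: R_def)
    have QR: "Q t ** R t = R t" "R t ** Q t = R t" if "t \<in> I" for t
      using p that pair_projection_absorb_left[OF pd] pair_projection_absorb_right[OF pd] Q(1)
      by (auto simp: R_def projection_of_def pair_curve_def fixed_by_def invariant_projection_def split: prod.splits)
    have "R t0 \<noteq> 0"
    proof
      assume "R t0 = 0"
      then have "trace (R t0) = 0" by (simp add: trace_def)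
      moreover have "trace (R t0) = 2"
        using p(1) t0 trace_pair_projection[OF pd] by (auto simp: R_def projection_of_def pair_curve_def split: prod.splits)
      ultimately show False by simp
    qed
    have inv: "invariant_projection (\<lambda>t. Q t - R t)"
      by (rule invariant_projection_diff[OF Q(1) R(2) QR])
    have "dim (range ((*v) (Q t0 - R t0))) < dim (range ((*v) (Q t0)))"
      using QR[OF t0] \<open>R t0 \<noteq> 0\<close> Q(1) R(2) t0
      by (intro dim_range_idempotent_less) (auto simp: invariant_projection_def matrix_distribs)
    moreover have "T t ** (Q t - R t) = l t *\<^sub>R (Q t - R t)" if t: "t \<in> I" for t
    proof -
      have "T t ** R t = (T t ** Q t) ** R t" using QR(1)[OF t] by (simp flip: matrix_mul_assoc)
      then show ?thesis using Q(2)[OF t] QR(1)[OF t] by (simp add: matrix_distribs scaleR_diff_right)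
    qed
    ultimately obtain L where L: "frame L (\<lambda>t. Q t - R t)"
      using less.hyps[of "\<lambda>t. Q t - R t"] inv by blast
    have "frame ([p] @ L) Q" by (rule frame_extend[OF Q(1) R(2) QR R(1) L])
    then show ?thesis by blast
  qed
qed

end

lemma trace_sum_list: "trace (\<Sum>p\<leftarrow>L. M p) = (\<Sum>p\<leftarrow>L. trace (M p))"
  for M :: "'b \<Rightarrow> real ^ 'm::finite ^ 'm"
  by (induction L) (auto simp: trace_add trace_0[simplified])

section \<open>Splitting off one eigenvalue function at a time\<close>

context analytic_positive_definite
begin

lemma spectral_factor:
  assumes an_L: "\<forall>l\<in>set (l0 # L). \<forall>t\<in>I. real_analytic_at l t"
    and P: "invariant_projection P"
    and zero_L: "\<forall>t\<in>I. matrix_prod (T t) (map (\<lambda>l. l t) (l0 # L)) ** P t = 0"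
  obtains (trivial) "\<And>t. t \<in> I \<Longrightarrow> matrix_prod (T t) (map (\<lambda>l. l t) L) ** P t = 0"
  | (projection) Q where "invariant_projection Q" "\<And>t. t \<in> I \<Longrightarrow> T t ** Q t = l0 t *\<^sub>R Q t"
      "\<And>t. t \<in> I \<Longrightarrow> P t ** Q t = Q t" "\<And>t. t \<in> I \<Longrightarrow> Q t ** P t = Q t"
      "\<And>t. t \<in> I \<Longrightarrow> matrix_prod (T t) (map (\<lambda>l. l t) L) ** (P t - Q t) = 0"
proof -
  have L: "real_analytic_at l t" if "l \<in> set L" "t \<in> I" for l t
    using an_L that by simp
  have l0: "real_analytic_at l0 t" if "t \<in> I" for t
    using an_L that by simp
  have zero: "matrix_prod (T t) (l0 t # map (\<lambda>l. l t) L) ** P t = 0" if "t \<in> I" for t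
    using zero_L that by simp
  define M where "M t = matrix_prod (T t) (map (\<lambda>l. l t) L)" for t
  define f where "f t = M t ** P t" for t
  define h where "h t = (\<Prod>l\<leftarrow>L. l0 t - l t)" for t
  have an_P: "real_analytic_at P t" and PP: "P t ** P t = P t" and saP: "self_adj (A t) (P t)"
    and PK: "P t ** K t = K t ** P t" if "t \<in> I" for t
    using P that by (auto simp: invariant_projection_def)
  have PT: "P t ** T t = T t ** P t" if "t \<in> I" for t using commute_T[OF PK[OF that]] .
  have PM: "P t ** M t = M t ** P t" if "t \<in> I" for t
    unfolding M_def by (rule matrix_prod_commute[OF PT[OF that]])
  have KM: "K t ** M t = M t ** K t" for t
    unfolding M_def by (rule matrix_prod_commute, rule commute_T) simp
  have an_f: "real_analytic_at f t" if "t \<in> I" for t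
    unfolding f_def M_def
    by (intro real_analytic_at_matrix_mult real_analytic_at_matrix_prod analytic_T an_P that L)
  have an_h: "real_analytic_at h t" if t: "t \<in> I" for t
  proof -
    have "real_analytic_at (\<lambda>s. \<Prod>l\<leftarrow>L'. l0 s - l s) t" if "set L' \<subseteq> set L" for L'
      using that by (induction L') (auto intro!: real_analytic_at_mult real_analytic_at_diff l0 t intro: L)
    then show ?thesis unfolding h_def by simp
  qed
  have saM: "self_adj (A t) (M t)" if "t \<in> I" for t
    unfolding M_def by (intro self_adj_matrix_prod positive_definite_symmetric pd self_adj_T that)
  have saf: "self_adj (A t) (f t)" if "t \<in> I" for t
    unfolding f_def using PM[OF that] by (intro self_adj_mult saM saP that) simp
  have Tf: "T t ** f t = l0 t *\<^sub>R f t" and ff: "f t ** f t = h t *\<^sub>R f t" if t: "t \<in> I" for t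
    using spectral_peel[OF PP[OF t] PT[OF t] zero[OF t]] by (simp_all add: f_def M_def h_def comp_def)
  have Pf: "P t ** f t = f t" and fP: "f t ** P t = f t" and fK: "f t ** K t = K t ** f t" if t: "t \<in> I" for t
  proof -
    show "f t ** P t = f t" using PP[OF t] by (simp add: f_def flip: matrix_mul_assoc)
    have "P t ** f t = M t ** (P t ** P t)" by (simp add: f_def matrix_mul_assoc PM[OF t])
    then show "P t ** f t = f t" using PP[OF t] by (simp add: f_def)
    have "f t ** K t = (M t ** K t) ** P t" using PK[OF t] by (simp add: f_def flip: matrix_mul_assoc)
    then show "f t ** K t = K t ** f t" by (simp add: f_def KM[symmetric] matrix_mul_assoc)
  qed
  show thesis
  proof (cases "\<exists>a\<in>I. h a \<noteq> 0")
    case False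
    have "f t = 0" if t: "t \<in> I" for t
      using self_adj_square_eq_0[OF pd[OF t] saf[OF t]] ff[OF t] False t by auto
    then show thesis using trivial by (simp add: f_def M_def)
  next
    case True
    then obtain a where a: "a \<in> I" "h a \<noteq> 0" by blast
    have h0: "\<forall>x\<in>I. \<forall>\<^sub>F t in at x. h t \<noteq> 0"
      by (intro ballI real_analytic_nonzero_eventually_at[OF connected_I an_h a])
    have "\<exists>g. real_analytic_at g x \<and> (\<forall>\<^sub>F t in nhds x. f t = h t *\<^sub>R g t)" if x: "x \<in> I" for x
      using eventually_nhds_in_open[OF open_I x]
      by (intro idempotent_quotient_local[where A = A] analytic_A pd an_f an_h bspec[OF h0] x)
         (auto elim!: eventually_mono intro: saf ff)
    then obtain Q where an_Q: "\<And>x. x \<in> I \<Longrightarrow> real_analytic_at Q x" and fQ: "\<And>x. x \<in> I \<Longrightarrow> f x = h x *\<^sub>R Q x"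
      using real_analytic_quotient[of I h f] h0 by blast
    note cancel = cancel_analytic_factor[OF h0]
    note an = real_analytic_at_diff real_analytic_at_matrix_mult real_analytic_at_transpose
      real_analytic_at_scaleR an_Q an_P analytic_K analytic_T analytic_A l0 an_h
    \<comment> \<open>Substituting f = h Q in f^2 = h f gives h^2 (Q^2 - Q) = 0, so \<open>h\<close>
      is cancelled twice.\<close>
    have QQ: "Q t ** Q t - Q t = 0" if "t \<in> I" for t
    proof (rule cancel[OF _ _ that])
      fix x assume x: "x \<in> I"
      show "h x *\<^sub>R (Q x ** Q x - Q x) = 0"
      proof (rule cancel[OF _ _ x])
        fix x assume x: "x \<in> I"
        show "h x *\<^sub>R (h x *\<^sub>R (Q x ** Q x - Q x)) = 0"
          using ff[OF x] by (simp add: fQ[OF x] matrix_distribs scaleR_diff_right)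
      qed (intro an; assumption)+
    qed (intro an; assumption)+
    have saQ: "transpose (Q t) ** A t - A t ** Q t = 0" if "t \<in> I" for t
      by (rule cancel[OF _ _ that], (intro an; assumption)+)
         (use saf in \<open>simp add: self_adj_def fQ transpose_scalar matrix_distribs scaleR_diff_right\<close>)
    have QK: "Q t ** K t - K t ** Q t = 0" if "t \<in> I" for t
      by (rule cancel[OF _ _ that], (intro an; assumption)+)
         (use fK in \<open>simp add: fQ matrix_distribs scaleR_diff_right\<close>)
    have TQ: "T t ** Q t - l0 t *\<^sub>R Q t = 0" if "t \<in> I" for t
      by (rule cancel[OF _ _ that], (intro an; assumption)+)
         (use Tf in \<open>simp add: fQ matrix_distribs scaleR_diff_right mult.commute\<close>)
    have PQ: "P t ** Q t - Q t = 0" if "t \<in> I" for t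
      by (rule cancel[OF _ _ that], (intro an; assumption)+)
         (use Pf in \<open>simp add: fQ matrix_distribs scaleR_diff_right\<close>)
    have QP: "Q t ** P t - Q t = 0" if "t \<in> I" for t
      by (rule cancel[OF _ _ that], (intro an; assumption)+)
         (use fP in \<open>simp add: fQ matrix_distribs scaleR_diff_right\<close>)
    have "invariant_projection Q"
      using an_Q QQ saQ QK by (simp add: invariant_projection_def self_adj_def)
    moreover have TQ': "T t ** Q t = l0 t *\<^sub>R Q t" if "t \<in> I" for t using TQ[OF that] by simp
    \<comment> \<open>M P = f = h Q by construction, and M Q = h Q because T acts on Q as
      \<open>l0\<close>.\<close>
    moreover have "M t ** (P t - Q t) = 0" if t: "t \<in> I" for t
      using matrix_prod_eigen[OF TQ'[OF t], of "map (\<lambda>l. l t) L"] fQ[OF t]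
      by (simp add: matrix_distribs f_def M_def h_def comp_def)
    ultimately show thesis
      using projection PQ QP by (simp add: M_def)
  qed
qed

text \<open>Each root function is either dropped or splits off its eigenprojection, and on the
  complement the shorter list annihilates T.\<close>

lemma frame_exists:
  assumes I: "I \<noteq> {}" and L: "\<forall>l\<in>set L. \<forall>t\<in>I. real_analytic_at l t"
    and P: "invariant_projection P" "\<forall>t\<in>I. matrix_prod (T t) (map (\<lambda>l. l t) L) ** P t = 0"
  shows "\<exists>F. frame F P"
  using L P
proof (induction L arbitrary: P)
  case Nil
  then have "frame [] P" by (simp add: frame_def)
  then show ?case by blast
next
  case (Cons l0 L)
  from Cons.prems show ?case
  proof (cases rule: spectral_factor)
    case trivial
    then show ?thesis using Cons.IH[OF _ Cons.prems(2)] Cons.prems(1) by simp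
  next
    case (projection Q)
    obtain t0 where t0: "t0 \<in> I" using I by blast
    have "\<exists>F1. frame F1 Q"
      by (rule frame_eigenspace[OF t0 _ projection(1,2)]) (use Cons.prems(1) in auto)
    moreover have "\<exists>F2. frame F2 (\<lambda>t. P t - Q t)"
    proof (rule Cons.IH)
      show "invariant_projection (\<lambda>t. P t - Q t)"
        by (rule invariant_projection_diff[OF Cons.prems(2) projection(1,3,4)])
    qed (use Cons.prems(1) projection(5) in auto)
    ultimately obtain F1 F2 where "frame F1 Q" "frame F2 (\<lambda>t. P t - Q t)" by blast
    then have "frame (F1 @ F2) P"
      by (intro frame_extend[OF Cons.prems(2) projection(1)] projection(3,4))
    then show ?thesis by blast
  qed
qed

lemma full_frame:
  assumes I: "I \<noteq> {}"
  obtains F where "frame F (\<lambda>_. mat 1)" "length F = CARD('n)"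
proof -
  obtain L where L: "\<And>l t. l \<in> set L \<Longrightarrow> t \<in> I \<Longrightarrow> real_analytic_at l t"
    "\<And>t. t \<in> I \<Longrightarrow> matrix_prod (T t) (map (\<lambda>l. l t) L) = 0"
  proof (rule global_eigenvalues[of I A T, OF open_I connected_I I])
    fix L assume "\<And>l t. l \<in> set L \<Longrightarrow> t \<in> I \<Longrightarrow> real_analytic_at l t"
      "\<And>t. t \<in> I \<Longrightarrow> matrix_prod (T t) (map (\<lambda>l. l t) L) = 0"
    then show thesis by (rule that)
  qed (auto intro: analytic_A pd analytic_T self_adj_T)
  have "invariant_projection (\<lambda>_. mat 1)"
    using self_adj_mat_1[OF positive_definite_symmetric[OF pd]] by (auto simp: invariant_projection_def)
  then have "\<exists>F. frame F (\<lambda>_. mat 1)"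
    by (intro frame_exists[OF I, of L]) (simp_all add: L)
  then obtain F where F: "frame F (\<lambda>_. mat 1)" ..
  obtain t where t: "t \<in> I" using I by blast
  have "trace (projection_of p t) = 2" if "p \<in> set F" for p
    using F that t trace_pair_projection[OF pd]
    by (auto simp: frame_def projection_of_def pair_curve_def split: prod.splits)
  then have "(\<Sum>p\<leftarrow>F. trace (projection_of p t)) = (\<Sum>p\<leftarrow>F. 2)"
    by (intro arg_cong[where f = sum_list] map_cong) auto
  moreover have "mat 1 = (\<Sum>p\<leftarrow>F. projection_of p t)" using F t by (simp add: frame_def)
  \<comment> \<open>Every pair contributes trace 2 to an identity matrix of trace 2n.\<close>
  ultimately have "trace (mat 1 :: real ^ ('n + 'n) ^ ('n + 'n)) = 2 * real (length F)"
    by (simp add: trace_sum_list sum_list_triv)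
  then have "length F = CARD('n)" by (simp add: trace_I)
  with F that show thesis by blast
qed

lemma analytic_eigenbasis:
  assumes I: "I \<noteq> {}"
  obtains d :: "'n \<Rightarrow> real \<Rightarrow> real" and u v :: "'n \<Rightarrow> real \<Rightarrow> real ^ ('n + 'n)" where
    "\<And>i t. t \<in> I \<Longrightarrow> real_analytic_at (d i) t \<and> real_analytic_at (u i) t \<and> real_analytic_at (v i) t"
    "\<And>i t. t \<in> I \<Longrightarrow> d i t > 0"
    "\<And>t. t \<in> I \<Longrightarrow> symplectic_eigenbasis (A t) (\<lambda>i. d i t) (\<lambda>i. u i t) (\<lambda>i. v i t)"
proof -
  obtain F where F: "frame F (\<lambda>_. mat 1)" "length F = CARD('n)" using full_frame[OF I] .
  obtain e :: "'n \<Rightarrow> nat" where e: "bij_betw e UNIV {0..<CARD('n)}"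
    using ex_bij_betw_finite_nat[of "UNIV :: 'n set"] by auto
  have e_less: "e i < length F" for i using e F(2) by (auto simp: bij_betw_def)
  have e_inj: "i \<noteq> j \<Longrightarrow> e i \<noteq> e j" for i j using e by (auto simp: bij_betw_def inj_def)
  define d where "d i = fst (F ! e i)" for i
  define u where "u i = fst (snd (F ! e i))" for i
  define v where "v i = snd (snd (F ! e i))" for i
  have Fi: "F ! e i = (d i, u i, v i)" for i by (simp add: d_def u_def v_def)
  have "pair_curve (d i, u i, v i)" for i
    using F(1) nth_mem[OF e_less[of i]] by (auto simp: frame_def Fi)
  then have an: "real_analytic_at (d i) t \<and> real_analytic_at (u i) t \<and> real_analytic_at (v i) t"
    and pair: "williamson_pair (A t) (d i t) (u i t) (v i t)" if "t \<in> I" for i t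
    using that by (auto simp: pair_curve_def)
  have orth_less: "orthogonal_pairs (F ! e i) (F ! e j)" if "e i < e j" for i j
    using F(1) e_less[of j] that by (auto simp: frame_def sorted_wrt_iff_nth_less)
  have orth: "x \<bullet> (A t *v y) = 0" if t: "t \<in> I" and ij: "i \<noteq> j" and xy: "x \<in> {u i t, v i t}" "y \<in> {u j t, v j t}" for i j t x y
  proof (cases "e i < e j")
    case True
    from orth_less[OF this] show ?thesis unfolding Fi orthogonal_pairs_def using t xy by blast
  next
    case False
    then have "e j < e i" using e_inj[OF ij] by simp
    from orth_less[OF this] have "y \<bullet> (A t *v x) = 0" unfolding Fi orthogonal_pairs_def using t xy by blast
    then show ?thesis using positive_definite_inner_commute[OF pd[OF t], of x y] by simp
  qed
  have "symplectic_eigenbasis (A t) (\<lambda>i. d i t) (\<lambda>i. u i t) (\<lambda>i. v i t)" if t: "t \<in> I" for t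
  proof -
    note w = williamson_pair_d[OF pd[OF t] pair[OF t]]
    note Au = williamson_pair_u[OF pd[OF t] pair[OF t]] and Av = williamson_pair_v[OF pd[OF t] pair[OF t]]
    note diag = williamson_pair_uu[OF pd[OF t] pair[OF t]]
    \<comment> \<open>Since A u_j = d_j J v_j and A v_j = - d_j J u_j, dividing by d_j turns
      relations for A into relations for J.\<close>
    have "u i t \<bullet> (symplectic_J *v v j t) = (if i = j then 1 else 0)" for i j
    proof -
      have "d j t * (u i t \<bullet> (symplectic_J *v v j t)) = u i t \<bullet> (A t *v u j t)" by (simp add: Au)
      also have "\<dots> = (if i = j then d j t else 0)" using orth[OF t, of i j] diag by simp
      finally show ?thesis using w[of j] by (auto split: if_splits)
    qed
    moreover have "u i t \<bullet> (symplectic_J *v u j t) = 0" for i j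
    proof (cases "i = j")
      case False
      then have "u i t \<bullet> (A t *v v j t) = 0" using orth[OF t] by blast
      then show ?thesis using w[of j] by (simp add: Av)
    qed simp
    moreover have "v i t \<bullet> (symplectic_J *v v j t) = 0" for i j
    proof (cases "i = j")
      case False
      then have "v i t \<bullet> (A t *v u j t) = 0" using orth[OF t] by blast
      then show ?thesis using w[of j] by (simp add: Au)
    qed simp
    ultimately show ?thesis
      using Au Av by (simp add: symplectic_eigenbasis_def symplectic_basis_def)
  qed
  moreover have "d i t > 0" if "t \<in> I" for i t using williamson_pair_d[OF pd[OF that] pair[OF that]] .
  ultimately show thesis using that an by blast
qed

end

section \<open>Symplectic eigenvalues\<close>

abbreviation symplectic_diagonal :: "('n::finite \<Rightarrow> real) \<Rightarrow> real ^ ('n + 'n) ^ ('n + 'n)" where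
  "symplectic_diagonal d \<equiv> block_matrix (diagonal_matrix d) 0 0 (diagonal_matrix d)"

lemma prod_UNIV_Plus: "(\<Prod>j\<in>UNIV. f j) = (\<Prod>j\<in>UNIV. f (Inl j)) * (\<Prod>j\<in>UNIV. f (Inr j))"
  for f :: "'n::finite + 'n \<Rightarrow> real"
  using prod.Plus[of UNIV UNIV f] by (simp add: UNIV_Plus_UNIV comp_def)

lemma symplectic_diagonal_vec_nth:
  "(symplectic_diagonal d *v x) $ Inl i = d i * x $ Inl i"
  "(symplectic_diagonal d *v x) $ Inr i = d i * x $ Inr i"
  by (simp_all add: matrix_vector_mult_def block_matrix_def sum_UNIV_Plus diagonal_matrix_def
      if_distrib[of "\<lambda>a. a * _"] sum.delta' cong: if_cong)

text \<open>The source of uniqueness: symplecticity gives (J A) M = M (J D), so J A is similar to J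
  D, whose square is diagonal with each - d_i^2 occurring at two positions. The squares of the d_i
  are thus read off from A alone.\<close>

lemma det_williamson:
  fixes A :: "real ^ ('n::finite + 'n) ^ ('n + 'n)"
  assumes M: "symplectic_matrix M" "transpose M ** A ** M = symplectic_diagonal d"
  shows "det (x *\<^sub>R mat 1 + (symplectic_J ** A) ** (symplectic_J ** A)) = (\<Prod>i\<in>UNIV. x - (d i)\<^sup>2) * (\<Prod>i\<in>UNIV. x - (d i)\<^sup>2)"
proof -
  let ?J = "symplectic_J" and ?D = "symplectic_diagonal d"
  \<comment> \<open>The inverse of a symplectic matrix, read off from M^T J M = J and J^2 = -
    1.\<close>
  define N where "N = - (?J ** transpose M ** ?J)"
  define E where "E = x *\<^sub>R mat 1 + (?J ** ?D) ** (?J ** ?D)"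
  have "N ** M = - (?J ** (transpose M ** ?J ** M))"
    by (simp add: N_def matrix_minus_left matrix_mul_assoc)
  also have "\<dots> = mat 1"
    using M(1) by (simp add: symplectic_matrix_def symplectic_J_square)
  finally have NM: "N ** M = mat 1" .
  then have MN: "M ** N = mat 1" by (simp add: matrix_left_right_inverse)
  have NT: "transpose N ** transpose M = mat 1"
    using MN by (metis matrix_transpose_mul transpose_mat)
  have "A ** M = (transpose N ** transpose M) ** (A ** M)" by (simp add: NT)
  also have "\<dots> = transpose N ** (transpose M ** A ** M)" by (simp add: matrix_mul_assoc)
  also have "\<dots> = transpose N ** ?D" by (simp only: M(2))
  finally have AM: "A ** M = transpose N ** ?D" .
  have "?J ** transpose N = - ((?J ** ?J) ** M ** ?J)"
    by (simp add: N_def transpose_minus matrix_transpose_mul transpose_symplectic_J matrix_distribs matrix_mul_assoc)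
  then have JN: "?J ** transpose N = M ** ?J" by (simp add: symplectic_J_square matrix_minus_left)
  have "(?J ** A) ** M = ?J ** (A ** M)" by (simp only: matrix_mul_assoc)
  also have "\<dots> = (?J ** transpose N) ** ?D" by (simp only: AM matrix_mul_assoc)
  also have "\<dots> = M ** (?J ** ?D)" by (simp only: JN matrix_mul_assoc)
  finally have JAM: "(?J ** A) ** M = M ** (?J ** ?D)" .
  have "(?J ** A) ** (?J ** A) ** M = (?J ** A) ** ((?J ** A) ** M)" by (simp only: matrix_mul_assoc)
  also have "\<dots> = (?J ** A) ** (M ** (?J ** ?D))" by (simp only: JAM)
  also have "\<dots> = ((?J ** A) ** M) ** (?J ** ?D)" by (simp only: matrix_mul_assoc)
  also have "\<dots> = (M ** (?J ** ?D)) ** (?J ** ?D)" by (simp only: JAM)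
  also have "\<dots> = M ** ((?J ** ?D) ** (?J ** ?D))" by (simp only: matrix_mul_assoc)
  finally have "(?J ** A) ** (?J ** A) ** M = M ** ((?J ** ?D) ** (?J ** ?D))" .
  then have "(x *\<^sub>R mat 1 + (?J ** A) ** (?J ** A)) ** M = M ** E"
    by (simp add: E_def matrix_distribs)
  then have "det (x *\<^sub>R mat 1 + (?J ** A) ** (?J ** A)) * det M = det M * det E"
    by (metis det_mul)
  moreover have "det M \<noteq> 0" using NM det_mul[of N M] by auto
  ultimately have 1: "det (x *\<^sub>R mat 1 + (?J ** A) ** (?J ** A)) = det E" by simp
  define e where "e j = x - (case j of Inl i \<Rightarrow> (d i)\<^sup>2 | Inr i \<Rightarrow> (d i)\<^sup>2)" for j
  have diag: "((\<chi> i j. if i = j then e i else 0) *v z) $ a = e a * z $ a" for z :: "real ^ ('n + 'n)" and a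
    by (simp add: matrix_vector_mult_def if_distrib[of "\<lambda>a. a * _"] cong: if_cong)
  have "E *v z = (\<chi> i j. if i = j then e i else 0) *v z" for z
    by (simp add: vec_eq_sum_iff E_def matrix_vector_mult_add_rdistrib symplectic_diagonal_vec_nth diag
        flip: matrix_vector_mul_assoc scaleR_matrix_vector_assoc)
       (simp add: e_def power2_eq_square algebra_simps)
  then have E: "E = (\<chi> i j. if i = j then e i else 0)" by (simp add: matrix_eq)
  have "det E = (\<Prod>j\<in>UNIV. e j)"
    unfolding E by (subst det_diagonal) auto
  then show ?thesis unfolding 1 by (simp add: prod_UNIV_Plus e_def)
qed

text \<open>Root multisets of polynomials add under multiplication, so the doubled multisets agree,
  and multiplicities can be halved.\<close>

lemma prod_square_eq_imp_image_mset_eq: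
  fixes f g :: "'n::finite \<Rightarrow> real"
  assumes "\<And>x. (\<Prod>i\<in>UNIV. x - f i) * (\<Prod>i\<in>UNIV. x - f i) = (\<Prod>i\<in>UNIV. x - g i) * (\<Prod>i\<in>UNIV. x - g i)"
  shows "image_mset f (mset_set UNIV) = image_mset g (mset_set UNIV)"
proof -
  define p where "p h = (\<Prod>i\<in>UNIV. [:- h i, 1:])" for h :: "'n \<Rightarrow> real"
  have p0: "p h \<noteq> 0" for h by (simp add: p_def)
  have roots: "proots (p h) = image_mset h (mset_set UNIV)" for h
  proof -
    have "(\<Sum>i\<in>S. {#h i#}) = image_mset h (mset_set S)" if "finite S" for S
      using that by induction auto
    then show ?thesis by (simp add: p_def proots_prod)
  qed
  have "poly (p h) x = (\<Prod>i\<in>UNIV. x - h i)" for h x by (simp add: p_def poly_prod)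
  then have "poly (p f * p f) = poly (p g * p g)" using assms by auto
  then have "p f * p f = p g * p g" by (simp only: poly_eq_poly_eq_iff)
  then have "proots (p f) + proots (p f) = proots (p g) + proots (p g)"
    by (metis p0 proots_mult)
  then have "count (proots (p f)) a = count (proots (p g)) a" for a
    by (metis add_left_cancel count_union mult_2 nat_mult_eq_cancel1 zero_less_numeral)
  then show ?thesis by (intro multiset_eqI) (simp flip: roots)
qed

lemma mono_image_mset_eq_imp_eq:
  fixes f g :: "'n::{finite, linorder} \<Rightarrow> real"
  assumes "mono f" "mono g" "image_mset f (mset_set UNIV) = image_mset g (mset_set UNIV)"
  shows "f = g"
proof -
  define xs where "xs = sorted_list_of_set (UNIV :: 'n set)"
  have xs: "sorted xs" "set xs = UNIV" "mset xs = mset_set UNIV"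
    using mset_set_set[of xs] by (simp_all add: xs_def)
  have "sorted (map f xs)" "sorted (map g xs)"
    using assms(1,2) xs(1) by (auto simp: sorted_map mono_def elim!: sorted_wrt_mono_rel[rotated])
  moreover have "mset (map f xs) = mset (map g xs)" using assms(3) xs(3) by simp
  ultimately have "map f xs = map g xs" by (metis properties_for_sort)
  then show ?thesis using xs(2) by (auto simp: fun_eq_iff)
qed

lemma ex_bij_mono_comp:
  fixes d :: "'n::{finite, linorder} \<Rightarrow> real"
  obtains \<pi> :: "'n \<Rightarrow> 'n" where "bij \<pi>" "mono (d \<circ> \<pi>)"
proof -
  define zs where "zs = sort_key d (sorted_list_of_set (UNIV :: 'n set))"
  have zs: "sorted (map d zs)" "distinct zs" "length zs = CARD('n)"
    by (simp_all add: zs_def)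
  \<comment> \<open>The position of \<open>i\<close> in the linear order, counted from 0;
    \<open>zs ! r i\<close> is then the index with the corresponding place in the order of the
    values of \<open>d\<close>.\<close>
  define r where "r i = card {j. j < i}" for i :: 'n
  have less: "r i < length zs" for i
    unfolding zs(3) r_def by (intro psubset_card_mono) auto
  have strict: "r i < r j" if "i < j" for i j
    unfolding r_def using that by (intro psubset_card_mono) auto
  have inj_r: "inj r"
    by (rule injI) (metis less_irrefl linorder_neqE strict)
  have "inj (\<lambda>i. zs ! r i)"
    using inj_r less zs(2) by (auto simp: inj_def nth_eq_iff_index_eq)
  then have "bij (\<lambda>i. zs ! r i)" by (simp add: bij_def finite_UNIV_inj_surj)
  moreover have "mono (d \<circ> (\<lambda>i. zs ! r i))"
  proof (rule monoI)
    fix i j :: 'n assume "i \<le> j"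
    then have "r i \<le> r j" using strict by (cases "i = j") (auto intro: less_imp_le)
    then show "(d \<circ> (\<lambda>i. zs ! r i)) i \<le> (d \<circ> (\<lambda>i. zs ! r i)) j"
      using sorted_nth_mono[OF zs(1), of "r i" "r j"] less by simp
  qed
  ultimately show thesis using that by blast
qed

lemma transpose_mult_mult_nth:
  "(transpose M ** X ** M) $ a $ b = column a M \<bullet> (X *v column b M)" for X M :: "real ^ 'm::finite ^ 'm"
proof -
  have "(transpose M ** (X ** M)) $ a $ b = column a M \<bullet> (X *v column b M)"
    by (simp add: matrix_matrix_mult_def matrix_vector_mult_def transpose_def column_def inner_vec_def)
  then show ?thesis by (simp add: matrix_mul_assoc)
qed

text \<open>The columns of \<open>M\<close> are the \<open>u i\<close> followed by the
  \<open>v i\<close>, so the entries of M^T J M and M^T A M are the pairings between basis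
  vectors.\<close>

lemma symplectic_eigenbasis_matrix:
  fixes A :: "real ^ ('n::finite + 'n) ^ ('n + 'n)"
  assumes "symplectic_eigenbasis A d u v"
  obtains M where "symplectic_matrix M" "transpose M ** A ** M = symplectic_diagonal d"
proof -
  define M :: "real ^ ('n + 'n) ^ ('n + 'n)" where
    "M = (\<chi> k j. case j of Inl i \<Rightarrow> u i $ k | Inr i \<Rightarrow> v i $ k)"
  have col: "column (Inl i) M = u i" "column (Inr i) M = v i" for i
    by (simp_all add: M_def column_def vec_eq_iff)
  have uv: "u i \<bullet> (symplectic_J *v v j) = (if i = j then 1 else 0)" "u i \<bullet> (symplectic_J *v u j) = 0"
    "v i \<bullet> (symplectic_J *v v j) = 0" "v i \<bullet> (symplectic_J *v u j) = (if i = j then -1 else 0)" for i j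
    using assms inner_symplectic_J_commute[of "v i" "u j"]
    by (auto simp: symplectic_eigenbasis_def symplectic_basis_def)
  have A: "A *v u i = d i *\<^sub>R (symplectic_J *v v i)" "A *v v i = - (d i *\<^sub>R (symplectic_J *v u i))" for i
    using assms by (auto simp: symplectic_eigenbasis_def)
  have "(transpose M ** symplectic_J ** M) $ a $ b = symplectic_J $ a $ b" for a b
    unfolding transpose_mult_mult_nth
    by (cases a; cases b) (auto simp: col uv, auto simp: symplectic_J_def block_matrix_def mat_def)
  then have "symplectic_matrix M" by (simp add: symplectic_matrix_def vec_eq_iff)
  moreover have "(transpose M ** A ** M) $ a $ b = symplectic_diagonal d $ a $ b" for a b
    unfolding transpose_mult_mult_nth
    by (cases a; cases b) (auto simp: col A uv, auto simp: block_matrix_def diagonal_matrix_def)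
  then have "transpose M ** A ** M = symplectic_diagonal d" by (simp add: vec_eq_iff)
  ultimately show thesis by (rule that)
qed

text \<open>The determinant identity fixes the multiset of squares, positivity the multiset of
  values, and monotonicity the function, so the definite description denotes
  \<open>d\<close>.\<close>

lemma symplectic_eigenvalue_eqI:
  fixes A :: "real ^ ('n::{finite, linorder} + 'n) ^ ('n + 'n)"
  assumes "\<And>i. 0 < d i" "mono d" "symplectic_matrix M" "transpose M ** A ** M = symplectic_diagonal d"
  shows "symplectic_eigenvalue A = d"
  unfolding symplectic_eigenvalue_def
proof (rule the_equality)
  fix e assume "(\<forall>i. 0 < e i) \<and> mono e \<and> (\<exists>M. symplectic_matrix M \<and> transpose M ** A ** M = symplectic_diagonal e)"
  then obtain M' where e: "\<And>i. 0 < e i" "mono e" and M': "symplectic_matrix M'" "transpose M' ** A ** M' = symplectic_diagonal e"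
    by blast
  have "image_mset (\<lambda>i. (e i)\<^sup>2) (mset_set UNIV) = image_mset (\<lambda>i. (d i)\<^sup>2) (mset_set UNIV)"
    by (rule prod_square_eq_imp_image_mset_eq)
       (simp only: det_williamson[OF M', symmetric] det_williamson[OF assms(3,4), symmetric])
  then have "image_mset sqrt (image_mset (\<lambda>i. (e i)\<^sup>2) (mset_set UNIV)) = image_mset sqrt (image_mset (\<lambda>i. (d i)\<^sup>2) (mset_set UNIV))"
    by (rule arg_cong)
  then have "image_mset e (mset_set UNIV) = image_mset d (mset_set UNIV)"
    using e(1) assms(1) by (simp add: multiset.map_comp comp_def less_imp_le)
  then show "e = d" by (rule mono_image_mset_eq_imp_eq[OF e(2) assms(2)])
qed (use assms in blast)

text \<open>Analytic eigenvalue functions may cross and so come unordered; a permutation of the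
  eigenbasis for this one matrix sorts them without changing the multiset.\<close>

lemma symplectic_eigenbasis_image_mset:
  fixes A :: "real ^ ('n::{finite, linorder} + 'n) ^ ('n + 'n)"
  assumes "symplectic_eigenbasis A d u v" "\<And>i. 0 < d i"
  shows "image_mset d (mset_set UNIV) = image_mset (symplectic_eigenvalue A) (mset_set UNIV)"
proof -
  obtain \<pi> :: "'n \<Rightarrow> 'n" where \<pi>: "bij \<pi>" "mono (d \<circ> \<pi>)" using ex_bij_mono_comp .
  have "symplectic_eigenbasis A (d \<circ> \<pi>) (u \<circ> \<pi>) (v \<circ> \<pi>)"
    using assms(1) \<pi>(1) by (auto simp: symplectic_eigenbasis_def symplectic_basis_def bij_def inj_eq)
  then obtain M where "symplectic_matrix M" "transpose M ** A ** M = symplectic_diagonal (d \<circ> \<pi>)"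
    by (rule symplectic_eigenbasis_matrix)
  then have "symplectic_eigenvalue A = d \<circ> \<pi>"
    using assms(2) \<pi>(2) by (intro symplectic_eigenvalue_eqI) auto
  moreover have "image_mset \<pi> (mset_set UNIV) = mset_set UNIV"
    using \<pi>(1) by (simp add: image_mset_mset_set bij_def)
  ultimately show ?thesis by (metis multiset.map_comp)
qed

theorem theorem4p6:
  fixes A :: "real \<Rightarrow> real^('n::{finite,linorder} + 'n)^('n + 'n)"
    and I :: "real set"
  assumes "open I" and "is_interval I"
    and "\<And>t. t \<in> I \<Longrightarrow> positive_definite (A t)"
    and "real_analytic_on A I"
  shows "\<exists>(d :: 'n \<Rightarrow> real \<Rightarrow> real)
            (u :: 'n \<Rightarrow> real \<Rightarrow> real^('n + 'n))
            (v :: 'n \<Rightarrow> real \<Rightarrow> real^('n + 'n)).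
           (\<forall>i. real_analytic_on (d i) I \<and> real_analytic_on (u i) I \<and> real_analytic_on (v i) I) \<and>
           (\<forall>t\<in>I.
              image_mset (\<lambda>i. d i t) (mset_set UNIV) =
                image_mset (symplectic_eigenvalue (A t)) (mset_set UNIV) \<and>
              symplectic_eigenbasis (A t) (\<lambda>i. d i t) (\<lambda>i. u i t) (\<lambda>i. v i t))"
proof (cases "I = {}")
  \<comment> \<open>The empty interval is set aside because the construction starts from a base
    point of \<open>I\<close>.\<close>
  case True
  then show ?thesis by (simp add: real_analytic_on_def)
next
  case False
  interpret analytic_positive_definite A I
    using assms by unfold_locales (auto simp: real_analytic_on_iff_at is_interval_connected)
  obtain d :: "'n \<Rightarrow> real \<Rightarrow> real" and u v :: "'n \<Rightarrow> real \<Rightarrow> real ^ ('n + 'n)" where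
    an: "\<And>i t. t \<in> I \<Longrightarrow> real_analytic_at (d i) t \<and> real_analytic_at (u i) t \<and> real_analytic_at (v i) t"
    and d: "\<And>i t. t \<in> I \<Longrightarrow> d i t > 0"
    and basis: "\<And>t. t \<in> I \<Longrightarrow> symplectic_eigenbasis (A t) (\<lambda>i. d i t) (\<lambda>i. u i t) (\<lambda>i. v i t)"
    using analytic_eigenbasis[OF False] by blast
  show ?thesis
    using an basis symplectic_eigenbasis_image_mset[OF basis d]
    by (intro exI[of _ d] exI[of _ u] exI[of _ v]) (auto simp: real_analytic_on_iff_at)
qed

end
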